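(* Let $n\ge1$ and $\psi\in\mathcal{T}_n^0$. For $t>0$ put $F_t(\lambda)=e^{t\psi(i\lambda)}\psi(i\lambda)$, $\lambda\in\mathbb{R}^n$. Suppose that for every $t>0$ the Fourier transform $p_t=\mathcal{F}(F_t)$ belongs to $L^1(\mathbb{R}^n)$ and is concentrated on $\mathbb{R}_+^n$, and put $J_t(\psi)=\int_{\mathbb{R}_+^n}|(\mathcal{F}F_t)(u)|\,du$. If $$\limsup_{t\to0+}tJ_t(\psi)<\infty,$$ then $\psi\in\mathcal{T}_n^Y$ (i.e. for every complex Banach space $X$ and every $n$-tuple $A$ of commuting generators of bounded $C_0$-semigroups on $X$, $\psi(A)$ is the generator of a quasibounded holomorphic semigroup $g(A)$ in $X$).
   Context: $\mathbb{R}_+=[0,\infty)$. $\mathcal{F}$ is the Fourier transform on $\mathbb{R}^n$ in the sense of (tempered) distributions, normalized so that $F(y)=(2\pi)^{-n/2}\int(\mathcal{F}F)(u)e^{iy\cdot u}\,du$ when $\mathcal{F}F\in L^1$. $\mathcal{T}_n$ is the set of nonpositive $\psi\in C^\infty((-\infty,0)^n)$ all of whose first partial derivatives are absolutely monotone (nonnegative together with all their partial derivatives of all orders). Every $\psi\in\mathcal{T}_n$ has a representation $\psi(s)=c_0+c_1\cdot s+\int_{\mathbb{R}_+^n\setminus\{0\}}(e^{s\cdot v}-1)\,d\mu(v)$ with $c_0=\lim_{s\to-0}\psi(s)$, $c_1\in\mathbb{R}_+^n$ and a positive measure $\mu$ on $\mathbb{R}_+^n\setminus\{0\}$, all determined by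 $\psi$; the same formula extends $\psi$ to a function holomorphic in $\{z\in\mathbb{C}^n:\mathrm{Re}\,z_j<0\ \forall j\}$ and continuous on the closure of this set. $\mathcal{T}_n^0$ is the subclass with $c_0=0$, $c_1=0$. For $\psi\in\mathcal{T}_n^0$ and $t\ge0$, $\nu_t$ is the unique probability measure on $\mathbb{R}_+^n$ with $\int e^{z\cdot u}d\nu_t(u)=e^{t\psi(z)}$, $z\in(-\infty,0)^n$. A bounded $C_0$-semigroup is a strongly continuous one-parameter operator semigroup with uniformly bounded norms. Generators commute if the corresponding semigroups commute. If $A=(A_1,\dots,A_n)$ is an $n$-tuple of commuting generators of bounded $C_0$-semigroups $T_1,\dots,T_n$ on $X$, then $g_t(A)x=\int_{\mathbb{R}_+^n}T_1(u_1)\cdots T_n(u_n)x\,d\nu_t(u)$ defines a bounded $C_0$-semigroup $g(A)$ on $X$, and $\psi(A)$ denotes its generator. A bounded $C_0$-semigroup $U$ with generator $G$ on $X$ satisfies condition (Y), and is then called a quasibounded holomorphic semigroup, if $U(t)X\subset D(G)$ for all $t>0$ and $\limsup_{t\to0+}t\|GU(t)\|<\infty$. $\mathcal{T}_n^Y$ is the set of all $\psi\in\mathcal{T}_n^0$ such that, for every complex Banach space $X$ and every $n$-tuple $A$ of commuting generators of bounded $C_0$-semigroups on $X$, $\psi(A)$ generates a bounded $C_0$-semigroup with property (Y). *)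

theory Defs
  imports "HOL-Probability.Probability"
begin

section \<open>Smooth functions, orthants\<close>

definition neg_orthant :: "(real ^ 'n) set" where
  "neg_orthant = {s. \<forall>j. s $ j < 0}"

definition nonneg_orthant :: "(real ^ 'n) set" where
  "nonneg_orthant = {u. \<forall>j. 0 \<le> u $ j}"

definition partial_deriv ::
    "'n::finite \<Rightarrow> (real ^ 'n \<Rightarrow> 'b::real_normed_vector) \<Rightarrow> real ^ 'n \<Rightarrow> 'b" where
  "partial_deriv j f x = vector_derivative (\<lambda>h. f (x + h *\<^sub>R axis j 1)) (at 0)"

primrec partial_derivs ::
    "'n::finite list \<Rightarrow> (real ^ 'n \<Rightarrow> 'b::real_normed_vector) \<Rightarrow> real ^ 'n \<Rightarrow> 'b" where
  "partial_derivs [] f = f"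
| "partial_derivs (j # js) f = partial_deriv j (partial_derivs js f)"

text \<open>\<open>C\<^sup>\<infinity>\<close> on an open set \<open>S\<close>: partial derivatives of all orders exist and are continuous.\<close>

definition smooth_on ::
    "(real ^ 'n::finite) set \<Rightarrow> (real ^ 'n \<Rightarrow> 'b::real_normed_vector) \<Rightarrow> bool" where
  "smooth_on S f \<longleftrightarrow>
     (\<forall>js. continuous_on S (partial_derivs js f) \<and>
        (\<forall>j. \<forall>x\<in>S. (\<lambda>h::real. partial_derivs js f (x + h *\<^sub>R axis j 1)) differentiable (at 0)))"

section \<open>The Fourier transform of tempered distributions\<close>

definition schwartz :: "(real ^ 'n::finite \<Rightarrow> complex) set" where
  "schwartz = {\<phi>. smooth_on UNIV \<phi> \<and>
     (\<forall>js k. bounded (range (\<lambda>x. norm x ^ k *\<^sub>R partial_derivs js \<phi> x)))}"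

definition fourier :: "(real ^ 'n::finite \<Rightarrow> complex) \<Rightarrow> real ^ 'n \<Rightarrow> complex" where
  "fourier \<phi> y = ((2 * pi) powr (- real CARD('n) / 2)) *\<^sub>R (LINT u|lborel. \<phi> u * cis (- (y \<bullet> u)))"

text \<open>The functions \<open>F\<close> and \<open>p\<close> define tempered distributions by integration, and the
  distribution \<open>p\<close> is the Fourier transform of the distribution \<open>F\<close>, that is,
  \<open>\<langle>p, \<phi>\<rangle> = \<langle>F, fourier \<phi>\<rangle>\<close> for all test functions \<open>\<phi>\<close>.\<close>

definition has_fourier_transform ::
    "(real ^ 'n::finite \<Rightarrow> complex) \<Rightarrow> (real ^ 'n \<Rightarrow> complex) \<Rightarrow> bool" where
  "has_fourier_transform F p \<longleftrightarrow>
     (\<forall>\<phi>\<in>schwartz. integrable lborel (\<lambda>x. F x * \<phi> x) \<and> integrable lborel (\<lambda>x. p x * \<phi> x)) \<and>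
     (\<forall>\<phi>\<in>schwartz. (LINT u|lborel. p u * \<phi> u) = (LINT y|lborel. F y * fourier \<phi> y))"

section \<open>Bernstein functions of several variables\<close>

definition absolutely_monotone :: "(real ^ 'n::finite \<Rightarrow> real) \<Rightarrow> bool" where
  "absolutely_monotone f \<longleftrightarrow> (\<forall>js. \<forall>s\<in>neg_orthant. 0 \<le> partial_derivs js f s)"

text \<open>Only the values on \<^const>\<open>neg_orthant\<close> of a member of \<open>T_class\<close> matter.\<close>

definition T_class :: "(real ^ 'n::finite \<Rightarrow> real) set" where
  "T_class = {\<psi>. smooth_on neg_orthant \<psi> \<and> (\<forall>s\<in>neg_orthant. \<psi> s \<le> 0) \<and>
                 (\<forall>j. absolutely_monotone (partial_deriv j \<psi>))}"

text \<open>A measure on a subset of \<open>\<real>\<^sup>n\<close> is represented by the Borel measure on \<open>\<real>\<^sup>n\<close> that vanishes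
  off that subset.\<close>

definition representation ::
    "(real ^ 'n::finite \<Rightarrow> real) \<Rightarrow> real \<Rightarrow> real ^ 'n \<Rightarrow> (real ^ 'n) measure \<Rightarrow> bool" where
  "representation \<psi> c0 c1 \<mu> \<longleftrightarrow>
     (\<psi> \<longlongrightarrow> c0) (at 0 within neg_orthant) \<and>
     c1 \<in> nonneg_orthant \<and>
     sets \<mu> = sets borel \<and> (AE v in \<mu>. v \<in> nonneg_orthant - {0}) \<and>
     (\<forall>s\<in>neg_orthant.
        integrable \<mu> (\<lambda>v. exp (s \<bullet> v) - 1) \<and>
        \<psi> s = c0 + c1 \<bullet> s + (LINT v|\<mu>. exp (s \<bullet> v) - 1))"

definition T0_class :: "(real ^ 'n::finite \<Rightarrow> real) set" where
  "T0_class = {\<psi> \<in> T_class. \<exists>\<mu>. representation \<psi> 0 0 \<mu>}"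

definition cdot :: "complex ^ 'n::finite \<Rightarrow> real ^ 'n \<Rightarrow> complex" where
  "cdot z v = (\<Sum>j\<in>UNIV. z $ j * complex_of_real (v $ j))"

text \<open>The extension of \<open>\<psi>\<close> to \<open>{z. \<forall>j. Re (z $ j) \<le> 0}\<close> by the representation formula; the
  triple \<open>(c0, c1, \<mu>)\<close> chosen here is uniquely determined by \<open>\<psi>\<close>.\<close>

definition extension :: "(real ^ 'n::finite \<Rightarrow> real) \<Rightarrow> complex ^ 'n \<Rightarrow> complex" where
  "extension \<psi> z =
     (let (c0, c1, \<mu>) = (SOME (c0, c1, \<mu>). representation \<psi> c0 c1 \<mu>)
      in complex_of_real c0 + cdot z c1 + (LINT v|\<mu>. exp (cdot z v) - 1))"

definition imag_vec :: "real ^ 'n \<Rightarrow> complex ^ 'n" where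
  "imag_vec y = (\<chi> j. \<i> * complex_of_real (y $ j))"

definition F_fun :: "(real ^ 'n::finite \<Rightarrow> real) \<Rightarrow> real \<Rightarrow> real ^ 'n \<Rightarrow> complex" where
  "F_fun \<psi> t y = exp (complex_of_real t * extension \<psi> (imag_vec y)) * extension \<psi> (imag_vec y)"

definition nu :: "(real ^ 'n::finite \<Rightarrow> real) \<Rightarrow> real \<Rightarrow> (real ^ 'n) measure" where
  "nu \<psi> t = (THE \<nu>. prob_space \<nu> \<and> sets \<nu> = sets borel \<and> (AE u in \<nu>. u \<in> nonneg_orthant) \<and>
                    (\<forall>z\<in>neg_orthant. (LINT u|\<nu>. exp (z \<bullet> u)) = exp (t * \<psi> z)))"

section \<open>Complex Banach spaces and semigroups of operators\<close>

class complex_banach = banach +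
  fixes scaleC :: "complex \<Rightarrow> 'a \<Rightarrow> 'a"
  assumes scaleC_add_right: "scaleC a (x + y) = scaleC a x + scaleC a y"
    and scaleC_add_left: "scaleC (a + b) x = scaleC a x + scaleC b x"
    and scaleC_scaleC: "scaleC a (scaleC b x) = scaleC (a * b) x"
    and scaleC_of_real: "scaleC (complex_of_real r) x = r *\<^sub>R x"
    and norm_scaleC: "norm (scaleC a x) = cmod a * norm x"

instantiation complex :: complex_banach
begin
definition scaleC_complex :: "complex \<Rightarrow> complex \<Rightarrow> complex" where
  "scaleC_complex a x = a * x"
instance
  by standard (simp_all add: scaleC_complex_def algebra_simps norm_mult scaleR_conv_of_real)
end

definition bounded_clinear :: "('x::complex_banach \<Rightarrow> 'x) \<Rightarrow> bool" where
  "bounded_clinear f \<longleftrightarrow> bounded_linear f \<and> (\<forall>c x. f (scaleC c x) = scaleC c (f x))"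

text \<open>Only the values \<open>T t\<close> with \<open>0 \<le> t\<close> belong to the semigroup.\<close>

definition bounded_C0_semigroup :: "(real \<Rightarrow> 'x::complex_banach \<Rightarrow> 'x) \<Rightarrow> bool" where
  "bounded_C0_semigroup T \<longleftrightarrow>
     (\<forall>t\<ge>0. bounded_clinear (T t)) \<and>
     T 0 = id \<and> (\<forall>s\<ge>0. \<forall>t\<ge>0. T (s + t) = T s \<circ> T t) \<and>
     (\<forall>x. continuous_on {0..} (\<lambda>t. T t x)) \<and>
     (\<exists>M. \<forall>t\<ge>0. onorm (T t) \<le> M)"

text \<open>An unbounded operator is given by its graph.\<close>

type_synonym 'x unbounded_op = "('x \<times> 'x) set"

definition op_apply :: "'x unbounded_op \<Rightarrow> 'x \<Rightarrow> 'x" where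
  "op_apply G x = (THE y. (x, y) \<in> G)"

definition generator :: "(real \<Rightarrow> 'x::complex_banach \<Rightarrow> 'x) \<Rightarrow> 'x unbounded_op" where
  "generator T = {(x, y). ((\<lambda>t. (T t x - x) /\<^sub>R t) \<longlongrightarrow> y) (at_right 0)}"

definition generates ::
    "'x::complex_banach unbounded_op \<Rightarrow> (real \<Rightarrow> 'x \<Rightarrow> 'x) \<Rightarrow> bool" where
  "generates A T \<longleftrightarrow> bounded_C0_semigroup T \<and> A = generator T"

text \<open>A generator determines its semigroup on \<open>{0..}\<close>, so the choice below is immaterial.\<close>

definition semigroup_of :: "'x::complex_banach unbounded_op \<Rightarrow> real \<Rightarrow> 'x \<Rightarrow> 'x" where
  "semigroup_of A = (SOME T. generates A T)"

definition commuting_generators :: "('n \<Rightarrow> 'x::complex_banach unbounded_op) \<Rightarrow> bool" where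
  "commuting_generators A \<longleftrightarrow>
     (\<forall>j. \<exists>T. generates (A j) T) \<and>
     (\<forall>j k. \<forall>s\<ge>0. \<forall>t\<ge>0.
        semigroup_of (A j) s \<circ> semigroup_of (A k) t = semigroup_of (A k) t \<circ> semigroup_of (A j) s)"

text \<open>Here \<open>generates G U\<close> is intended. Under the first conjunct \<open>G U(t)\<close> is a closed operator defined
  on the whole space, hence bounded, so \<^const>\<open>onorm\<close> is its operator norm.\<close>

definition condition_Y ::
    "'x::complex_banach unbounded_op \<Rightarrow> (real \<Rightarrow> 'x \<Rightarrow> 'x) \<Rightarrow> bool" where
  "condition_Y G U \<longleftrightarrow>
     (\<forall>t>0. range (U t) \<subseteq> Domain G) \<and>
     Limsup (at_right 0) (\<lambda>t. ereal (t * onorm (\<lambda>x. op_apply G (U t x)))) < \<infinity>"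

definition quasibounded_holomorphic ::
    "'x::complex_banach unbounded_op \<Rightarrow> (real \<Rightarrow> 'x \<Rightarrow> 'x) \<Rightarrow> bool" where
  "quasibounded_holomorphic G U \<longleftrightarrow> generates G U \<and> condition_Y G U"

section \<open>The Bochner integral and the functional calculus\<close>

text \<open>\<^const>\<open>has_bochner_integral\<close> demands a second countable range type, i.e. a separable Banach
  space. The following is the same definition without this sort constraint.\<close>

definition has_banach_integral ::
    "'a measure \<Rightarrow> ('a \<Rightarrow> 'x::banach) \<Rightarrow> 'x \<Rightarrow> bool" where
  "has_banach_integral M f I \<longleftrightarrow> f \<in> borel_measurable M \<and>
     (\<exists>s. (\<forall>i. Bochner_Integration.simple_bochner_integrable M (s i)) \<and>
          (\<lambda>i. \<integral>\<^sup>+x. ennreal (norm (f x - s i x)) \<partial>M) \<longlonglongrightarrow> 0 \<and>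
          (\<lambda>i. Bochner_Integration.simple_bochner_integral M (s i)) \<longlonglongrightarrow> I)"

definition banach_integral :: "'a measure \<Rightarrow> ('a \<Rightarrow> 'x::banach) \<Rightarrow> 'x" where
  "banach_integral M f = (THE I. has_banach_integral M f I)"

text \<open>The product \<open>T\<^sub>1(u\<^sub>1) \<cdots> T\<^sub>n(u\<^sub>n) x\<close>; the factors commute for \<open>u \<in> nonneg_orthant\<close>, so their
  order is irrelevant.\<close>

definition multi_semigroup ::
    "('n::finite \<Rightarrow> 'x::complex_banach unbounded_op) \<Rightarrow> real ^ 'n \<Rightarrow> 'x \<Rightarrow> 'x" where
  "multi_semigroup A u x = Finite_Set.fold (\<lambda>j y. semigroup_of (A j) (u $ j) y) x UNIV"

definition g_semigroup ::
    "(real ^ 'n::finite \<Rightarrow> real) \<Rightarrow> ('n \<Rightarrow> 'x::complex_banach unbounded_op) \<Rightarrow> real \<Rightarrow> 'x \<Rightarrow> 'x" where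
  "g_semigroup \<psi> A t x =
     banach_integral (nu \<psi> t) (\<lambda>u. indicator nonneg_orthant u *\<^sub>R multi_semigroup A u x)"

definition psi_op ::
    "(real ^ 'n::finite \<Rightarrow> real) \<Rightarrow> ('n \<Rightarrow> 'x::complex_banach unbounded_op) \<Rightarrow> 'x unbounded_op" where
  "psi_op \<psi> A = generator (g_semigroup \<psi> A)"

text \<open>The part of the class \<open>T\<^sup>Y\<close> that concerns the Banach space \<open>'x\<close>. Membership in \<open>T\<^sup>Y\<close> itself is
  \<open>\<psi> \<in> TY_class TYPE('x)\<close> for a type variable \<open>'x\<close>, which ranges over all complex Banach spaces.\<close>

definition TY_class :: "'x::complex_banach itself \<Rightarrow> (real ^ 'n::finite \<Rightarrow> real) set" where
  "TY_class _ = {\<psi> \<in> T0_class. \<forall>A :: 'n \<Rightarrow> 'x unbounded_op. commuting_generators A \<longrightarrow>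
     quasibounded_holomorphic (psi_op \<psi> A) (g_semigroup \<psi> A)}"

end

theory Submission
  imports Defs
begin

text \<open>
  Let \<open>T u = T\<^sub>1 (u\<^sub>1) \<cdots> T\<^sub>n (u\<^sub>n)\<close>, let \<open>U t\<close> be the integral of \<open>T\<close> against \<open>\<nu>\<^sub>t\<close>, and let \<open>q\<^sub>t\<close> be
  the real part of \<open>(2 \<pi>)\<^bsup>-n/2\<^esup> p\<^sub>t\<close>. The derivative of \<open>\<nu>\<^sub>t\<close> in \<open>t\<close> is \<open>q\<^sub>t du\<close>: tested against a centred
  Gaussian, both sides become Gaussian integrals over the imaginary axis, where the derivative of
  \<open>exp (t \<psi>)\<close> is \<open>F\<^sub>t\<close>. Centred Gaussians span a dense subspace of the functions vanishing at
  infinity on the orthant, and the total mass of \<open>q\<^sub>t\<close> is locally bounded near \<open>0\<close>, so the identity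
  holds for all such Banach-space valued functions. Applied to the damped semigroup
  \<open>exp (- \<epsilon> (u\<^sub>1 + \<dots> + u\<^sub>n)) T u\<close>, the semigroup law and the mean value inequality give
  \<open>\<parallel>U (t + h) x - U t x - h V t x\<parallel> \<le> K J\<^sub>t h sup {\<parallel>U s x - x\<parallel> | s \<le> h}\<close> up to an error that is uniform
  in \<open>\<epsilon>\<close>, where \<open>V t\<close> is the integral of \<open>T\<close> against \<open>q\<^sub>t du\<close>. Letting \<open>\<epsilon> \<rightarrow> 0\<close>, the generator
  composed with \<open>U t\<close> is \<open>V t\<close>, and \<open>\<parallel>V t\<parallel> \<le> K J\<^sub>t\<close>.
\<close>

section \<open>Bochner integrals of bounded continuous functions on the orthant\<close>

text \<open>The hypothesis on \<open>p t\<close> is distributional, so it can be tested only against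
  Schwartz functions on all of R^n. Exponentials, the natural test functions on the orthant, grow
  off it; centred Gaussians are Schwartz, transform into Gaussians, and on the orthant become the
  same exponentials after the substitution v_j = u_j^2 / 2. Of the signed densities only the total
  mass is controlled, so passing to general functions needs uniform approximation, hence decay at
  infinity, whereas an orbit \<open>T u x\<close> is merely bounded. Damping repairs this, but a
  derivative does not survive the removal of the damping by itself; an inequality for finite
  \<open>h\<close> with an undamped right side does. Two constructions are forced by the
  definitions. \<open>nu\<close> is a definite description, so existence and uniqueness of the
  subordinator must be proved, existence through an infinite sum of independent compound Poisson
  variables. The Banach space may be inseparable, so integrals are built by discretising the
  variable \<open>u\<close> and not the values.\<close>

lemma borel_measurable_norm_diff_simple:
  fixes f s :: "'a \<Rightarrow> 'x::real_normed_vector"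
  assumes f: "f \<in> borel_measurable M" and s: "simple_function M s"
  shows "(\<lambda>x. norm (f x - s x)) \<in> borel_measurable M"
\<comment> \<open>In an inseparable space a difference of measurable maps can fail to be measurable.
  Here \<open>s\<close> has finite range, so the claim is checked for each of its values
  separately.\<close>
proof (rule measurable_compose_countable'[where f="\<lambda>y x. norm (f x - y)" and g=s and I="s ` space M"])
  fix y
  have "(\<lambda>z::'x. norm (z - y)) \<in> borel_measurable borel"
    by (intro borel_measurable_continuous_onI continuous_intros)
  then show "(\<lambda>x. norm (f x - y)) \<in> borel_measurable M"
    by (rule measurable_compose[OF f])
next
  show "s \<in> M \<rightarrow>\<^sub>M count_space (s ` space M)"
    using s by (subst measurable_count_space_eq2) (auto simp: simple_function_def)
  show "countable (s ` space M)"
    using s by (simp add: simple_function_def countable_finite)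
qed

text \<open>The integral of simple functions is a contraction for the L1 distance. Comparing two of
  them through \<open>f\<close> serves both uniqueness of the limit and the Cauchy property.\<close>

lemma simple_bochner_integral_dist_le:
  fixes f :: "'a \<Rightarrow> 'x::real_normed_vector"
  assumes f: "f \<in> borel_measurable M"
    and s: "Bochner_Integration.simple_bochner_integrable M s" and t: "Bochner_Integration.simple_bochner_integrable M t"
  shows "ennreal (norm (Bochner_Integration.simple_bochner_integral M s - Bochner_Integration.simple_bochner_integral M t)) \<le>
    (\<integral>\<^sup>+ x. norm (f x - s x) \<partial>M) + (\<integral>\<^sup>+ x. norm (f x - t x) \<partial>M)"
    (is "ennreal (norm (?s - ?t)) \<le> ?S + ?T")
proof -
  have [measurable]: "(\<lambda>x. norm (f x - s x)) \<in> borel_measurable M"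
      "(\<lambda>x. norm (f x - t x)) \<in> borel_measurable M"
    using s t by (auto intro!: borel_measurable_norm_diff_simple[OF f] elim: simple_bochner_integrable.cases)
  have "ennreal (norm (?s - ?t)) = norm (Bochner_Integration.simple_bochner_integral M (\<lambda>x. s x - t x))"
    using s t by (subst simple_bochner_integral_diff) auto
  also have "\<dots> \<le> Bochner_Integration.simple_bochner_integral M (\<lambda>x. norm (s x - t x))"
    using simple_bochner_integrable_compose2[of "(-)" M "s" "t"] s t
    by (auto intro!: simple_bochner_integral_norm_bound)
  also have "\<dots> = (\<integral>\<^sup>+x. norm (s x - t x) \<partial>M)"
    using simple_bochner_integrable_compose2[of "\<lambda>x y. norm (x - y)" M "s" "t"] s t
    by (auto intro!: simple_bochner_integral_eq_nn_integral)
  also have "\<dots> \<le> (\<integral>\<^sup>+x. ennreal (norm (f x - s x)) + ennreal (norm (f x - t x)) \<partial>M)"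
  proof (rule nn_integral_mono)
    fix x
    have "norm (s x - t x) \<le> norm (f x - s x) + norm (f x - t x)"
      by (metis dual_order.refl norm_diff_triangle_le norm_minus_commute)
    then show "ennreal (norm (s x - t x)) \<le> ennreal (norm (f x - s x)) + ennreal (norm (f x - t x))"
      by (metis ennreal_leI ennreal_plus norm_ge_zero)
  qed
  also have "\<dots> = ?S + ?T"
    by (rule nn_integral_add) auto
  finally show ?thesis .
qed

lemma simple_bochner_integrals_tendsto_unique:
  fixes f :: "'a \<Rightarrow> 'x::real_normed_vector"
  assumes f: "f \<in> borel_measurable M"
    and s: "\<And>i::nat. Bochner_Integration.simple_bochner_integrable M (s i)" "(\<lambda>i. \<integral>\<^sup>+x. ennreal (norm (f x - s i x)) \<partial>M) \<longlonglongrightarrow> 0"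
    and t: "\<And>i. Bochner_Integration.simple_bochner_integrable M (t i)" "(\<lambda>i. \<integral>\<^sup>+x. ennreal (norm (f x - t i x)) \<partial>M) \<longlonglongrightarrow> 0"
  shows "(\<lambda>i. Bochner_Integration.simple_bochner_integral M (s i) - Bochner_Integration.simple_bochner_integral M (t i)) \<longlonglongrightarrow> 0"
proof -
  have "(\<lambda>i. ennreal (norm (Bochner_Integration.simple_bochner_integral M (s i) - Bochner_Integration.simple_bochner_integral M (t i)))) \<longlonglongrightarrow> 0"
  proof (rule tendsto_sandwich)
    show "\<forall>\<^sub>F i in sequentially. 0 \<le> ennreal (norm (Bochner_Integration.simple_bochner_integral M (s i) - Bochner_Integration.simple_bochner_integral M (t i)))"
      by simp
    show "\<forall>\<^sub>F i in sequentially. ennreal (norm (Bochner_Integration.simple_bochner_integral M (s i) - Bochner_Integration.simple_bochner_integral M (t i)))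
        \<le> (\<integral>\<^sup>+ x. norm (f x - s i x) \<partial>M) + (\<integral>\<^sup>+ x. norm (f x - t i x) \<partial>M)"
      by (intro always_eventually allI simple_bochner_integral_dist_le f s t)
    show "(\<lambda>i. (\<integral>\<^sup>+ x. norm (f x - s i x) \<partial>M) + (\<integral>\<^sup>+ x. norm (f x - t i x) \<partial>M)) \<longlonglongrightarrow> 0"
      using tendsto_add[OF s(2) t(2)] by simp
  qed simp
  then show ?thesis
    by (simp add: tendsto_norm_zero_iff flip: ennreal_0)
qed

lemma has_banach_integral_unique:
  assumes "has_banach_integral M f I" "has_banach_integral M f J"
  shows "I = J"
proof -
  obtain s t where f: "f \<in> borel_measurable M"
    and s: "\<And>i. Bochner_Integration.simple_bochner_integrable M (s i)" "(\<lambda>i. \<integral>\<^sup>+x. ennreal (norm (f x - s i x)) \<partial>M) \<longlonglongrightarrow> 0"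
      "(\<lambda>i. Bochner_Integration.simple_bochner_integral M (s i)) \<longlonglongrightarrow> I"
    and t: "\<And>i. Bochner_Integration.simple_bochner_integrable M (t i)" "(\<lambda>i. \<integral>\<^sup>+x. ennreal (norm (f x - t i x)) \<partial>M) \<longlonglongrightarrow> 0"
      "(\<lambda>i. Bochner_Integration.simple_bochner_integral M (t i)) \<longlonglongrightarrow> J"
    using assms unfolding has_banach_integral_def by blast
  have "(\<lambda>i. Bochner_Integration.simple_bochner_integral M (s i) - Bochner_Integration.simple_bochner_integral M (t i)) \<longlonglongrightarrow> I - J"
    by (intro tendsto_diff s t)
  with simple_bochner_integrals_tendsto_unique[OF f s(1,2) t(1,2)] have "I - J = 0"
    using LIMSEQ_unique by blast
  then show ?thesis by simp
qed

lemma banach_integral_eqI: "has_banach_integral M f I \<Longrightarrow> banach_integral M f = I"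
  unfolding banach_integral_def using has_banach_integral_unique by blast

text \<open>Both notions unfold to the same formula. This opens scalar integration theory, in
  particular dominated convergence for norms of integrands.\<close>

lemma has_banach_integral_iff_has_bochner_integral:
  "has_banach_integral M f I \<longleftrightarrow> has_bochner_integral M f I"
  unfolding has_banach_integral_def has_bochner_integral.simps by blast

lemma simple_bochner_integrals_convergent:
  fixes f :: "'a \<Rightarrow> 'x::banach"
  assumes f: "f \<in> borel_measurable M"
    and s: "\<And>i::nat. Bochner_Integration.simple_bochner_integrable M (s i)" "(\<lambda>i. \<integral>\<^sup>+x. ennreal (norm (f x - s i x)) \<partial>M) \<longlonglongrightarrow> 0"
  shows "convergent (\<lambda>i. Bochner_Integration.simple_bochner_integral M (s i))"
proof (rule Cauchy_convergent, rule metric_CauchyI)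
  fix e :: real assume e: "0 < e"
  then have "0 < ennreal (e / 2)" by simp
  with s(2) have "\<forall>\<^sub>F i in sequentially. (\<integral>\<^sup>+x. ennreal (norm (f x - s i x)) \<partial>M) < ennreal (e / 2)"
    by (rule order_tendstoD)
  then obtain N where N: "\<And>i. i \<ge> N \<Longrightarrow> (\<integral>\<^sup>+x. ennreal (norm (f x - s i x)) \<partial>M) < ennreal (e / 2)"
    by (auto simp: eventually_sequentially)
  show "\<exists>N. \<forall>m\<ge>N. \<forall>n\<ge>N. dist (Bochner_Integration.simple_bochner_integral M (s m)) (Bochner_Integration.simple_bochner_integral M (s n)) < e"
  proof (intro exI allI impI)
    fix m n assume "N \<le> m" "N \<le> n"
    have "ennreal (dist (Bochner_Integration.simple_bochner_integral M (s m)) (Bochner_Integration.simple_bochner_integral M (s n)))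
        \<le> (\<integral>\<^sup>+ x. norm (f x - s m x) \<partial>M) + (\<integral>\<^sup>+ x. norm (f x - s n x) \<partial>M)"
      unfolding dist_norm by (rule simple_bochner_integral_dist_le) fact+
    also have "\<dots> < ennreal (e / 2) + ennreal (e / 2)"
      by (intro add_strict_mono N) fact+
    also have "\<dots> = ennreal e"
      using e by (simp flip: ennreal_plus)
    finally show "dist (Bochner_Integration.simple_bochner_integral M (s m)) (Bochner_Integration.simple_bochner_integral M (s n)) < e"
      using e by (simp add: ennreal_less_iff)
  qed
qed

section \<open>Bounded continuous functions on the orthant\<close>

definition pos_vec :: "real ^ 'n::finite \<Rightarrow> real ^ 'n" where
  "pos_vec u = (\<chi> j. max 0 (u $ j))"

lemma pos_vec_in [simp]: "pos_vec u \<in> nonneg_orthant"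
  by (simp add: pos_vec_def nonneg_orthant_def)

lemma pos_vec_id: "u \<in> nonneg_orthant \<Longrightarrow> pos_vec u = u"
  by (simp add: pos_vec_def nonneg_orthant_def vec_eq_iff max_def)

lemma continuous_on_pos_vec: "continuous_on S pos_vec"
  unfolding pos_vec_def by (intro continuous_intros)

lemma closed_nonneg_orthant: "closed (nonneg_orthant :: (real ^ 'n::finite) set)"
proof -
  have "nonneg_orthant = (\<Inter>j::'n. {u::real^'n. 0 \<le> u $ j})"
    by (auto simp: nonneg_orthant_def)
  moreover have "closed {u::real^'n. 0 \<le> u $ j}" for j
    by (intro closed_Collect_le continuous_intros)
  ultimately show ?thesis
    by (metis closed_INT)
qed

lemma nonneg_orthant_borel [measurable, simp]: "(nonneg_orthant :: (real ^ 'n::finite) set) \<in> sets borel"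
  using closed_nonneg_orthant by (rule borel_closed)

lemma nonneg_orthant_add: "u \<in> nonneg_orthant \<Longrightarrow> v \<in> nonneg_orthant \<Longrightarrow> u + v \<in> nonneg_orthant"
  by (simp add: nonneg_orthant_def)

definition orthant_bcont :: "(real ^ 'n::finite \<Rightarrow> 'x::real_normed_vector) \<Rightarrow> bool" where
  "orthant_bcont f \<longleftrightarrow> continuous_on nonneg_orthant f \<and> bounded (f ` nonneg_orthant)"

lemma orthant_bcontI:
  assumes "continuous_on nonneg_orthant f" "\<And>u. u \<in> nonneg_orthant \<Longrightarrow> norm (f u) \<le> B"
  shows "orthant_bcont f"
  using assms by (auto simp: orthant_bcont_def bounded_iff)

lemma orthant_bcontE:
  assumes "orthant_bcont f"
  obtains B where "B > 0" "\<And>u. u \<in> nonneg_orthant \<Longrightarrow> norm (f u) \<le> B"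
  using assms unfolding orthant_bcont_def bounded_pos by blast

lemma orthant_bcont_const: "orthant_bcont (\<lambda>u. c)"
  by (rule orthant_bcontI[where B="norm c"]) (auto intro: continuous_intros)

lemma orthant_bcont_add:
  assumes "orthant_bcont f" "orthant_bcont g"
  shows "orthant_bcont (\<lambda>u. f u + g u)"
proof -
  obtain A B where "\<And>u. u \<in> nonneg_orthant \<Longrightarrow> norm (f u) \<le> A"
    "\<And>u. u \<in> nonneg_orthant \<Longrightarrow> norm (g u) \<le> B"
    using orthant_bcontE assms by metis
  then show ?thesis
    using assms
    by (intro orthant_bcontI[where B="A + B"])
      (auto simp: orthant_bcont_def intro: continuous_intros norm_triangle_mono)
qed

lemma orthant_bcont_bounded_linear:
  assumes "bounded_linear L" "orthant_bcont f"
  shows "orthant_bcont (\<lambda>u. L (f u))"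
  using assms unfolding orthant_bcont_def
  by (auto intro: bounded_linear.continuous_on dest: bounded_linear_image[of "f ` nonneg_orthant" L] simp: image_image)

lemma orthant_bcont_diff:
  "orthant_bcont f \<Longrightarrow> orthant_bcont g \<Longrightarrow> orthant_bcont (\<lambda>u. f u - g u)"
  using orthant_bcont_add[OF _ orthant_bcont_bounded_linear[OF bounded_linear_minus[OF bounded_linear_ident]], of f g]
  by simp

lemma orthant_bcont_scaleR:
  assumes "orthant_bcont \<phi>" "orthant_bcont f"
  shows "orthant_bcont (\<lambda>u. \<phi> u *\<^sub>R f u)"
proof -
  obtain A B where "A > 0" "\<And>u. u \<in> nonneg_orthant \<Longrightarrow> norm (\<phi> u) \<le> A"
    "\<And>u. u \<in> nonneg_orthant \<Longrightarrow> norm (f u) \<le> B"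
    using orthant_bcontE assms by metis
  then show ?thesis
    using assms
    by (intro orthant_bcontI[where B="A * B"])
      (auto simp: orthant_bcont_def intro: continuous_intros mult_mono)
qed

lemma orthant_bcont_sum:
  "(\<And>i. i \<in> I \<Longrightarrow> orthant_bcont (f i)) \<Longrightarrow> orthant_bcont (\<lambda>u. \<Sum>i\<in>I. f i u)"
  by (induction I rule: infinite_finite_induct) (auto intro: orthant_bcont_const orthant_bcont_add)

lemma orthant_bcont_norm: "orthant_bcont f \<Longrightarrow> orthant_bcont (\<lambda>u. norm (f u))"
  unfolding orthant_bcont_def bounded_iff by (auto intro: continuous_intros)

definition simple_approx :: "nat \<Rightarrow> real ^ 'n::finite \<Rightarrow> real ^ 'n" where
  "simple_approx = (SOME F. (\<forall>i. simple_function borel (F i)) \<and> (\<forall>x. (\<lambda>i. F i x) \<longlonglongrightarrow> x))"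

lemma simple_approx:
  "simple_function borel (simple_approx i)" "(\<lambda>i. simple_approx i x) \<longlonglongrightarrow> x"
proof -
  have "\<exists>F. (\<forall>i. simple_function borel (F i)) \<and> (\<forall>x::real^'n. (\<lambda>i::nat. F i x) \<longlonglongrightarrow> x)"
    using borel_measurable_implies_sequence_metric[OF measurable_ident[of borel], of undefined]
    by auto
  from someI_ex[OF this, folded simple_approx_def]
  show "simple_function borel (simple_approx i)" "(\<lambda>i. simple_approx i x) \<longlonglongrightarrow> x"
    by auto
qed

text \<open>Not the values of \<open>f\<close> but its argument is approximated: a function of a
  simple function is simple, whatever the range space. \<open>pos_vec\<close> brings back
  approximants that leave the orthant. The expression is linear in \<open>f\<close>, so linearity of
  the integral passes to the limit.\<close>

definition step_approx :: "nat \<Rightarrow> (real ^ 'n::finite \<Rightarrow> 'x) \<Rightarrow> real ^ 'n \<Rightarrow> 'x::real_vector" where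
  "step_approx i f u = indicator nonneg_orthant u *\<^sub>R f (pos_vec (simple_approx i u))"

lemma step_approx_tendsto:
  fixes f :: "real ^ 'n::finite \<Rightarrow> 'x::real_normed_vector"
  assumes "orthant_bcont f"
  shows "(\<lambda>i. step_approx i f u) \<longlonglongrightarrow> indicator nonneg_orthant u *\<^sub>R f u"
proof (cases "u \<in> nonneg_orthant")
  case True
  have "continuous_on UNIV (\<lambda>u. f (pos_vec u))"
    using assms by (intro continuous_on_compose2[of nonneg_orthant f UNIV pos_vec] continuous_on_pos_vec)
      (auto simp: orthant_bcont_def)
  then have "(\<lambda>i. f (pos_vec (simple_approx i u))) \<longlonglongrightarrow> f (pos_vec u)"
    using simple_approx(2)[of u] continuous_on_tendsto_compose[of UNIV "\<lambda>u. f (pos_vec u)"] by auto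
  with True show ?thesis
    by (simp add: step_approx_def pos_vec_id)
qed (simp add: step_approx_def)

lemma step_approx_bound:
  assumes "\<And>u. u \<in> nonneg_orthant \<Longrightarrow> norm (f u) \<le> B"
  shows "norm (step_approx i f u) \<le> B"
proof -
  have "0 \<le> B" using assms[OF pos_vec_in[of 0]] norm_ge_zero order_trans by blast
  with assms[OF pos_vec_in] show ?thesis by (auto simp: step_approx_def indicator_def)
qed

section \<open>The integral over the orthant\<close>

definition orthant_integral :: "(real ^ 'n::finite) measure \<Rightarrow> (real ^ 'n \<Rightarrow> 'x::banach) \<Rightarrow> 'x" where
  "orthant_integral M f = banach_integral M (\<lambda>u. indicator nonneg_orthant u *\<^sub>R f u)"

lemma orthant_integral_cong:
  assumes "\<And>u. u \<in> nonneg_orthant \<Longrightarrow> f u = g u"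
  shows "orthant_integral M f = orthant_integral M g"
  unfolding orthant_integral_def
  by (intro arg_cong[where f="banach_integral M"] ext) (auto simp: indicator_def assms)

locale orthant_measure = finite_measure M for M :: "(real ^ 'n::finite) measure" +
  assumes sets_eq [measurable_cong]: "sets M = sets borel"
    and AE_orthant: "AE u in M. u \<in> nonneg_orthant"
begin

lemma space_eq [simp]: "space M = UNIV"
  using sets_eq_imp_space_eq[OF sets_eq] by simp

lemma simple_bochner_integrable_step:
  fixes f :: "real ^ 'n \<Rightarrow> 'x::real_normed_vector"
  shows "Bochner_Integration.simple_bochner_integrable M (step_approx i f)"
proof
  have "simple_function M (simple_approx i)"
    using simple_approx(1) simple_function_cong_algebra[OF sets_eq space_eq[unfolded space_borel[symmetric]]]
    by blast
  moreover have "simple_function M (indicator nonneg_orthant :: _ \<Rightarrow> real)"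
    using sets_eq by (intro simple_function_indicator) simp
  ultimately show "simple_function M (step_approx i f)"
    unfolding step_approx_def
    using simple_function_compose2[of M "indicator nonneg_orthant" "simple_approx i" "\<lambda>a b. a *\<^sub>R f (pos_vec b)"]
    by simp
  show "emeasure M {y \<in> space M. step_approx i f y \<noteq> 0} \<noteq> \<infinity>"
    using emeasure_finite by simp
qed

lemma borel_measurable_orthant_bcont:
  fixes f :: "real ^ 'n \<Rightarrow> 'x::real_normed_vector"
  assumes "orthant_bcont f"
  shows "(\<lambda>u. indicator nonneg_orthant u *\<^sub>R f u) \<in> borel_measurable M"
  using borel_measurable_continuous_on_indicator[OF nonneg_orthant_borel, of f] assms
  by (simp add: orthant_bcont_def measurable_cong_sets[OF sets_eq refl])

lemma nn_integral_step_approx_tendsto: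
  fixes f :: "real ^ 'n \<Rightarrow> 'x::real_normed_vector"
  assumes f: "orthant_bcont f"
  shows "(\<lambda>i. \<integral>\<^sup>+u. ennreal (norm (indicator nonneg_orthant u *\<^sub>R f u - step_approx i f u)) \<partial>M) \<longlonglongrightarrow> 0"
proof -
  obtain B where B: "B > 0" "\<And>u. u \<in> nonneg_orthant \<Longrightarrow> norm (f u) \<le> B"
    using orthant_bcontE[OF f] by blast
  let ?g = "\<lambda>i u. norm (indicator nonneg_orthant u *\<^sub>R f u - step_approx i f u)"
  have "(\<lambda>i. \<integral>\<^sup>+u. ennreal (?g i u) \<partial>M) \<longlonglongrightarrow> (\<integral>\<^sup>+u. 0 \<partial>M)"
  \<comment> \<open>The constant majorant is integrable because the measure is finite.\<close>
  proof (rule nn_integral_dominated_convergence[where w="\<lambda>_. ennreal (2 * B)"])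
    show "(\<lambda>u. ennreal (?g i u)) \<in> borel_measurable M" for i
      using borel_measurable_norm_diff_simple[OF borel_measurable_orthant_bcont[OF f]]
        simple_bochner_integrable_step by (auto elim: simple_bochner_integrable.cases)
    show "AE u in M. ennreal (?g i u) \<le> ennreal (2 * B)" for i
    proof (intro AE_I2 ennreal_leI)
      fix u
      have "norm (indicator nonneg_orthant u *\<^sub>R f u) \<le> B"
        using B by (auto simp: indicator_def)
      then show "?g i u \<le> 2 * B"
        using step_approx_bound[of f B i u, OF B(2)] norm_triangle_ineq4[of "indicator nonneg_orthant u *\<^sub>R f u" "step_approx i f u"]
        by linarith
    qed
    show "AE u in M. (\<lambda>i. ennreal (?g i u)) \<longlonglongrightarrow> 0"
    proof (intro AE_I2)
      fix u
      have "(\<lambda>i. ?g i u) \<longlonglongrightarrow> norm (indicator nonneg_orthant u *\<^sub>R f u - indicator nonneg_orthant u *\<^sub>R f u)"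
        by (intro tendsto_intros step_approx_tendsto f)
      then show "(\<lambda>i. ennreal (?g i u)) \<longlonglongrightarrow> 0"
        using tendsto_ennrealI by fastforce
    qed
    show "(\<integral>\<^sup>+u. ennreal (2 * B) \<partial>M) < \<infinity>"
      using emeasure_finite[of UNIV] by (auto simp: ennreal_mult_eq_top_iff less_top[symmetric])
  qed auto
  then show ?thesis by simp
qed

lemma step_integrals_tendsto:
  fixes f :: "real ^ 'n \<Rightarrow> 'x::banach"
  assumes f: "orthant_bcont f"
  shows "(\<lambda>i. Bochner_Integration.simple_bochner_integral M (step_approx i f)) \<longlonglongrightarrow> orthant_integral M f"
proof -
  obtain I where I: "(\<lambda>i. Bochner_Integration.simple_bochner_integral M (step_approx i f)) \<longlonglongrightarrow> I"
    using simple_bochner_integrals_convergent[OF borel_measurable_orthant_bcont[OF f]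
        simple_bochner_integrable_step nn_integral_step_approx_tendsto[OF f]]
    by (auto simp: convergent_def)
  then have "has_banach_integral M (\<lambda>u. indicator nonneg_orthant u *\<^sub>R f u) I"
    unfolding has_banach_integral_def
    by (intro conjI exI[where x="\<lambda>i. step_approx i f"] allI borel_measurable_orthant_bcont
      simple_bochner_integrable_step nn_integral_step_approx_tendsto f)
  then have "orthant_integral M f = I"
    unfolding orthant_integral_def by (rule banach_integral_eqI)
  with I show ?thesis by simp
qed

lemma orthant_integral_real:
  fixes f :: "real ^ 'n \<Rightarrow> 'x::{banach, second_countable_topology}"
  assumes f: "orthant_bcont f"
  shows "orthant_integral M f = (LINT u|M. indicator nonneg_orthant u *\<^sub>R f u)"
    and "integrable M (\<lambda>u. indicator nonneg_orthant u *\<^sub>R f u)"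
proof -
  have "has_banach_integral M (\<lambda>u. indicator nonneg_orthant u *\<^sub>R f u) (orthant_integral M f)"
    unfolding has_banach_integral_def
    by (intro conjI exI[where x="\<lambda>i. step_approx i f"] allI borel_measurable_orthant_bcont
      simple_bochner_integrable_step nn_integral_step_approx_tendsto step_integrals_tendsto f)
  then have *: "has_bochner_integral M (\<lambda>u. indicator nonneg_orthant u *\<^sub>R f u) (orthant_integral M f)"
    by (simp add: has_banach_integral_iff_has_bochner_integral)
  show "orthant_integral M f = (LINT u|M. indicator nonneg_orthant u *\<^sub>R f u)"
    using has_bochner_integral_integral_eq[OF *] by simp
  show "integrable M (\<lambda>u. indicator nonneg_orthant u *\<^sub>R f u)"
    using * by (rule integrable.intros)
qed

text \<open>The indicator disappears because the measure lives on the orthant; since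
  \<open>f\<close> is arbitrary elsewhere, its global measurability has to be assumed.\<close>

lemma integral_orthant:
  fixes f :: "real ^ 'n \<Rightarrow> 'x::{banach, second_countable_topology}"
  assumes f: "orthant_bcont f" and [measurable]: "f \<in> borel_measurable borel"
  shows "orthant_integral M f = (LINT u|M. f u)" and "integrable M f"
proof -
  have ae: "AE u in M. indicator nonneg_orthant u *\<^sub>R f u = f u"
    using AE_orthant by eventually_elim simp
  have m: "f \<in> borel_measurable M"
    by (simp add: measurable_cong_sets[OF sets_eq refl])
  show "orthant_integral M f = (LINT u|M. f u)"
    unfolding orthant_integral_real(1)[OF f]
    by (intro integral_cong_AE borel_measurable_orthant_bcont f m ae)
  show "integrable M f"
    using orthant_integral_real(2)[OF f] integrable_cong_AE[OF borel_measurable_orthant_bcont[OF f] m ae]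
    by simp
qed

lemma orthant_integral_add:
  fixes f g :: "real ^ 'n \<Rightarrow> 'x::banach"
  assumes "orthant_bcont f" "orthant_bcont g"
  shows "orthant_integral M (\<lambda>u. f u + g u) = orthant_integral M f + orthant_integral M g"
proof (rule LIMSEQ_unique)
  show "(\<lambda>i. Bochner_Integration.simple_bochner_integral M (step_approx i (\<lambda>u. f u + g u))) \<longlonglongrightarrow> orthant_integral M (\<lambda>u. f u + g u)"
    by (intro step_integrals_tendsto orthant_bcont_add assms)
  have "step_approx i (\<lambda>u. f u + g u) = (\<lambda>u. step_approx i f u + step_approx i g u)" for i
    by (simp add: step_approx_def fun_eq_iff scaleR_add_right)
  then show "(\<lambda>i. Bochner_Integration.simple_bochner_integral M (step_approx i (\<lambda>u. f u + g u))) \<longlonglongrightarrow> orthant_integral M f + orthant_integral M g"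
    by (simp add: simple_bochner_integral_add simple_bochner_integrable_step tendsto_add step_integrals_tendsto assms)
qed

lemma orthant_integral_bounded_linear:
  fixes f :: "real ^ 'n \<Rightarrow> 'x::banach" and L :: "'x \<Rightarrow> 'y::banach"
  assumes L: "bounded_linear L" and f: "orthant_bcont f"
  shows "orthant_integral M (\<lambda>u. L (f u)) = L (orthant_integral M f)"
proof (rule LIMSEQ_unique)
  show "(\<lambda>i. Bochner_Integration.simple_bochner_integral M (step_approx i (\<lambda>u. L (f u)))) \<longlonglongrightarrow> orthant_integral M (\<lambda>u. L (f u))"
    by (rule step_integrals_tendsto[OF orthant_bcont_bounded_linear[OF L f]])
  have "step_approx i (\<lambda>u. L (f u)) = (\<lambda>u. L (step_approx i f u))" for i
    by (simp add: step_approx_def fun_eq_iff linear_cmul[OF bounded_linear.linear[OF L]])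
  then have "Bochner_Integration.simple_bochner_integral M (step_approx i (\<lambda>u. L (f u))) = L (Bochner_Integration.simple_bochner_integral M (step_approx i f))" for i
    by (simp add: simple_bochner_integral_linear[OF bounded_linear.linear[OF L]] simple_bochner_integrable_step)
  then show "(\<lambda>i. Bochner_Integration.simple_bochner_integral M (step_approx i (\<lambda>u. L (f u)))) \<longlonglongrightarrow> L (orthant_integral M f)"
    by (simp add: bounded_linear.tendsto[OF L] step_integrals_tendsto f)
qed

lemma orthant_integral_diff:
  fixes f g :: "real ^ 'n \<Rightarrow> 'x::banach"
  assumes "orthant_bcont f" "orthant_bcont g"
  shows "orthant_integral M (\<lambda>u. f u - g u) = orthant_integral M f - orthant_integral M g"
  using orthant_integral_add[OF assms(1) orthant_bcont_bounded_linear[OF bounded_linear_minus[OF bounded_linear_ident] assms(2)]]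
    orthant_integral_bounded_linear[OF bounded_linear_minus[OF bounded_linear_ident] assms(2)]
  by simp

lemma orthant_integral_scaleR:
  fixes x :: "'x::banach"
  assumes "orthant_bcont \<phi>"
  shows "orthant_integral M (\<lambda>u. \<phi> u *\<^sub>R x) = orthant_integral M \<phi> *\<^sub>R x"
  by (rule orthant_integral_bounded_linear[OF bounded_linear_scaleR_left assms])

lemma orthant_integral_zero: "orthant_integral M (\<lambda>u. 0 :: 'x::banach) = 0"
  using orthant_integral_scaleR[OF orthant_bcont_const[of 0], of "0::'x"] by simp

lemma orthant_integral_sum:
  fixes f :: "'i \<Rightarrow> real ^ 'n \<Rightarrow> 'x::banach"
  assumes "\<And>i. i \<in> I \<Longrightarrow> orthant_bcont (f i)"
  shows "orthant_integral M (\<lambda>u. \<Sum>i\<in>I. f i u) = (\<Sum>i\<in>I. orthant_integral M (f i))"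
  using assms
  by (induction I rule: infinite_finite_induct)
     (auto simp: orthant_integral_zero orthant_integral_add orthant_bcont_sum)

lemma norm_orthant_integral_le:
  fixes f :: "real ^ 'n \<Rightarrow> 'x::banach"
  assumes f: "orthant_bcont f"
  shows "norm (orthant_integral M f) \<le> orthant_integral M (\<lambda>u. norm (f u))"
proof (rule LIMSEQ_le)
  show "(\<lambda>i. norm (Bochner_Integration.simple_bochner_integral M (step_approx i f))) \<longlonglongrightarrow> norm (orthant_integral M f)"
    by (intro tendsto_norm step_integrals_tendsto f)
  show "(\<lambda>i. Bochner_Integration.simple_bochner_integral M (step_approx i (\<lambda>u. norm (f u)))) \<longlonglongrightarrow> orthant_integral M (\<lambda>u. norm (f u))"
    by (intro step_integrals_tendsto orthant_bcont_norm f)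
  have "step_approx i (\<lambda>u. norm (f u)) = (\<lambda>u. norm (step_approx i f u))" for i
    by (simp add: step_approx_def fun_eq_iff)
  then show "\<exists>N. \<forall>i\<ge>N. norm (Bochner_Integration.simple_bochner_integral M (step_approx i f)) \<le> Bochner_Integration.simple_bochner_integral M (step_approx i (\<lambda>u. norm (f u)))"
    using simple_bochner_integral_norm_bound[OF simple_bochner_integrable_step, of _ f] by auto
qed

lemma orthant_integral_mono:
  fixes f g :: "real ^ 'n \<Rightarrow> real"
  assumes "orthant_bcont f" "orthant_bcont g" "\<And>u. u \<in> nonneg_orthant \<Longrightarrow> f u \<le> g u"
  shows "orthant_integral M f \<le> orthant_integral M g"
  unfolding orthant_integral_real(1)[OF assms(1)] orthant_integral_real(1)[OF assms(2)]
  by (intro integral_mono orthant_integral_real(2) assms(1,2)) (auto simp: indicator_def assms(3))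

lemma orthant_integral_const: "orthant_integral M (\<lambda>u. c :: 'x::banach) = measure M UNIV *\<^sub>R c"
proof -
  have "orthant_integral M (\<lambda>u. 1 :: real) = measure M UNIV"
    using integral_orthant(1)[OF orthant_bcont_const, of "1::real"] by simp
  then show ?thesis
    using orthant_integral_scaleR[OF orthant_bcont_const[of 1], of c] by simp
qed

lemma norm_orthant_integral_le_bound:
  fixes f :: "real ^ 'n \<Rightarrow> 'x::banach"
  assumes f: "orthant_bcont f" and B: "\<And>u. u \<in> nonneg_orthant \<Longrightarrow> norm (f u) \<le> B"
  shows "norm (orthant_integral M f) \<le> measure M UNIV * B"
  using norm_orthant_integral_le[OF f] orthant_integral_mono[OF orthant_bcont_norm[OF f] orthant_bcont_const[of B] B]
  by (simp add: orthant_integral_const)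

text \<open>Dominated convergence in an arbitrary Banach space. It reduces to the scalar functions
  \<open>norm (F k u - f u)\<close>, which are again bounded and continuous on the orthant.\<close>

lemma orthant_integral_tendsto:
  fixes f :: "real ^ 'n \<Rightarrow> 'x::banach" and F :: "nat \<Rightarrow> real ^ 'n \<Rightarrow> 'x"
  assumes F: "\<And>k. orthant_bcont (F k)" and f: "orthant_bcont f"
    and lim: "\<And>u. u \<in> nonneg_orthant \<Longrightarrow> (\<lambda>k. F k u) \<longlonglongrightarrow> f u"
    and B: "\<And>k u. u \<in> nonneg_orthant \<Longrightarrow> norm (F k u) \<le> B"
  shows "(\<lambda>k. orthant_integral M (F k)) \<longlonglongrightarrow> orthant_integral M f"
proof -
  have bc: "orthant_bcont (\<lambda>u. norm (F k u - f u))" for k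
    by (intro orthant_bcont_norm orthant_bcont_diff F f)
  have fB: "norm (f u) \<le> B" if "u \<in> nonneg_orthant" for u
    using lim[OF that] B[OF that] by (intro LIMSEQ_le_const2[OF tendsto_norm]) auto
  have "(\<lambda>k. LINT u|M. indicator nonneg_orthant u *\<^sub>R norm (F k u - f u)) \<longlonglongrightarrow> (LINT u|M. 0)"
  proof (rule integral_dominated_convergence[where w="\<lambda>u. 2 * B"])
    show "(\<lambda>u. indicator nonneg_orthant u *\<^sub>R norm (F k u - f u)) \<in> borel_measurable M" for k
      by (intro borel_measurable_orthant_bcont bc)
    show "AE u in M. (\<lambda>k. indicator nonneg_orthant u *\<^sub>R norm (F k u - f u)) \<longlonglongrightarrow> 0"
    proof (intro AE_I2)
      fix u show "(\<lambda>k. indicator nonneg_orthant u *\<^sub>R norm (F k u - f u)) \<longlonglongrightarrow> 0"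
        using lim[of u] by (cases "u \<in> nonneg_orthant") (auto simp: LIM_zero_iff intro: tendsto_norm_zero)
    qed
    have "0 \<le> B" using fB[OF pos_vec_in[of 0]] norm_ge_zero order_trans by blast
    show "AE u in M. norm (indicator nonneg_orthant u *\<^sub>R norm (F k u - f u)) \<le> 2 * B" for k
    proof (intro AE_I2)
      fix u
      show "norm (indicator nonneg_orthant u *\<^sub>R norm (F k u - f u)) \<le> 2 * B"
        using B[of u k] fB[of u] norm_triangle_ineq4[of "F k u" "f u"] \<open>0 \<le> B\<close> by (auto simp: indicator_def)
    qed
  qed auto
  then have lim0: "(\<lambda>k. orthant_integral M (\<lambda>u. norm (F k u - f u))) \<longlonglongrightarrow> 0"
    by (simp add: orthant_integral_real(1)[OF bc])
  have "(\<lambda>k. orthant_integral M (F k) - orthant_integral M f) \<longlonglongrightarrow> 0"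
  proof (rule Lim_null_comparison[OF _ lim0], intro always_eventually allI)
    fix k
    show "norm (orthant_integral M (F k) - orthant_integral M f) \<le> orthant_integral M (\<lambda>u. norm (F k u - f u))"
      using norm_orthant_integral_le[OF orthant_bcont_diff[OF F f], of k] orthant_integral_diff[OF F f, of k] by simp
  qed
  then show ?thesis by (simp add: LIM_zero_iff)
qed

end

section \<open>Bernstein approximation on the compactified orthant\<close>

text \<open>The probability that independent binomial variables with parameters \<open>N\<close> and
  \<open>y $ j\<close> take the values \<open>k j\<close>. Total mass and variance of this law drive
  the approximation below.\<close>

definition bernstein_weight :: "nat \<Rightarrow> ('n::finite \<Rightarrow> nat) \<Rightarrow> real ^ 'n \<Rightarrow> real" where
  "bernstein_weight N k y = (\<Prod>j\<in>UNIV. Bernstein N (k j) (y $ j))"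

lemma bernstein_weight_nonneg:
  "y \<in> {0..1} \<Longrightarrow> 0 \<le> bernstein_weight N k y"
  unfolding bernstein_weight_def
  by (intro prod_nonneg ballI Bernstein_nonneg) (auto simp: less_eq_vec_def)

lemma sum_bernstein_weight: "(\<Sum>k\<in>PiE UNIV (\<lambda>_. {..N}). bernstein_weight N k y) = 1"
  unfolding bernstein_weight_def
  by (subst prod_sum_PiE[symmetric]) auto

lemma sum_Bernstein_square_dist:
  assumes "N > 0"
  shows "(\<Sum>k\<le>N. Bernstein N k x * (real k / real N - x)\<^sup>2) = x * (1 - x) / real N"
proof -
  have "(\<Sum>k\<le>N. (real k - N * x)\<^sup>2 * Bernstein N k x)
      = (\<Sum>k\<le>N. real k * (real k - 1) * Bernstein N k x + (1 - 2 * N * x) * (real k * Bernstein N k x) + (N * x)\<^sup>2 * Bernstein N k x)"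
    by (intro sum.cong refl) (simp add: algebra_simps power2_eq_square)
  also have "\<dots> = real N * (real N - 1) * x\<^sup>2 + (1 - 2 * N * x) * (N * x) + (N * x)\<^sup>2"
    by (simp add: sum.distrib flip: sum_distrib_left)
  also have "\<dots> = N * x * (1 - x)"
    by (simp add: algebra_simps power2_eq_square)
  finally have "(\<Sum>k\<le>N. (real k - N * x)\<^sup>2 * Bernstein N k x) / N\<^sup>2 = x * (1 - x) / N"
    using assms by (simp add: power2_eq_square)
  then show ?thesis
    using assms by (simp add: sum_divide_distrib field_split_simps power2_commute)
qed

text \<open>The squared distance is a sum over coordinates; in each term the other coordinates sum
  to 1 and one binomial variance remains.\<close>

lemma sum_bernstein_weight_square_dist:
  fixes y :: "real ^ 'n::finite"
  assumes "N > 0"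
  shows "(\<Sum>k\<in>PiE UNIV (\<lambda>_. {..N}). bernstein_weight N k y * (norm ((\<chi> j. real (k j) / real N) - y))\<^sup>2)
      = (\<Sum>i\<in>UNIV. y $ i * (1 - y $ i) / real N)"
proof -
  have one: "(\<Sum>k\<in>PiE UNIV (\<lambda>_. {..N}). bernstein_weight N k y * (real (k i) / real N - y $ i)\<^sup>2)
      = y $ i * (1 - y $ i) / real N" for i :: 'n
  proof -
    let ?f = "\<lambda>j m. Bernstein N m (y $ j) * (if j = i then (real m / real N - y $ i)\<^sup>2 else 1)"
    have "(\<Sum>k\<in>PiE UNIV (\<lambda>_. {..N}). bernstein_weight N k y * (real (k i) / real N - y $ i)\<^sup>2)
        = (\<Sum>k\<in>PiE UNIV (\<lambda>_. {..N}). \<Prod>j\<in>UNIV. ?f j (k j))"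
      unfolding bernstein_weight_def prod.distrib by (intro sum.cong refl) (simp add: prod.delta)
    also have "\<dots> = (\<Prod>j\<in>UNIV. \<Sum>m\<in>{..N}. ?f j m)"
      by (subst prod_sum_PiE) auto
    also have "\<dots> = (\<Prod>j\<in>UNIV. if j = i then y $ i * (1 - y $ i) / real N else 1)"
      by (intro prod.cong refl) (simp add: sum_Bernstein_square_dist[OF assms])
    finally show ?thesis by (simp add: prod.delta)
  qed
  have "(norm ((\<chi> j. real (k j) / real N) - y))\<^sup>2 = (\<Sum>i\<in>UNIV. (real (k i) / real N - y $ i)\<^sup>2)" for k :: "'n \<Rightarrow> nat"
    by (simp add: norm_vec_def L2_set_def sum_nonneg)
  then show ?thesis
    by (simp add: sum_distrib_left) (subst sum.swap, simp add: one)
qed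

text \<open>Chebyshev's argument: nodes near \<open>y\<close> are handled by uniform continuity,
  distant ones by the variance. The coefficients are values of \<open>F\<close> itself, so the proof
  works in any normed space.\<close>

theorem bernstein_approximation:
  fixes F :: "real ^ 'n::finite \<Rightarrow> 'x::real_normed_vector"
  assumes F: "continuous_on {0..1} F" and e: "e > 0"
  obtains N where "N > 0"
    "\<And>y. y \<in> {0..1} \<Longrightarrow>
      norm (F y - (\<Sum>k\<in>PiE UNIV (\<lambda>_. {..N}). bernstein_weight N k y *\<^sub>R F (\<chi> j. real (k j) / real N))) \<le> e"
proof -
  have comp: "compact {0..1::real^'n}"
    using compact_cbox[of "0::real^'n" 1] by (simp add: interval_cbox)
  then obtain B where B: "B > 0" "\<And>y. y \<in> {0..1} \<Longrightarrow> norm (F y) \<le> B"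
    using compact_imp_bounded[OF compact_continuous_image[OF F]] unfolding bounded_pos by blast
  obtain d where d: "d > 0" "\<And>y z. y \<in> {0..1} \<Longrightarrow> z \<in> {0..1} \<Longrightarrow> dist z y < d \<Longrightarrow> dist (F z) (F y) < e / 2"
    using compact_uniformly_continuous[OF F comp] e unfolding uniformly_continuous_on_def
    by (metis half_gt_zero)
  \<comment> \<open>At distance at least \<open>d\<close> the trivial bound \<open>2 * B\<close> is
    then at most \<open>C\<close> times the squared distance.\<close>
  define C where "C = 2 * B / d\<^sup>2"
  have "C > 0" using B d by (simp add: C_def)
  obtain N :: nat where N: "real N > C * CARD('n) * 2 / e"
    using reals_Archimedean2 by blast
  moreover have "C * CARD('n) * 2 / e > 0" using \<open>C > 0\<close> e by simp
  ultimately have N0: "N > 0" by (cases N) auto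
  show thesis
  proof (rule that[OF N0])
    fix y :: "real ^ 'n" assume y: "y \<in> {0..1}"
    let ?K = "PiE UNIV (\<lambda>_::'n. {..N})"
    let ?p = "\<lambda>k. (\<chi> j. real (k j) / real N) :: real ^ 'n"
    have close: "norm (F y - F (?p k)) \<le> e / 2 + C * (norm (?p k - y))\<^sup>2" if k: "k \<in> ?K" for k
    proof -
      have pk: "?p k \<in> {0..1}"
        using k N0 by (auto simp: less_eq_vec_def PiE_iff)
      show ?thesis
      proof (cases "dist (?p k) y < d")
        case True
        then have "dist (F (?p k)) (F y) < e / 2" by (intro d y pk)
        moreover have "0 \<le> C * (norm (?p k - y))\<^sup>2" using \<open>C > 0\<close> by simp
        ultimately show ?thesis
          by (simp add: dist_norm norm_minus_commute)
      next
        case False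
        then have "d \<le> norm (?p k - y)" by (simp add: dist_norm)
        then have "d\<^sup>2 \<le> (norm (?p k - y))\<^sup>2" using d by (intro power_mono) auto
        then have "C * d\<^sup>2 \<le> C * (norm (?p k - y))\<^sup>2"
          using \<open>C > 0\<close> by simp
        moreover have "C * d\<^sup>2 = 2 * B" using d by (simp add: C_def)
        moreover have "norm (F y - F (?p k)) \<le> B + B"
          using norm_triangle_ineq4[of "F y" "F (?p k)"] B(2)[OF y] B(2)[OF pk] by linarith
        ultimately show ?thesis using e by simp
      qed
    qed
    have "F y = (\<Sum>k\<in>?K. bernstein_weight N k y *\<^sub>R F y)"
      by (simp add: sum_bernstein_weight flip: scaleR_sum_left)
    then have "norm (F y - (\<Sum>k\<in>?K. bernstein_weight N k y *\<^sub>R F (?p k)))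
        = norm (\<Sum>k\<in>?K. bernstein_weight N k y *\<^sub>R (F y - F (?p k)))"
      by (simp add: scaleR_diff_right sum_subtractf)
    also have "\<dots> \<le> (\<Sum>k\<in>?K. bernstein_weight N k y * (e / 2 + C * (norm (?p k - y))\<^sup>2))"
      by (intro sum_norm_le)
        (auto simp: bernstein_weight_nonneg[OF y] intro!: mult_left_mono close)
    also have "\<dots> = (\<Sum>k\<in>?K. bernstein_weight N k y) * (e / 2)
        + C * (\<Sum>k\<in>?K. bernstein_weight N k y * (norm (?p k - y))\<^sup>2)"
      by (simp add: distrib_left sum.distrib sum_distrib_left sum_distrib_right mult_ac)
    also have "\<dots> = e / 2 + C * (\<Sum>i\<in>UNIV. y $ i * (1 - y $ i) / real N)"
      by (simp add: sum_bernstein_weight sum_bernstein_weight_square_dist[OF N0])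
    also have "\<dots> \<le> e / 2 + C * (\<Sum>i\<in>(UNIV::'n set). 1 / real N)"
    proof -
      have "y $ i * (1 - y $ i) \<le> 1" for i
        using y mult_mono[of "y $ i" 1 "1 - y $ i" 1] by (auto simp: less_eq_vec_def)
      then show ?thesis
        using \<open>C > 0\<close> by (intro add_left_mono mult_left_mono sum_mono divide_right_mono) auto
    qed
    also have "\<dots> = e / 2 + C * CARD('n) / real N" by simp
    also have "\<dots> \<le> e / 2 + e / 2"
      using N N0 e by (simp add: field_simps)
    finally show "norm (F y - (\<Sum>k\<in>?K. bernstein_weight N k y *\<^sub>R F (?p k))) \<le> e" by simp
  qed
qed

text \<open>For positive \<open>k\<close> the factor \<open>y ^ k\<close> kills the constant term,
  so the powers start at 1. In the end this yields exponentials that decay in every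
  coordinate.\<close>

lemma Bernstein_eq_sum_powers:
  assumes "1 \<le> k" "k \<le> N"
  obtains b where "\<And>y. Bernstein N k y = (\<Sum>i\<in>{1..N}. b i * y ^ i)"
proof
  fix y :: real
  let ?c = "\<lambda>i. real (N choose k) * (real ((N - k) choose i) * (- 1) ^ i)"
  have "(1 - y) ^ (N - k) = (\<Sum>i\<le>N - k. real ((N - k) choose i) * (- y) ^ i)"
    using binomial_ring[of "- y" 1 "N - k"] by simp
  then have "Bernstein N k y = (\<Sum>i\<le>N - k. ?c i * y ^ (i + k))"
    by (simp add: Bernstein_def sum_distrib_left power_add power_minus[of y] mult_ac)
  also have "\<dots> = (\<Sum>i\<in>{k..N}. ?c (i - k) * y ^ i)"
    using assms by (intro sum.reindex_bij_witness[of _ "\<lambda>i. i - k" "\<lambda>i. i + k"]) auto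
  \<comment> \<open>Padding with zero coefficients makes the range of summation independent of
    \<open>k\<close>.\<close>
  also have "\<dots> = (\<Sum>i\<in>{1..N}. (if i < k then 0 else ?c (i - k)) * y ^ i)"
    using assms by (intro sum.mono_neutral_cong_left) auto
  finally show "Bernstein N k y = (\<Sum>i\<in>{1..N}. (if i < k then 0 else ?c (i - k)) * y ^ i)" .
qed

section \<open>Functions vanishing at infinity and exponential sums\<close>

definition orthant_C0 :: "(real ^ 'n::finite \<Rightarrow> 'x::real_normed_vector) \<Rightarrow> bool" where
  "orthant_C0 f \<longleftrightarrow> continuous_on nonneg_orthant f \<and>
     (\<forall>e>0. \<exists>R. \<forall>u\<in>nonneg_orthant. norm u > R \<longrightarrow> norm (f u) < e)"

definition exp_char :: "('n::finite \<Rightarrow> nat) \<Rightarrow> real ^ 'n \<Rightarrow> real" where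
  "exp_char m u = exp (- (\<Sum>j\<in>UNIV. real (m j) * u $ j))"

abbreviation exponents :: "nat \<Rightarrow> ('n::finite \<Rightarrow> nat) set" where
  "exponents N \<equiv> PiE UNIV (\<lambda>_. {1..N})"

lemma exp_char_eq_prod: "exp_char m u = (\<Prod>j\<in>UNIV. (exp (- u $ j)) ^ m j)"
  by (simp add: exp_char_def exp_sum sum_negf[symmetric] exp_of_nat_mult[symmetric])

text \<open>The compactification \<open>u \<mapsto> (exp (- u\<^sub>j))\<^sub>j\<close> of the orthant turns functions vanishing at infinity
  into continuous functions on the cube that vanish on the faces \<open>y\<^sub>j = 0\<close>. The Bernstein
  polynomial of such a function is divisible by every coordinate, which is why only
  exponents \<open>m j \<ge> 1\<close> occur.\<close>

lemma continuous_on_cube_compactification: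
  fixes f :: "real ^ 'n::finite \<Rightarrow> 'x::real_normed_vector"
  assumes f: "orthant_C0 f"
  shows "continuous_on {0..1} (\<lambda>y. if \<exists>j. y $ j \<le> 0 then 0 else f (\<chi> j. - ln (y $ j)))"
    (is "continuous_on _ ?F")
  unfolding continuous_on_def
proof
  fix y :: "real ^ 'n" assume y: "y \<in> {0..1}"
  show "(?F \<longlongrightarrow> ?F y) (at y within {0..1})"
  proof (cases "\<exists>j. y $ j \<le> 0")
    case True
    then obtain i where "y $ i \<le> 0" by blast
    then have yi: "y $ i = 0" using y by (auto simp: less_eq_vec_def intro: antisym)
    have "(?F \<longlongrightarrow> 0) (at y within {0..1})"
    proof (rule tendstoI)
      fix e :: real assume "e > 0"
      then obtain R where R: "\<And>u. u \<in> nonneg_orthant \<Longrightarrow> norm u > R \<Longrightarrow> norm (f u) < e"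
        using f unfolding orthant_C0_def by blast
      have "((\<lambda>z. z $ i) \<longlongrightarrow> y $ i) (at y within {0..1})"
        by (intro tendsto_intros)
      then have "\<forall>\<^sub>F z in at y within {0..1}. z $ i < exp (- R)"
        by (rule order_tendstoD) (simp add: yi)
      moreover have "\<forall>\<^sub>F z in at y within {0..1}. z \<in> {0..1}"
        by (auto simp: eventually_at_filter)
      ultimately show "\<forall>\<^sub>F z in at y within {0..1}. dist (?F z) 0 < e"
      proof eventually_elim
        case (elim z)
        show ?case
        proof (cases "\<exists>j. z $ j \<le> 0")
          case False
          then have pos: "\<And>j. z $ j > 0" by (simp add: not_le)
          let ?u = "(\<chi> j. - ln (z $ j)) :: real ^ 'n"
          have "?u \<in> nonneg_orthant"
            using elim(2) pos by (auto simp: nonneg_orthant_def less_eq_vec_def)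
          moreover have "ln (z $ i) < ln (exp (- R))"
            using elim(1) pos[of i] by (subst ln_less_cancel_iff) auto
          then have "R < ?u $ i" by simp
          then have "R < norm ?u"
            using component_le_norm_cart[of ?u i] by linarith
          ultimately show ?thesis using R False \<open>e > 0\<close> by (simp add: not_le)
        qed (simp add: \<open>e > 0\<close>)
      qed
    qed
    with True show ?thesis by simp
  next
    case False
    then have pos: "\<And>j. y $ j > 0" by (simp add: not_le)
    have ev: "\<forall>\<^sub>F z in at y within {0..1}. \<forall>j. z $ j > 0"
    proof (rule eventually_all_finite)
      fix j
      have "((\<lambda>z. z $ j) \<longlongrightarrow> y $ j) (at y within {0..1})"
        by (intro tendsto_intros)
      then show "\<forall>\<^sub>F z in at y within {0..1}. z $ j > 0"
        by (rule order_tendstoD) (rule pos)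
    qed
    have "((\<lambda>z. f (\<chi> j. - ln (z $ j))) \<longlongrightarrow> f (\<chi> j. - ln (y $ j))) (at y within {0..1})"
    proof (rule continuous_on_tendsto_compose[of nonneg_orthant f])
      show "continuous_on nonneg_orthant f" using f by (simp add: orthant_C0_def)
      show "((\<lambda>z. \<chi> j. - ln (z $ j)) \<longlongrightarrow> (\<chi> j. - ln (y $ j))) (at y within {0..1})"
        using pos by (intro tendsto_intros) (metis less_irrefl)
      show "(\<chi> j. - ln (y $ j)) \<in> nonneg_orthant"
        using y pos by (auto simp: nonneg_orthant_def less_eq_vec_def)
      have "\<forall>\<^sub>F z in at y within {0..1}. z \<in> {0..1}"
        by (auto simp: eventually_at_filter)
      with ev show "\<forall>\<^sub>F z in at y within {0..1}. (\<chi> j. - ln (z $ j)) \<in> nonneg_orthant"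
        by eventually_elim (auto simp: nonneg_orthant_def less_eq_vec_def)
    qed
    moreover have "\<forall>\<^sub>F z in at y within {0..1}. f (\<chi> j. - ln (z $ j)) = ?F z"
      using ev by eventually_elim (simp add: linorder_not_le[symmetric])
    ultimately have "(?F \<longlongrightarrow> f (\<chi> j. - ln (y $ j))) (at y within {0..1})"
      by (rule Lim_transform_eventually)
    then show ?thesis
      using False by simp
  qed
qed

theorem exp_char_approximation:
  fixes f :: "real ^ 'n::finite \<Rightarrow> 'x::real_normed_vector"
  assumes f: "orthant_C0 f" and e: "e > 0"
  obtains N c where
    "\<And>u. u \<in> nonneg_orthant \<Longrightarrow> norm (f u - (\<Sum>m\<in>exponents N. exp_char m u *\<^sub>R c m)) \<le> e"
proof -
  define F where "F y = (if \<exists>j. y $ j \<le> 0 then 0 else f (\<chi> j. - ln (y $ j)))" for y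
  have "continuous_on {0..1} F"
    using continuous_on_cube_compactification[OF f] by (simp add: F_def[abs_def])
  from bernstein_approximation[OF this e] obtain N where N0: "N > 0" and
    N: "\<And>y. y \<in> {0..1} \<Longrightarrow> norm (F y - (\<Sum>k\<in>PiE UNIV (\<lambda>_. {..N}). bernstein_weight N k y *\<^sub>R F (\<chi> j. real (k j) / real N))) \<le> e"
    by blast
  have "\<exists>b. \<forall>y. Bernstein N k y = (\<Sum>i\<in>{1..N}. b i * y ^ i)" if "k \<in> {1..N}" for k
    using Bernstein_eq_sum_powers[of k N] that by (metis atLeastAtMost_iff)
  then obtain b where b: "\<And>k y. k \<in> {1..N} \<Longrightarrow> Bernstein N k y = (\<Sum>i\<in>{1..N}. b k i * y ^ i)"
    by metis
  \<comment> \<open>The coefficient of the monomial with exponents \<open>m\<close> after the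
    products of one-dimensional Bernstein polynomials have been expanded.\<close>
  define c where "c m = (\<Sum>k\<in>exponents N. (\<Prod>j\<in>UNIV. b (k j) (m j)) *\<^sub>R F (\<chi> j. real (k j) / real N))" for m :: "'n \<Rightarrow> nat"
  show thesis
  proof (rule that[of c N])
    fix u :: "real ^ 'n" assume u: "u \<in> nonneg_orthant"
    define y :: "real ^ 'n" where "y = (\<chi> j. exp (- u $ j))"
    have y: "y \<in> {0..1}"
      using u by (auto simp: y_def less_eq_vec_def nonneg_orthant_def)
    have Fy: "F y = f u" by (simp add: F_def y_def not_le vec_lambda_eta)
    have "(\<Sum>k\<in>PiE UNIV (\<lambda>_. {..N}). bernstein_weight N k y *\<^sub>R F (\<chi> j. real (k j) / real N))
        = (\<Sum>k\<in>exponents N. bernstein_weight N k y *\<^sub>R F (\<chi> j. real (k j) / real N))"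
    proof (rule sum.mono_neutral_right)
      show "\<forall>k\<in>PiE UNIV (\<lambda>_. {..N}) - exponents N. bernstein_weight N k y *\<^sub>R F (\<chi> j. real (k j) / real N) = 0"
      proof
        fix k assume "k \<in> PiE UNIV (\<lambda>_::'n. {..N}) - exponents N"
        then obtain j where "k j = 0"
          by (auto simp: PiE_iff Suc_le_eq)
        then have "F (\<chi> j. real (k j) / real N) = 0"
          unfolding F_def by (intro if_P exI[of _ j]) simp
        then show "bernstein_weight N k y *\<^sub>R F (\<chi> j. real (k j) / real N) = 0"
          by simp
      qed
    qed (auto simp: PiE_iff intro!: finite_PiE)
    also have "\<dots> = (\<Sum>k\<in>exponents N. \<Sum>m\<in>exponents N. exp_char m u *\<^sub>R (\<Prod>j\<in>UNIV. b (k j) (m j)) *\<^sub>R F (\<chi> j. real (k j) / real N))"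
    proof (intro sum.cong refl)
      fix k :: "'n \<Rightarrow> nat" assume k: "k \<in> exponents N"
      have "bernstein_weight N k y = (\<Prod>j\<in>UNIV. \<Sum>i\<in>{1..N}. b (k j) i * (y $ j) ^ i)"
        using k unfolding bernstein_weight_def by (intro prod.cong refl b) (auto simp: PiE_iff)
      also have "\<dots> = (\<Sum>m\<in>exponents N. \<Prod>j\<in>UNIV. b (k j) (m j) * (y $ j) ^ m j)"
        by (subst prod_sum_PiE) auto
      also have "\<dots> = (\<Sum>m\<in>exponents N. exp_char m u * (\<Prod>j\<in>UNIV. b (k j) (m j)))"
        by (simp add: prod.distrib exp_char_eq_prod y_def mult.commute)
      finally show "bernstein_weight N k y *\<^sub>R F (\<chi> j. real (k j) / real N)
          = (\<Sum>m\<in>exponents N. exp_char m u *\<^sub>R (\<Prod>j\<in>UNIV. b (k j) (m j)) *\<^sub>R F (\<chi> j. real (k j) / real N))"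
        by (simp add: scaleR_sum_left)
    qed
    also have "\<dots> = (\<Sum>m\<in>exponents N. exp_char m u *\<^sub>R c m)"
      by (subst sum.swap) (simp add: c_def scaleR_sum_right)
    finally show "norm (f u - (\<Sum>m\<in>exponents N. exp_char m u *\<^sub>R c m)) \<le> e"
      using N[OF y] by (simp add: Fy)
  qed
qed

section \<open>Centred Gaussians on the orthant\<close>

definition gauss :: "real ^ 'n::finite \<Rightarrow> real ^ 'n \<Rightarrow> real" where
  "gauss s u = exp (- (\<Sum>j\<in>UNIV. s $ j * (u $ j)\<^sup>2 / 2))"

abbreviation nat_vec :: "('n::finite \<Rightarrow> nat) \<Rightarrow> real ^ 'n" where
  "nat_vec m \<equiv> (\<chi> j. real (m j))"

text \<open>Ensures that the substitution u_j \<mapsto> sqrt (2 u_j) sends infinity to infinity and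
  so preserves decay.\<close>

lemma norm_le_sqrt_vec:
  fixes u :: "real ^ 'n::finite"
  assumes "u \<in> nonneg_orthant"
  shows "norm u \<le> real CARD('n) * norm (\<chi> j. sqrt (2 * u $ j)) ^ 2"
proof -
  let ?v = "(\<chi> j. sqrt (2 * u $ j)) :: real ^ 'n"
  have "norm u \<le> (\<Sum>j\<in>UNIV. \<bar>u $ j\<bar>)" by (rule norm_le_l1_cart)
  also have "\<dots> \<le> (\<Sum>j\<in>(UNIV::'n set). norm ?v ^ 2)"
  proof (rule sum_mono)
    fix j
    have "0 \<le> u $ j" using assms by (simp add: nonneg_orthant_def)
    then have "\<bar>u $ j\<bar> \<le> (?v $ j) ^ 2" by simp
    also have "\<dots> \<le> norm ?v ^ 2"
      using component_le_norm_cart[of ?v j] power_mono[of "\<bar>?v $ j\<bar>" "norm ?v" 2] by simp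
    finally show "\<bar>u $ j\<bar> \<le> norm ?v ^ 2" .
  qed
  finally show ?thesis by simp
qed

text \<open>The substitution u_j \<mapsto> sqrt (2 u_j) is a homeomorphism of the orthant that turns
  \<open>gauss (nat_vec m)\<close> into \<open>exp_char m\<close>. On the orthant no information is
  lost by using even functions, which is why Gaussians centred at 0 are enough.\<close>

corollary gauss_approximation:
  fixes f :: "real ^ 'n::finite \<Rightarrow> 'x::real_normed_vector"
  assumes f: "orthant_C0 f" and e: "e > 0"
  obtains N c where
    "\<And>u. u \<in> nonneg_orthant \<Longrightarrow> norm (f u - (\<Sum>m\<in>exponents N. gauss (nat_vec m) u *\<^sub>R c m)) \<le> e"
proof -
  define S :: "real ^ 'n \<Rightarrow> real ^ 'n" where "S u = (\<chi> j. sqrt (2 * u $ j))" for u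
  have S: "S u \<in> nonneg_orthant" if "u \<in> nonneg_orthant" for u
    using that by (simp add: S_def nonneg_orthant_def)
  have "orthant_C0 (\<lambda>u. f (S u))"
    unfolding orthant_C0_def
  proof (intro conjI allI impI)
    have "continuous_on nonneg_orthant S"
      unfolding S_def by (intro continuous_intros)
    with S show "continuous_on nonneg_orthant (\<lambda>u. f (S u))"
      using f by (intro continuous_on_compose2[of nonneg_orthant f _ S]) (auto simp: orthant_C0_def)
    fix e :: real assume "e > 0"
    then obtain R where R: "\<And>u. u \<in> nonneg_orthant \<Longrightarrow> norm u > R \<Longrightarrow> norm (f u) < e"
      using f unfolding orthant_C0_def by blast
    show "\<exists>R. \<forall>u\<in>nonneg_orthant. R < norm u \<longrightarrow> norm (f (S u)) < e"
    proof (intro exI ballI impI)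
      fix u :: "real ^ 'n" assume u: "u \<in> nonneg_orthant" and "real CARD('n) * R ^ 2 < norm u"
      then have "real CARD('n) * R ^ 2 < real CARD('n) * norm (S u) ^ 2"
        using norm_le_sqrt_vec[OF u] unfolding S_def by linarith
      then have "R < norm (S u)"
        by (auto dest: power_less_imp_less_base)
      then show "norm (f (S u)) < e" using R[OF S[OF u]] by simp
    qed
  qed
  from exp_char_approximation[OF this e] obtain N c where
    N: "\<And>u. u \<in> nonneg_orthant \<Longrightarrow> norm (f (S u) - (\<Sum>m\<in>exponents N. exp_char m u *\<^sub>R c m)) \<le> e"
    by blast
  show thesis
  proof (rule that[of c N])
    fix u :: "real ^ 'n" assume u: "u \<in> nonneg_orthant"
    define v :: "real ^ 'n" where "v = (\<chi> j. (u $ j)\<^sup>2 / 2)"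
    have "v \<in> nonneg_orthant" by (simp add: v_def nonneg_orthant_def)
    moreover have "S v = u"
      using u by (simp add: S_def v_def vec_eq_iff nonneg_orthant_def)
    moreover have "exp_char m v = gauss (nat_vec m) u" for m
      by (simp add: exp_char_def gauss_def v_def)
    ultimately show "norm (f u - (\<Sum>m\<in>exponents N. gauss (nat_vec m) u *\<^sub>R c m)) \<le> e"
      using N[of v] by simp
  qed
qed

lemma orthant_bcont_exp_char: "orthant_bcont (exp_char m)"
proof (rule orthant_bcontI[where B=1])
  show "continuous_on nonneg_orthant (exp_char m)"
    unfolding exp_char_def by (intro continuous_intros)
  show "norm (exp_char m u) \<le> 1" if "u \<in> nonneg_orthant" for u
    using that by (simp add: exp_char_def sum_nonneg nonneg_orthant_def)
qed

lemma orthant_bcont_gauss: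
  assumes "\<And>j. 0 \<le> s $ j"
  shows "orthant_bcont (gauss s)"
proof (rule orthant_bcontI[where B=1])
  show "continuous_on nonneg_orthant (gauss s)"
    unfolding gauss_def by (intro continuous_intros) auto
  show "norm (gauss s u) \<le> 1" if "u \<in> nonneg_orthant" for u
    using assms by (simp add: gauss_def sum_nonneg)
qed

abbreviation exp_sum :: "nat \<Rightarrow> (('n::finite \<Rightarrow> nat) \<Rightarrow> 'x) \<Rightarrow> real ^ 'n \<Rightarrow> 'x::real_vector" where
  "exp_sum N c u \<equiv> (\<Sum>m\<in>exponents N. exp_char m u *\<^sub>R c m)"

lemma orthant_bcont_exp_sum:
  fixes c :: "('n::finite \<Rightarrow> nat) \<Rightarrow> 'x::real_normed_vector"
  shows "orthant_bcont (exp_sum N c)"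
  by (intro orthant_bcont_sum orthant_bcont_scaleR orthant_bcont_exp_char orthant_bcont_const)

section \<open>Damping of bounded functions\<close>

definition damp :: "real \<Rightarrow> real ^ 'n::finite \<Rightarrow> real" where
  "damp \<epsilon> u = exp (- (\<epsilon> * (\<Sum>j\<in>UNIV. u $ j)))"

lemma damp_bounds: "0 \<le> \<epsilon> \<Longrightarrow> u \<in> nonneg_orthant \<Longrightarrow> 0 < damp \<epsilon> u \<and> damp \<epsilon> u \<le> 1"
  by (simp add: damp_def sum_nonneg nonneg_orthant_def)

lemma orthant_C0_damp:
  fixes f :: "real ^ 'n::finite \<Rightarrow> 'x::real_normed_vector"
  assumes f: "orthant_bcont f" and \<epsilon>: "\<epsilon> > 0"
  shows "orthant_C0 (\<lambda>u. damp \<epsilon> u *\<^sub>R f u)"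
  unfolding orthant_C0_def
proof (intro conjI allI impI)
  show "continuous_on nonneg_orthant (\<lambda>u. damp \<epsilon> u *\<^sub>R f u)"
    using f unfolding damp_def orthant_bcont_def by (intro continuous_intros) auto
  obtain B where B: "B > 0" "\<And>u. u \<in> nonneg_orthant \<Longrightarrow> norm (f u) \<le> B"
    using orthant_bcontE[OF f] by blast
  fix e :: real assume e: "e > 0"
  show "\<exists>R. \<forall>u\<in>nonneg_orthant. R < norm u \<longrightarrow> norm (damp \<epsilon> u *\<^sub>R f u) < e"
  \<comment> \<open>The radius solves \<open>B * exp (- \<epsilon> * R) = e\<close>; on the orthant
    the coordinate sum in the damping dominates the norm.\<close>
  proof (intro exI[of _ "ln (B / e) / \<epsilon>"] ballI impI)
    fix u :: "real ^ 'n" assume u: "u \<in> nonneg_orthant" and "ln (B / e) / \<epsilon> < norm u"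
    moreover have "norm u \<le> (\<Sum>j\<in>UNIV. u $ j)"
      using norm_le_l1_cart[of u] u by (simp add: nonneg_orthant_def)
    ultimately have "ln (B / e) < \<epsilon> * (\<Sum>j\<in>UNIV. u $ j)"
      using \<epsilon> by (simp add: pos_divide_less_eq mult.commute) (meson less_le_trans mult_left_mono less_imp_le)
    then have "B / e < exp (\<epsilon> * (\<Sum>j\<in>UNIV. u $ j))"
      using B e by (metis divide_pos_pos exp_less_cancel_iff exp_ln)
    then have "damp \<epsilon> u * B < e"
      using e by (simp add: damp_def exp_minus field_simps)
    moreover have "norm (damp \<epsilon> u *\<^sub>R f u) \<le> damp \<epsilon> u * B"
      using B(2)[OF u] damp_bounds[OF _ u, of \<epsilon>] \<epsilon> by (simp add: mult_left_mono)
    ultimately show "norm (damp \<epsilon> u *\<^sub>R f u) < e" by linarith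
  qed
qed

text \<open>A bounded function cannot be approximated uniformly. Damping by a factor that tends to 1
  pointwise, with the approximation error tending to 0 alongside, leaves pointwise convergence under
  a common bound, which is what dominated convergence asks for.\<close>

lemma exp_sum_pointwise_approximation:
  fixes f :: "real ^ 'n::finite \<Rightarrow> 'x::real_normed_vector"
  assumes f: "orthant_bcont f"
  shows "\<exists>N c B. \<forall>u\<in>nonneg_orthant. (\<lambda>k. exp_sum (N k) (c k) u) \<longlonglongrightarrow> f u \<and>
    (\<forall>k. norm (exp_sum (N k) (c k) u) \<le> B)"
proof -
  obtain B where B: "\<And>u. u \<in> nonneg_orthant \<Longrightarrow> norm (f u) \<le> B"
    using orthant_bcontE[OF f] by blast
  let ?\<epsilon> = "\<lambda>k. 1 / real (Suc k)"
  have "\<exists>N c. \<forall>u\<in>nonneg_orthant. norm (damp (?\<epsilon> k) u *\<^sub>R f u - exp_sum N c u) \<le> ?\<epsilon> k" for k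
  proof -
    have "?\<epsilon> k > 0" by simp
    then show ?thesis
      by (rule exp_char_approximation[OF orthant_C0_damp[OF f] \<open>?\<epsilon> k > 0\<close>]) blast
  qed
  then obtain N c where N: "\<And>k u. u \<in> nonneg_orthant \<Longrightarrow> norm (damp (?\<epsilon> k) u *\<^sub>R f u - exp_sum (N k) (c k) u) \<le> ?\<epsilon> k"
    by metis
  show ?thesis
  proof (intro exI ballI conjI allI)
    fix u :: "real ^ 'n" assume u: "u \<in> nonneg_orthant"
    have \<epsilon>0: "?\<epsilon> \<longlonglongrightarrow> 0"
      using LIMSEQ_inverse_real_of_nat by (simp add: inverse_eq_divide)
    have "(\<lambda>k. damp (?\<epsilon> k) u *\<^sub>R f u) \<longlonglongrightarrow> exp (- (0 * (\<Sum>j\<in>UNIV. u $ j))) *\<^sub>R f u"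
      unfolding damp_def by (intro tendsto_intros \<epsilon>0)
    moreover have "(\<lambda>k. damp (?\<epsilon> k) u *\<^sub>R f u - exp_sum (N k) (c k) u) \<longlonglongrightarrow> 0"
      by (rule Lim_null_comparison[OF _ \<epsilon>0]) (use N[OF u] in auto)
    ultimately show "(\<lambda>k. exp_sum (N k) (c k) u) \<longlonglongrightarrow> f u"
      using tendsto_diff by fastforce
    fix k
    have "norm (damp (?\<epsilon> k) u *\<^sub>R f u) \<le> 1 * B"
      unfolding norm_scaleR using damp_bounds[OF _ u, of "?\<epsilon> k"] B[OF u]
      by (intro mult_mono) auto
    moreover have "?\<epsilon> k \<le> 1" by simp
    ultimately show "norm (exp_sum (N k) (c k) u) \<le> B + 1"
      using N[OF u, of k] norm_triangle_sub[of "exp_sum (N k) (c k) u" "damp (?\<epsilon> k) u *\<^sub>R f u"]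
        norm_minus_commute[of "exp_sum (N k) (c k) u" "damp (?\<epsilon> k) u *\<^sub>R f u"]
      by linarith
  qed
qed

section \<open>Uniqueness of measures on the orthant\<close>

lemma (in orthant_measure) orthant_integral_exp_sum:
  fixes c :: "('n \<Rightarrow> nat) \<Rightarrow> 'x::banach"
  shows "orthant_integral M (exp_sum N c) = (\<Sum>m\<in>exponents N. orthant_integral M (exp_char m) *\<^sub>R c m)"
  by (subst orthant_integral_sum)
    (auto intro!: orthant_bcont_scaleR orthant_bcont_exp_char orthant_bcont_const
      simp: orthant_integral_scaleR[OF orthant_bcont_exp_char])

text \<open>Dominated convergence carries the equality from exponential sums to \<open>f\<close>.
  Positive integer exponents suffice because the exponentials are the monomials of the compactified
  orthant.\<close>

lemma orthant_integral_eqI: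
  fixes f :: "real ^ 'n::finite \<Rightarrow> 'x::banach"
  assumes M: "orthant_measure M" and N: "orthant_measure N"
    and eq: "\<And>m. (\<And>j. 1 \<le> m j) \<Longrightarrow> orthant_integral M (exp_char m) = orthant_integral N (exp_char m)"
    and f: "orthant_bcont f"
  shows "orthant_integral M f = orthant_integral N f"
proof -
  interpret M: orthant_measure M by fact
  interpret N: orthant_measure N by fact
  obtain K c B where Kc: "\<forall>u\<in>nonneg_orthant. (\<lambda>k. exp_sum (K k) (c k) u) \<longlonglongrightarrow> f u \<and>
      (\<forall>k. norm (exp_sum (K k) (c k) u) \<le> B)"
    using exp_sum_pointwise_approximation[OF f] by (elim exE) (rule that)
  then have K: "\<And>u. u \<in> nonneg_orthant \<Longrightarrow> (\<lambda>k. exp_sum (K k) (c k) u) \<longlonglongrightarrow> f u"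
    "\<And>k u. u \<in> nonneg_orthant \<Longrightarrow> norm (exp_sum (K k) (c k) u) \<le> B"
    by auto
  have "orthant_integral M (exp_sum (K k) (c k)) = orthant_integral N (exp_sum (K k) (c k))" for k
    unfolding M.orthant_integral_exp_sum N.orthant_integral_exp_sum
    by (intro sum.cong refl arg_cong2[where f=scaleR] eq) (auto simp: PiE_iff)
  moreover have "(\<lambda>k. orthant_integral M (exp_sum (K k) (c k))) \<longlonglongrightarrow> orthant_integral M f"
    by (rule M.orthant_integral_tendsto[OF orthant_bcont_exp_sum f K])
  moreover have "(\<lambda>k. orthant_integral N (exp_sum (K k) (c k))) \<longlonglongrightarrow> orthant_integral N f"
    by (rule N.orthant_integral_tendsto[OF orthant_bcont_exp_sum f K])
  ultimately show ?thesis by (simp add: LIMSEQ_unique)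
qed

text \<open>The tents \<open>max 0 (1 - k * infdist u C)\<close> decrease to the indicator of a
  closed set \<open>C\<close>, and closed sets form an intersection-stable generator of the Borel
  sets.\<close>

theorem orthant_measure_eqI:
  fixes M N :: "(real ^ 'n::finite) measure"
  assumes M: "orthant_measure M" and N: "orthant_measure N"
    and eq: "\<And>m. (\<And>j. 1 \<le> m j) \<Longrightarrow> orthant_integral M (exp_char m) = orthant_integral N (exp_char m)"
  shows "M = N"
proof (rule measure_eqI_generator_eq[where E="Collect closed" and \<Omega>=UNIV and A="\<lambda>_. UNIV"])
  interpret M: orthant_measure M by fact
  interpret N: orthant_measure N by fact
  show "Int_stable (Collect (closed :: (real^'n) set \<Rightarrow> bool))"
    by (auto simp: Int_stable_def)
  have "sets (borel :: (real^'n) measure) = sigma_sets UNIV (Collect closed)"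
    unfolding borel_eq_closed by simp
  then show "sets M = sigma_sets UNIV (Collect closed)" "sets N = sigma_sets UNIV (Collect closed)"
    by (simp_all add: M.sets_eq N.sets_eq)
  show "emeasure M UNIV \<noteq> \<infinity>" using M.emeasure_finite by simp
  fix C :: "(real ^ 'n) set" assume "C \<in> Collect closed"
  then have C: "closed C" by simp
  show "emeasure M C = emeasure N C"
  \<comment> \<open>The empty set is separated because \<open>infdist u {} = 0\<close> would make
    all tents equal to 1.\<close>
  proof (cases "C = {}")
    case False
    let ?g = "\<lambda>k u. max 0 (1 - real k * infdist u C)"
    have bc: "orthant_bcont (?g k)" for k
      by (rule orthant_bcontI[where B=1]) (auto intro!: continuous_intros simp: infdist_nonneg)
    have cm: "?g k \<in> borel_measurable borel" for k
      by (intro borel_measurable_continuous_onI continuous_intros)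
    have lim: "(\<lambda>k. orthant_integral L (?g k)) \<longlonglongrightarrow> measure L C" if "orthant_measure L" for L
    proof -
      interpret L: orthant_measure L by fact
      have C': "C \<in> sets L" using C L.sets_eq by simp
      have "(\<lambda>k. LINT u|L. ?g k u) \<longlonglongrightarrow> (LINT u|L. indicator C u)"
      proof (rule integral_dominated_convergence[where w="\<lambda>_. 1"])
        show "AE u in L. (\<lambda>k. ?g k u) \<longlonglongrightarrow> indicator C u"
        proof (intro AE_I2)
          fix u
          show "(\<lambda>k. ?g k u) \<longlonglongrightarrow> indicator C u"
          proof (cases "u \<in> C")
            case True
            then show ?thesis using in_closed_iff_infdist_zero[OF C False, of u] by simp
          next
            case nin: False
            then have pos: "infdist u C > 0" by (rule infdist_pos_not_in_closed[OF C False])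
            then obtain K :: nat where K: "1 / infdist u C < real K" using reals_Archimedean2 by blast
            have "?g k u = 0" if "k \<ge> K" for k
            proof -
              have "1 < real K * infdist u C" using K pos by (simp add: field_simps)
              also have "\<dots> \<le> real k * infdist u C" using that pos by (intro mult_right_mono) auto
              finally show ?thesis by simp
            qed
            then have "\<forall>\<^sub>F k in sequentially. ?g k u = 0" by (auto simp: eventually_sequentially)
            with nin show ?thesis by (simp add: tendsto_eventually)
          qed
        qed
        show "?g k \<in> borel_measurable L" for k
          using cm by (simp add: measurable_cong_sets[OF L.sets_eq refl])
        show "(\<lambda>u. indicator C u :: real) \<in> borel_measurable L" using C' by simp
      qed (auto simp: infdist_nonneg)
      then show ?thesis
        using C' by (simp add: L.integral_orthant(1)[OF bc cm])
    qed
    have "measure M C = measure N C"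
      using lim[OF M] lim[OF N] orthant_integral_eqI[OF M N eq bc]
      by (simp add: LIMSEQ_unique)
    then show ?thesis
      by (simp add: M.emeasure_eq_measure N.emeasure_eq_measure)
  qed simp
qed auto

section \<open>The subordinator of a Bernstein function\<close>

definition left_half :: "(complex ^ 'n::finite) set" where
  "left_half = {z. \<forall>j. Re (z $ j) \<le> 0}"

lemma cdot_add: "cdot z (u + v) = cdot z u + cdot z v"
  by (simp add: cdot_def distrib_left sum.distrib)

lemma cdot_zero [simp]: "cdot z 0 = 0"
  by (simp add: cdot_def)

lemma cdot_sum: "cdot z (\<Sum>i\<in>I. f i) = (\<Sum>i\<in>I. cdot z (f i))"
  by (induction I rule: infinite_finite_induct) (auto simp: cdot_add)

lemma cdot_scaleR: "cdot z (r *\<^sub>R v) = of_real r * cdot z v"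
  by (simp add: cdot_def sum_distrib_left mult_ac)

lemma continuous_on_cdot: "continuous_on S (cdot z)"
  unfolding cdot_def[abs_def] by (intro continuous_intros)

lemma borel_measurable_cdot [measurable]: "cdot z \<in> borel_measurable borel"
  by (intro borel_measurable_continuous_onI continuous_on_cdot)

lemma Re_cdot_le: "z \<in> left_half \<Longrightarrow> v \<in> nonneg_orthant \<Longrightarrow> Re (cdot z v) \<le> 0"
  by (simp add: cdot_def left_half_def nonneg_orthant_def sum_nonpos mult_nonpos_nonneg)

lemma norm_exp_cdot_le: "z \<in> left_half \<Longrightarrow> v \<in> nonneg_orthant \<Longrightarrow> norm (exp (cdot z v)) \<le> 1"
  by (simp add: Re_cdot_le)

lemma orthant_bcont_exp_cdot: "z \<in> left_half \<Longrightarrow> orthant_bcont (\<lambda>v. exp (cdot z v))"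
  by (rule orthant_bcontI[where B=1]) (auto intro!: continuous_intros continuous_on_cdot Re_cdot_le)

text \<open>Mean value inequality on the half plane, which is convex and on which the derivative of
  \<open>exp\<close> has modulus at most 1.\<close>

lemma norm_exp_minus_1_le:
  fixes w :: complex
  assumes "Re w \<le> 0"
  shows "norm (exp w - 1) \<le> norm w"
proof -
  have "norm (exp w - exp 0) \<le> 1 * norm (w - 0)"
  proof (rule field_differentiable_bound[where S="{z. Re z \<le> 0}" and f'=exp])
    show "convex {z. Re z \<le> 0}" by (rule convex_halfspace_Re_le)
    show "(exp has_field_derivative exp z) (at z within {z. Re z \<le> 0})" for z :: complex
      by (auto intro!: derivative_eq_intros)
  qed (use assms in auto)
  then show ?thesis by simp
qed

lemma exp_minus_le_inverse: "0 \<le> a \<Longrightarrow> a / (1 + a) \<le> 1 - exp (- a)" for a :: real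
  using exp_ge_add_one_self[of a] by (simp add: exp_minus field_simps)

text \<open>Compares the customary weight \<open>min 1 a\<close> of Levy measures with
  \<open>1 - exp (- a)\<close>, whose integrals are explicit because they are values of Laplace
  transforms.\<close>

lemma min_one_le: "0 \<le> a \<Longrightarrow> min 1 a \<le> 2 * (1 - exp (- a))" for a :: real
proof -
  assume a: "0 \<le> a"
  have "min 1 a \<le> 2 * (a / (1 + a))"
  proof (cases "a \<le> 1")
    case True
    then have "a * a \<le> a * 1" using a by (intro mult_left_mono) auto
    then show ?thesis using a True by (simp add: field_simps)
  next
    case False
    then show ?thesis by (simp add: field_simps)
  qed
  also have "\<dots> \<le> 2 * (1 - exp (- a))"
    using exp_minus_le_inverse[OF a] by simp
  finally show ?thesis .
qed

definition coord_sum :: "real ^ 'n::finite \<Rightarrow> real" where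
  "coord_sum u = (\<Sum>j\<in>UNIV. u $ j)"

lemma coord_sum_nonneg: "u \<in> nonneg_orthant \<Longrightarrow> 0 \<le> coord_sum u"
  by (simp add: coord_sum_def nonneg_orthant_def sum_nonneg)

lemma norm_le_coord_sum: "u \<in> nonneg_orthant \<Longrightarrow> norm u \<le> coord_sum u"
  using norm_le_l1_cart[of u] by (simp add: coord_sum_def nonneg_orthant_def)

lemma borel_measurable_coord_sum [measurable]: "coord_sum \<in> borel_measurable borel"
  unfolding coord_sum_def[abs_def] by (intro borel_measurable_continuous_onI continuous_intros)

text \<open>Near 0 the exponent bounds the left side, far away the constant 2 does; the sum of the
  two constants covers both cases, and the outer factor 2 comes from
  \<open>min_one_le\<close>.\<close>

lemma norm_exp_cdot_minus_1_le:
  assumes z: "z \<in> left_half" and v: "v \<in> nonneg_orthant"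
  shows "norm (exp (cdot z v) - 1) \<le> 2 * (2 + (\<Sum>j\<in>UNIV. norm (z $ j))) * (1 - exp (- coord_sum v))"
proof -
  let ?Z = "\<Sum>j\<in>UNIV. norm (z $ j)"
  have Z: "0 \<le> ?Z" by (simp add: sum_nonneg)
  have "norm (cdot z v) \<le> (\<Sum>j\<in>UNIV. norm (z $ j) * v $ j)"
    unfolding cdot_def using v by (intro sum_norm_le) (auto simp: norm_mult nonneg_orthant_def)
  also have "\<dots> \<le> (\<Sum>j\<in>UNIV. norm (z $ j) * coord_sum v)"
  proof (intro sum_mono mult_left_mono)
    fix j
    have "v $ j \<le> norm v" using component_le_norm_cart[of v j] by simp
    then show "v $ j \<le> coord_sum v" using norm_le_coord_sum[OF v] by simp
  qed simp
  finally have "norm (cdot z v) \<le> ?Z * coord_sum v" by (simp add: sum_distrib_right)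
  then have "norm (exp (cdot z v) - 1) \<le> ?Z * coord_sum v"
    using norm_exp_minus_1_le[OF Re_cdot_le[OF z v]] by simp
  moreover have "norm (exp (cdot z v) - 1) \<le> 1 + 1"
    using norm_triangle_ineq4[of "exp (cdot z v)" 1] norm_exp_cdot_le[OF z v] unfolding norm_one by linarith
  ultimately have "norm (exp (cdot z v) - 1) \<le> (2 + ?Z) * min 1 (coord_sum v)"
    using Z coord_sum_nonneg[OF v] by (auto simp: min_def distrib_right)
  also have "\<dots> \<le> (2 + ?Z) * (2 * (1 - exp (- coord_sum v)))"
    using Z by (intro mult_left_mono min_one_le coord_sum_nonneg v) auto
  finally show ?thesis by (simp only: mult.assoc mult.left_commute)
qed

section \<open>Independent sums and compound Poisson laws\<close>

lemma PiM_nat_integral_prod: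
  fixes h :: "nat \<Rightarrow> 'a \<Rightarrow> complex"
  assumes M: "\<And>i. prob_space (M i)" and h: "\<And>i. integrable (M i) (h i)"
  shows "(\<integral>\<omega>. (\<Prod>i<k. h i (\<omega> i)) \<partial>PiM UNIV M) = (\<Prod>i<k. \<integral>u. h i u \<partial>M i)"
proof -
  interpret product_prob_space M UNIV
    by (intro product_prob_space.intro product_sigma_finite.intro prob_space_imp_sigma_finite
      product_prob_space_axioms.intro M)
  have "(\<Prod>i<k. \<integral>u. h i u \<partial>M i) = (\<integral>\<omega>. (\<Prod>i<k. h i (\<omega> i)) \<partial>PiM {..<k} M)"
    by (subst product_integral_prod) (auto simp: h)
  also have "\<dots> = (\<integral>\<omega>. (\<Prod>i<k. h i (\<omega> i)) \<partial>distr (PiM UNIV M) (PiM {..<k} M) (\<lambda>x. restrict x {..<k}))"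
    by (subst distr_PiM_restrict_finite) auto
  also have "\<dots> = (\<integral>\<omega>. (\<Prod>i<k. h i (restrict \<omega> {..<k} i)) \<partial>PiM UNIV M)"
  proof (rule integral_distr)
    have [measurable]: "h i \<in> borel_measurable (M i)" for i using h by auto
    show "(\<lambda>\<omega>. \<Prod>i<k. h i (\<omega> i)) \<in> borel_measurable (PiM {..<k} M)"
      by (intro borel_measurable_prod) measurable
  qed (auto intro!: measurable_restrict_subset)
  also have "\<dots> = (\<integral>\<omega>. (\<Prod>i<k. h i (\<omega> i)) \<partial>PiM UNIV M)"
    by (intro Bochner_Integration.integral_cong refl prod.cong) auto
  finally show ?thesis by simp
qed

text \<open>The generating function of the Poisson law, at complex points of the closed unit
  disc.\<close>

lemma integral_poisson_power:
  fixes L :: complex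
  assumes c: "c > 0" and L: "norm L \<le> 1"
  shows "(\<integral>k. L ^ k \<partial>measure_pmf (poisson_pmf c)) = exp (of_real c * (L - 1))"
proof -
  have "integrable (measure_pmf (poisson_pmf c)) (\<lambda>k. L ^ k)"
    by (rule measure_pmf.integrable_const_bound[where B=1]) (auto simp: norm_power power_le_one L)
  then have int: "integrable (count_space UNIV) (\<lambda>k. pmf (poisson_pmf c) k *\<^sub>R L ^ k)"
    unfolding measure_pmf_eq_density by (subst (asm) integrable_density) auto
  have "(\<integral>k. L ^ k \<partial>measure_pmf (poisson_pmf c)) = (\<integral>k. pmf (poisson_pmf c) k *\<^sub>R L ^ k \<partial>count_space UNIV)"
    unfolding measure_pmf_eq_density by (subst integral_density) auto
  then have "(\<lambda>k. pmf (poisson_pmf c) k *\<^sub>R L ^ k) sums (\<integral>k. L ^ k \<partial>measure_pmf (poisson_pmf c))"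
    using sums_integral_count_space_nat[OF int] by simp
  moreover have "(\<lambda>k. exp (- of_real c) * ((of_real c * L) ^ k /\<^sub>R fact k)) sums (exp (- of_real c) * exp (of_real c * L))"
    by (intro sums_mult exp_converges)
  then have "(\<lambda>k. pmf (poisson_pmf c) k *\<^sub>R L ^ k) sums exp (of_real c * (L - 1))"
    using c by (simp add: scaleR_conv_of_real power_mult_distrib mult_ac right_diff_distrib exp_diff exp_minus
      exp_of_real divide_inverse)
  ultimately show ?thesis by (rule sums_unique2)
qed

lemma orthant_measure_distr:
  assumes "prob_space M" "X \<in> borel_measurable M" "AE \<omega> in M. X \<omega> \<in> nonneg_orthant"
  shows "orthant_measure (distr M borel X)" "prob_space (distr M borel X)"
proof -
  show "prob_space (distr M borel X)"
    by (intro prob_space.prob_space_distr assms)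
  then show "orthant_measure (distr M borel X)"
    using assms by (simp add: orthant_measure_def orthant_measure_axioms_def prob_space_def AE_distr_iff)
qed

text \<open>The law of a sum of independent variables distributed as \<open>\<mu>\<close> divided by
  its mass \<open>c\<close>, their number being Poisson with mean \<open>c\<close>. Independence
  turns the transform into a power of the single transform \<open>L\<close>, and averaging over the
  number of terms gives \<open>exp (c * (L - 1))\<close>.\<close>

theorem compound_poisson_exists:
  fixes \<mu> :: "(real ^ 'n::finite) measure"
  assumes "orthant_measure \<mu>"
  shows "\<exists>\<rho>. prob_space \<rho> \<and> orthant_measure \<rho> \<and>
    (\<forall>z\<in>left_half. (LINT u|\<rho>. exp (cdot z u)) = exp (LINT v|\<mu>. exp (cdot z v) - 1))"
proof -
  interpret \<mu>: orthant_measure \<mu> by fact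
  define c where "c = measure \<mu> UNIV"
  show ?thesis
  proof (cases "c = 0")
    \<comment> \<open>Zero mass cannot be normalised; the sum has no terms and its law is the point
      mass at 0.\<close>
    case True
    then have "emeasure \<mu> (space \<mu>) = 0"
      by (simp add: c_def \<mu>.emeasure_eq_measure)
    then have "AE v in \<mu>. exp (cdot z v) - 1 = 0" for z
      by (intro AE_I[of _ _ "space \<mu>"]) auto
    then have "(LINT v|\<mu>. exp (cdot z v) - 1) = 0" for z
      by (rule integral_eq_zero_AE)
    moreover have "prob_space (return borel (0::real^'n))"
      by (intro prob_space_return) simp
    moreover from this have "orthant_measure (return borel (0::real^'n))"
      by (simp add: orthant_measure_def orthant_measure_axioms_def prob_space_def AE_return nonneg_orthant_def[symmetric])
        (simp add: nonneg_orthant_def)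
    moreover have "(LINT u|return borel (0::real^'n). exp (cdot z u)) = 1" for z
      by (subst integral_return) auto
    ultimately show ?thesis by (intro exI[of _ "return borel 0"]) auto
  next
    case False
    then have c: "c > 0" by (simp add: c_def zero_less_measure_iff)
    define N where "N = density \<mu> (\<lambda>_. ennreal (1 / c))"
    have sets_N [measurable_cong]: "sets N = sets borel" by (simp add: N_def \<mu>.sets_eq)
    have "emeasure N (space N) = 1"
      using c by (simp add: N_def emeasure_density_const \<mu>.emeasure_eq_measure ennreal_mult[symmetric] c_def[symmetric])
    then have prob_N: "prob_space N" by (rule prob_spaceI)
    interpret P: pair_prob_space "measure_pmf (poisson_pmf c)" "PiM UNIV (\<lambda>_::nat. N)"
      by (intro pair_prob_space.intro pair_sigma_finite.intro prob_space_imp_sigma_finite prob_space_PiM prob_N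
        prob_space_measure_pmf)
    \<comment> \<open>\<open>pos_vec\<close> is the identity almost everywhere for \<open>N\<close>;
      with it the sum lies in the orthant everywhere, without exceptional sets.\<close>
    define S where "S x = (\<Sum>i<fst x. pos_vec (snd x i))" for x :: "nat \<times> (nat \<Rightarrow> real ^ 'n)"
    have [measurable]: "(pos_vec :: real^'n \<Rightarrow> _) \<in> borel_measurable borel"
      by (intro borel_measurable_continuous_onI continuous_on_pos_vec)
    have S_meas [measurable]: "S \<in> borel_measurable (measure_pmf (poisson_pmf c) \<Otimes>\<^sub>M PiM UNIV (\<lambda>_. N))"
      unfolding S_def[abs_def]
      by (rule measurable_compose_countable[where f="\<lambda>k x. \<Sum>i<k. pos_vec (snd x i)" and g=fst]) measurable
    have S_orthant: "S x \<in> nonneg_orthant" for x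
      unfolding S_def nonneg_orthant_def by (auto simp: pos_vec_def intro!: sum_nonneg)
    let ?\<rho> = "distr (measure_pmf (poisson_pmf c) \<Otimes>\<^sub>M PiM UNIV (\<lambda>_. N)) borel S"
    have "(LINT u|?\<rho>. exp (cdot z u)) = exp (LINT v|\<mu>. exp (cdot z v) - 1)" if z: "z \<in> left_half" for z
    proof -
      let ?h = "\<lambda>u. exp (cdot z (pos_vec u))"
      have h: "integrable N ?h"
        by (rule finite_measure.integrable_const_bound[where B=1])
          (auto simp: norm_exp_cdot_le[OF z pos_vec_in] prob_N prob_space.finite_measure simp del: norm_exp_eq_Re)
      have hN: "(LINT u|N. ?h u) = (LINT v|\<mu>. exp (cdot z v)) / of_real c"
      proof -
        have "(LINT u|N. ?h u) = (LINT u|\<mu>. (1 / c) *\<^sub>R ?h u)"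
          unfolding N_def using c \<mu>.sets_eq by (subst integral_density) (auto simp: measurable_cong_sets[OF \<mu>.sets_eq refl])
        also have "\<dots> = (LINT u|\<mu>. (1 / c) *\<^sub>R exp (cdot z u))"
          using \<mu>.AE_orthant by (intro integral_cong_AE)
            (auto simp: measurable_cong_sets[OF \<mu>.sets_eq refl] pos_vec_id elim!: eventually_mono)
        finally show ?thesis by (simp add: scaleR_conv_of_real)
      qed
      have L1: "norm (LINT u|N. ?h u) \<le> 1"
      proof -
        have "norm (LINT u|N. ?h u) \<le> (LINT u|N. norm (?h u))" by (rule integral_norm_bound)
        also have "\<dots> \<le> (LINT u|N. 1)"
          by (intro integral_mono integrable_norm h finite_measure.integrable_const prob_space.finite_measure prob_N)
            (rule norm_exp_cdot_le[OF z pos_vec_in])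
        also have "\<dots> = 1" using prob_space.prob_space[OF prob_N] by simp
        finally show ?thesis .
      qed
      have "(LINT u|?\<rho>. exp (cdot z u)) = (LINT x|(measure_pmf (poisson_pmf c) \<Otimes>\<^sub>M PiM UNIV (\<lambda>_. N)). exp (cdot z (S x)))"
        by (subst integral_distr) auto
      also have "\<dots> = (LINT k|measure_pmf (poisson_pmf c). LINT \<omega>|PiM UNIV (\<lambda>_. N). exp (cdot z (S (k, \<omega>))))"
      proof (rule P.integral_fst'[symmetric])
        show "integrable (measure_pmf (poisson_pmf c) \<Otimes>\<^sub>M PiM UNIV (\<lambda>_. N)) (\<lambda>x. exp (cdot z (S x)))"
          by (rule P.integrable_const_bound[where B=1])
            (auto simp: norm_exp_cdot_le[OF z S_orthant] simp del: norm_exp_eq_Re)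
      qed
      also have "\<dots> = (LINT k|measure_pmf (poisson_pmf c). (LINT u|N. ?h u) ^ k)"
      proof (intro Bochner_Integration.integral_cong refl)
        fix k
        have "(LINT \<omega>|PiM UNIV (\<lambda>_. N). exp (cdot z (S (k, \<omega>)))) = (LINT \<omega>|PiM UNIV (\<lambda>_. N). (\<Prod>i<k. ?h (\<omega> i)))"
          by (simp add: S_def cdot_sum exp_sum)
        also have "\<dots> = (\<Prod>i<k. LINT u|N. ?h u)"
          by (rule PiM_nat_integral_prod[OF prob_N h])
        finally show "(LINT \<omega>|PiM UNIV (\<lambda>_. N). exp (cdot z (S (k, \<omega>)))) = (LINT u|N. ?h u) ^ k" by simp
      qed
      also have "\<dots> = exp (of_real c * ((LINT u|N. ?h u) - 1))"
        by (rule integral_poisson_power[OF c L1])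
      also have "of_real c * ((LINT u|N. ?h u) - 1) = (LINT v|\<mu>. exp (cdot z v)) - of_real c"
        using c unfolding hN by (simp add: right_diff_distrib)
      also have "\<dots> = (LINT v|\<mu>. exp (cdot z v) - 1)"
        using \<mu>.integral_orthant(2)[OF orthant_bcont_exp_cdot[OF z]]
        by (subst Bochner_Integration.integral_diff) (auto simp: c_def scaleR_conv_of_real)
      finally show ?thesis .
    qed
    then show ?thesis
      using orthant_measure_distr[OF P.prob_space_axioms S_meas] S_orthant by blast
  qed
qed

lemma orthant_bcont_exp_coord_sum: "orthant_bcont (\<lambda>u. exp (- coord_sum u))"
  by (rule orthant_bcontI[where B=1]) (auto simp: coord_sum_nonneg coord_sum_def[abs_def] sum_nonneg nonneg_orthant_def intro!: continuous_intros)

text \<open>The expectations of \<open>1 - exp (- coord_sum (\<omega> i))\<close> have a finite sum,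
  so this nonnegative series converges almost surely, and its small terms control the norms of the
  summands.\<close>

lemma AE_PiM_summable:
  fixes \<rho> :: "nat \<Rightarrow> (real ^ 'n::finite) measure"
  assumes prob: "\<And>i. prob_space (\<rho> i)" and orth: "\<And>i. orthant_measure (\<rho> i)"
    and bound: "\<And>k. (\<Sum>i<k. 1 - (LINT u|\<rho> i. exp (- coord_sum u))) \<le> C"
  shows "AE \<omega> in PiM UNIV \<rho>. summable \<omega>"
proof -
  interpret product_prob_space \<rho> UNIV
    by (intro product_prob_space.intro product_sigma_finite.intro prob_space_imp_sigma_finite
      product_prob_space_axioms.intro prob)
  have sets_\<rho> [measurable_cong]: "sets (\<rho> i) = sets borel" for i
    by (rule orthant_measure.sets_eq[OF orth])
  define w where "w u = 1 - exp (- coord_sum u)" for u :: "real ^ 'n"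
  have [measurable]: "w \<in> borel_measurable borel"
    unfolding w_def[abs_def] by measurable
  have AE_comp: "AE \<omega> in PiM UNIV \<rho>. P (\<omega> i)" if "AE u in \<rho> i. P u" for i P
    by (rule AE_PiM_component[where M=\<rho> and I=UNIV and i=i and P=P, OF prob UNIV_I that])
  have AE_orth: "AE \<omega> in PiM UNIV \<rho>. \<forall>i. \<omega> i \<in> nonneg_orthant"
    unfolding AE_all_countable by (intro allI AE_comp orthant_measure.AE_orthant orth)
  have one: "(\<integral>\<^sup>+\<omega>. ennreal (w (\<omega> i)) \<partial>PiM UNIV \<rho>) = ennreal (1 - (LINT u|\<rho> i. exp (- coord_sum u)))" for i
  proof -
    interpret o: orthant_measure "\<rho> i" by (rule orth)
    have int: "integrable (\<rho> i) (\<lambda>u. exp (- coord_sum u))"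
      by (rule o.integral_orthant(2)[OF orthant_bcont_exp_coord_sum]) simp
    have "(\<integral>\<^sup>+\<omega>. ennreal (w (\<omega> i)) \<partial>PiM UNIV \<rho>) = (\<integral>\<^sup>+u. ennreal (w u) \<partial>distr (PiM UNIV \<rho>) (\<rho> i) (\<lambda>\<omega>. \<omega> i))"
      by (subst nn_integral_distr) auto
    also have "\<dots> = (\<integral>\<^sup>+u. ennreal (w u) \<partial>\<rho> i)" by (simp add: PiM_component)
    also have "\<dots> = ennreal (LINT u|\<rho> i. w u)"
    proof (rule nn_integral_eq_integral)
      show "integrable (\<rho> i) w" unfolding w_def[abs_def] using int by simp
      show "AE u in \<rho> i. 0 \<le> w u"
        using o.AE_orthant by eventually_elim (simp add: w_def coord_sum_nonneg)
    qed
    also have "(LINT u|\<rho> i. w u) = 1 - (LINT u|\<rho> i. exp (- coord_sum u))"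
      using int prob_space.prob_space[OF prob, of i] unfolding w_def by simp
    finally show ?thesis .
  qed
  have nonneg: "0 \<le> 1 - (LINT u|\<rho> i. exp (- coord_sum u))" for i
  proof -
    interpret o: orthant_measure "\<rho> i" by (rule orth)
    have "(LINT u|\<rho> i. exp (- coord_sum u)) \<le> (LINT u|\<rho> i. 1)"
      using o.AE_orthant
      by (intro integral_mono_AE o.integral_orthant(2)[OF orthant_bcont_exp_coord_sum])
        (auto simp: coord_sum_nonneg elim!: eventually_mono)
    then show ?thesis using prob_space.prob_space[OF prob, of i] by simp
  qed
  have "(\<integral>\<^sup>+\<omega>. (\<Sum>i. ennreal (w (\<omega> i))) \<partial>PiM UNIV \<rho>) = (\<Sum>i. ennreal (1 - (LINT u|\<rho> i. exp (- coord_sum u))))"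
    by (subst nn_integral_suminf) (auto simp: one)
  also have "\<dots> \<le> ennreal C"
    unfolding suminf_eq_SUP by (intro SUP_least, subst sum_ennreal) (use nonneg in simp, intro ennreal_leI bound)
  finally have "(\<integral>\<^sup>+\<omega>. (\<Sum>i. ennreal (w (\<omega> i))) \<partial>PiM UNIV \<rho>) \<noteq> \<infinity>"
    using ennreal_less_top[of C] by (auto simp: top_unique)
  then have "AE \<omega> in PiM UNIV \<rho>. (\<Sum>i. ennreal (w (\<omega> i))) \<noteq> \<infinity>"
    by (intro nn_integral_PInf_AE) auto
  with AE_orth show ?thesis
  proof eventually_elim
    case (elim \<omega>)
    have w0: "0 \<le> w (\<omega> i)" for i
      using elim(1) by (simp add: w_def coord_sum_nonneg)
    have sw: "summable (\<lambda>i. w (\<omega> i))"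
      by (rule summable_suminf_not_top) (use w0 elim(2) in auto)
    then have "(\<lambda>i. w (\<omega> i)) \<longlonglongrightarrow> 0" by (rule summable_LIMSEQ_zero)
    \<comment> \<open>Below 1/2 the minimum in \<open>min_one_le\<close> is the coordinate sum
      itself, which dominates the norm.\<close>
    then have "\<forall>\<^sub>F i in sequentially. w (\<omega> i) < 1 / 2" by (rule order_tendstoD) simp
    then have "\<forall>\<^sub>F i in sequentially. norm (\<omega> i) \<le> 2 * w (\<omega> i)"
    proof eventually_elim
      case (elim i)
      have o: "\<omega> i \<in> nonneg_orthant" using \<open>\<forall>i. \<omega> i \<in> nonneg_orthant\<close> by blast
      have "min 1 (coord_sum (\<omega> i)) \<le> 2 * w (\<omega> i)"
        unfolding w_def by (rule min_one_le[OF coord_sum_nonneg[OF o]])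
      with elim norm_le_coord_sum[OF o] show ?case by (auto simp: min_def split: if_splits)
    qed
    then show "summable \<omega>"
      by (rule summable_comparison_test_ev) (intro summable_mult sw)
  qed
qed

section \<open>The Levy measure and its subordinator\<close>

lemma inner_minus_one: "(- 1 :: real ^ 'n::finite) \<bullet> v = - coord_sum v"
  by (simp add: inner_vec_def coord_sum_def sum_negf)

text \<open>The representation at the single point \<open>- 1\<close> makes
  \<open>1 - exp (- coord_sum v)\<close> integrable, and up to a constant this function dominates
  \<open>exp (cdot z v) - 1\<close> for every \<open>z\<close> in the closed half space.\<close>

lemma representation_integrable:
  assumes r: "representation \<psi> c0 c1 \<mu>"
  shows "integrable \<mu> (\<lambda>v. 1 - exp (- coord_sum v))"
    and "z \<in> left_half \<Longrightarrow> integrable \<mu> (\<lambda>v. exp (cdot z v) - 1)"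
proof -
  have sets_\<mu> [measurable_cong]: "sets \<mu> = sets borel" using r by (simp add: representation_def)
  have "(- 1 :: real ^ 'a) \<in> neg_orthant" by (simp add: neg_orthant_def)
  then have "integrable \<mu> (\<lambda>v. exp ((- 1) \<bullet> v) - 1)"
    using r unfolding representation_def by blast
  then have "integrable \<mu> (\<lambda>v. - (exp ((- 1) \<bullet> v) - 1))"
    by (rule integrable_minus)
  then show *: "integrable \<mu> (\<lambda>v. 1 - exp (- coord_sum v))"
    by (simp only: inner_minus_one minus_diff_eq)
  assume z: "z \<in> left_half"
  show "integrable \<mu> (\<lambda>v. exp (cdot z v) - 1)"
  proof (rule Bochner_Integration.integrable_bound)
    show "integrable \<mu> (\<lambda>v. 2 * (2 + (\<Sum>j\<in>UNIV. norm (z $ j))) * (1 - exp (- coord_sum v)))"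
      by (intro integrable_mult_right *)
    show "(\<lambda>v. exp (cdot z v) - 1) \<in> borel_measurable \<mu>" by measurable
    have "AE v in \<mu>. v \<in> nonneg_orthant - {0}" using r by (simp add: representation_def)
    then show "AE v in \<mu>. norm (exp (cdot z v) - 1)
        \<le> norm (2 * (2 + (\<Sum>j\<in>UNIV. norm (z $ j))) * (1 - exp (- coord_sum v)))"
    proof eventually_elim
      case (elim v)
      have "norm (exp (cdot z v) - 1) \<le> 2 * (2 + (\<Sum>j\<in>UNIV. norm (z $ j))) * (1 - exp (- coord_sum v))"
        using elim by (intro norm_exp_cdot_minus_1_le z) auto
      then show ?case unfolding real_norm_def by linarith
    qed
  qed
qed

text \<open>The annuli \<open>annulus i\<close> partition the punctured orthant into sets of finite Levy measure.\<close>

definition annulus :: "nat \<Rightarrow> (real ^ 'n::finite) set" where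
  "annulus i = {v. v \<in> nonneg_orthant \<and> nat \<lfloor>1 / coord_sum v\<rfloor> = i}"

lemma annulus_borel [measurable]: "annulus i \<in> sets borel"
  unfolding annulus_def by measurable

lemma sum_indicator_annulus:
  "v \<in> nonneg_orthant \<Longrightarrow> (\<Sum>i<k. indicator (annulus i) v) = (if nat \<lfloor>1 / coord_sum v\<rfloor> < k then 1 else 0 :: real)"
  by (simp add: annulus_def indicator_def)

text \<open>On the annulus the coordinate sum exceeds \<open>1 / (real i + 1)\<close>, so the
  integrable function \<open>1 - exp (- coord_sum v)\<close> is bounded below there by
  \<open>?\<delta>\<close>.\<close>

lemma emeasure_annulus_finite:
  assumes r: "representation \<psi> c0 c1 \<mu>"
  shows "emeasure \<mu> (annulus i) < \<infinity>"
proof -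
  have sets_\<mu> [measurable_cong]: "sets \<mu> = sets borel" using r by (simp add: representation_def)
  let ?\<delta> = "1 - exp (- (1 / (real i + 1)))"
  have \<delta>: "?\<delta> > 0" by simp
  have "integrable \<mu> (indicator (annulus i) :: _ \<Rightarrow> real)"
  proof (rule Bochner_Integration.integrable_bound)
    show "integrable \<mu> (\<lambda>v. (1 - exp (- coord_sum v)) / ?\<delta>)"
      by (intro integrable_divide_zero representation_integrable(1)[OF r])
    show "(indicator (annulus i) :: _ \<Rightarrow> real) \<in> borel_measurable \<mu>" by measurable
    have "AE v in \<mu>. v \<in> nonneg_orthant - {0}" using r by (simp add: representation_def)
    then show "AE v in \<mu>. norm (indicator (annulus i) v :: real) \<le> norm ((1 - exp (- coord_sum v)) / ?\<delta>)"
    proof eventually_elim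
      case (elim v)
      \<comment> \<open>Since \<open>1 / 0 = 0\<close>, the origin belongs to
        \<open>annulus 0\<close>; positivity therefore has to come from the almost sure exclusion of
        0.\<close>
      then have "0 < norm v" "norm v \<le> coord_sum v" by (auto intro: norm_le_coord_sum)
      then have pos: "coord_sum v > 0" by linarith
      show ?case
      proof (cases "v \<in> annulus i")
        case True
        have "1 / coord_sum v < real i + 1"
          using True pos by (simp add: annulus_def) linarith
        then have "1 / (real i + 1) \<le> coord_sum v"
          using pos by (simp add: field_simps)
        then have "?\<delta> \<le> 1 - exp (- coord_sum v)" by simp
        then have "1 \<le> (1 - exp (- coord_sum v)) / ?\<delta>"
          using \<delta> by (subst le_divide_eq_1_pos) auto
        moreover have "norm (indicator (annulus i) v :: real) = 1" using True by simp
        ultimately show ?thesis unfolding real_norm_def by linarith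
      qed simp
    qed
  qed
  then show ?thesis by (simp add: integrable_indicator_iff)
qed

lemma integral_annuli_tendsto:
  fixes f :: "real ^ 'n::finite \<Rightarrow> 'b::{banach, second_countable_topology}"
  assumes r: "representation \<psi> c0 c1 \<mu>" and f: "integrable \<mu> f"
  shows "(\<lambda>k. \<Sum>i<k. LINT v|\<mu>. indicator (annulus i) v *\<^sub>R f v) \<longlonglongrightarrow> (LINT v|\<mu>. f v)"
proof -
  have sets_\<mu> [measurable_cong]: "sets \<mu> = sets borel" using r by (simp add: representation_def)
  have AE: "AE v in \<mu>. v \<in> nonneg_orthant - {0}" using r by (simp add: representation_def)
  have [measurable]: "f \<in> borel_measurable \<mu>" using f by auto
  have int: "integrable \<mu> (\<lambda>v. indicator (annulus i) v *\<^sub>R f v)" for i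
    by (rule integrable_mult_indicator[OF _ f]) simp
  have "(\<lambda>k. LINT v|\<mu>. (\<Sum>i<k. indicator (annulus i) v) *\<^sub>R f v) \<longlonglongrightarrow> (LINT v|\<mu>. f v)"
  proof (rule integral_dominated_convergence[where w="\<lambda>v. norm (f v)"])
    show "integrable \<mu> (\<lambda>v. norm (f v))" using f by simp
    show "AE v in \<mu>. (\<lambda>k. (\<Sum>i<k. indicator (annulus i) v) *\<^sub>R f v) \<longlonglongrightarrow> f v"
      using AE
    proof eventually_elim
      case (elim v)
      have "\<forall>\<^sub>F k in sequentially. (\<Sum>i<k. indicator (annulus i) v) *\<^sub>R f v = f v"
        using eventually_gt_at_top[of "nat \<lfloor>1 / coord_sum v\<rfloor>"]
        by eventually_elim (use elim in \<open>simp add: sum_indicator_annulus\<close>)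
      then show ?case by (rule tendsto_eventually)
    qed
    show "AE v in \<mu>. norm ((\<Sum>i<k. indicator (annulus i) v) *\<^sub>R f v) \<le> norm (f v)" for k
      using AE by eventually_elim (simp add: sum_indicator_annulus)
  qed measurable
  moreover have "(LINT v|\<mu>. (\<Sum>i<k. indicator (annulus i) v) *\<^sub>R f v) = (\<Sum>i<k. LINT v|\<mu>. indicator (annulus i) v *\<^sub>R f v)" for k
    unfolding scaleR_sum_left by (intro Bochner_Integration.integral_sum int)
  ultimately show ?thesis by simp
qed

text \<open>The Levy measure may be infinite near 0, so one compound Poisson variable is not enough.
  Its restrictions to the annuli, scaled by \<open>t\<close>, are finite; they give independent
  compound Poisson variables whose sum converges almost surely. A deterministic drift is added at
  the end.\<close>

theorem subordinator_exists:
  fixes \<psi> :: "real ^ 'n::finite \<Rightarrow> real"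
  assumes r: "representation \<psi> 0 c1 \<mu>" and t: "0 \<le> t"
  shows "\<exists>\<rho>. prob_space \<rho> \<and> orthant_measure \<rho> \<and>
    (\<forall>z\<in>left_half. (LINT u|\<rho>. exp (cdot z u)) =
       exp (of_real t * (cdot z c1 + (LINT v|\<mu>. exp (cdot z v) - 1))))"
proof -
  have sets_\<mu> [measurable_cong]: "sets \<mu> = sets borel" using r by (simp add: representation_def)
  have AE_\<mu>: "AE v in \<mu>. v \<in> nonneg_orthant - {0}" using r by (simp add: representation_def)
  let ?\<mu> = "\<lambda>i. density \<mu> (\<lambda>v. ennreal (t * indicator (annulus i) v))"
  have orth_\<mu>: "orthant_measure (?\<mu> i)" for i
  proof -
    have "emeasure (?\<mu> i) (space (?\<mu> i)) = (\<integral>\<^sup>+v. ennreal (t * indicator (annulus i) v) * indicator (space \<mu>) v \<partial>\<mu>)"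
      by (subst emeasure_density) auto
    also have "\<dots> = (\<integral>\<^sup>+v. ennreal t * indicator (annulus i) v \<partial>\<mu>)"
      using t by (intro nn_integral_cong) (auto simp: indicator_def)
    also have "\<dots> = ennreal t * emeasure \<mu> (annulus i)"
      by (rule nn_integral_cmult_indicator) (simp add: sets_\<mu>)
    finally have "emeasure (?\<mu> i) (space (?\<mu> i)) = ennreal t * emeasure \<mu> (annulus i)" .
    then have "finite_measure (?\<mu> i)"
      using emeasure_annulus_finite[OF r, of i] by (intro finite_measureI) (auto simp: ennreal_mult_eq_top_iff)
    moreover have "AE v in ?\<mu> i. v \<in> nonneg_orthant"
      using AE_\<mu> by (subst AE_density) (auto elim!: eventually_mono)
    ultimately show ?thesis
      by (simp add: orthant_measure_def orthant_measure_axioms_def sets_\<mu>)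
  qed
  have int_\<mu>: "(LINT v|?\<mu> i. exp (cdot z v) - 1) = of_real t * (LINT v|\<mu>. indicator (annulus i) v *\<^sub>R (exp (cdot z v) - 1))" for i z
  proof -
    have "(LINT v|?\<mu> i. exp (cdot z v) - 1) = (LINT v|\<mu>. (t * indicator (annulus i) v) *\<^sub>R (exp (cdot z v) - 1))"
      using t by (subst integral_density) auto
    then show ?thesis by (simp add: scaleR_conv_of_real mult.assoc)
  qed
  have "\<exists>\<rho>. prob_space \<rho> \<and> orthant_measure \<rho> \<and> (\<forall>z\<in>left_half. (LINT u|\<rho>. exp (cdot z u)) =
      exp (of_real t * (LINT v|\<mu>. indicator (annulus i) v *\<^sub>R (exp (cdot z v) - 1))))" for i
    using compound_poisson_exists[OF orth_\<mu>, of i] unfolding int_\<mu> .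
  then obtain \<rho> where \<rho>: "\<And>i. prob_space (\<rho> i)" "\<And>i. orthant_measure (\<rho> i)"
    "\<And>i z. z \<in> left_half \<Longrightarrow> (LINT u|\<rho> i. exp (cdot z u)) =
      exp (of_real t * (LINT v|\<mu>. indicator (annulus i) v *\<^sub>R (exp (cdot z v) - 1)))"
    by metis
  have sets_\<rho> [measurable_cong]: "sets (\<rho> i) = sets borel" for i
    by (rule orthant_measure.sets_eq[OF \<rho>(2)])
  interpret \<rho>: product_prob_space \<rho> UNIV
    by (intro product_prob_space.intro product_sigma_finite.intro prob_space_imp_sigma_finite
      product_prob_space_axioms.intro \<rho>)
  let ?\<Omega> = "PiM UNIV \<rho>"
  have AE_orth: "AE \<omega> in ?\<Omega>. \<forall>i. \<omega> i \<in> nonneg_orthant"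
    unfolding AE_all_countable
    by (intro allI AE_PiM_component \<rho> orthant_measure.AE_orthant) auto
  have AE_sum: "AE \<omega> in ?\<Omega>. summable \<omega>"
  proof (rule AE_PiM_summable[OF \<rho>(1,2)])
    fix k
    define q where "q i = (LINT v|\<mu>. indicator (annulus i) v *\<^sub>R (1 - exp (- coord_sum v)))" for i
    \<comment> \<open>At this point the transform is the real Laplace transform of the coordinate
      sum, and \<open>1 - exp (- a) \<le> a\<close> bounds each expectation by an integral over one
      annulus.\<close>
    let ?z = "(- 1) :: complex ^ 'n"
    have z: "?z \<in> left_half" by (simp add: left_half_def)
    have cz: "cdot ?z v = of_real (- coord_sum v)" for v
      by (simp add: cdot_def coord_sum_def sum_negf)
    have q0: "0 \<le> q i" for i
      unfolding q_def using AE_\<mu> by (intro integral_nonneg_AE) (auto simp: coord_sum_nonneg elim!: eventually_mono)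
    have "1 - (LINT u|\<rho> i. exp (- coord_sum u)) \<le> t * q i" for i
    proof -
      have "(LINT u|\<rho> i. exp (cdot ?z u)) = of_real (LINT u|\<rho> i. exp (- coord_sum u))"
        unfolding cz exp_of_real by simp
      moreover have "(LINT v|\<mu>. indicator (annulus i) v *\<^sub>R (exp (cdot ?z v) - 1)) = of_real (- q i)"
      proof -
        have "(LINT v|\<mu>. indicator (annulus i) v *\<^sub>R (exp (cdot ?z v) - 1))
            = (LINT v|\<mu>. complex_of_real (- (indicator (annulus i) v *\<^sub>R (1 - exp (- coord_sum v)))))"
          unfolding cz exp_of_real by (intro Bochner_Integration.integral_cong refl)
              (simp add: scaleR_conv_of_real right_diff_distrib)
        also have "\<dots> = of_real (- q i)"
          unfolding q_def by (simp only: integral_complex_of_real integral_minus)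
        finally show ?thesis .
      qed
      ultimately have "complex_of_real (LINT u|\<rho> i. exp (- coord_sum u)) = of_real (exp (- (t * q i)))"
        using \<rho>(3)[OF z, of i] by (simp flip: exp_of_real)
      then have "(LINT u|\<rho> i. exp (- coord_sum u)) = exp (- (t * q i))"
        by (rule of_real_eq_iff[THEN iffD1])
      then show ?thesis using exp_ge_add_one_self[of "- (t * q i)"] by simp
    qed
    then have "(\<Sum>i<k. 1 - (LINT u|\<rho> i. exp (- coord_sum u))) \<le> (\<Sum>i<k. t * q i)"
      by (intro sum_mono)
    also have "\<dots> \<le> t * (LINT v|\<mu>. 1 - exp (- coord_sum v))"
    proof -
      have "(\<lambda>k. \<Sum>i<k. q i) \<longlonglongrightarrow> (LINT v|\<mu>. 1 - exp (- coord_sum v))"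
        unfolding q_def by (rule integral_annuli_tendsto[OF r representation_integrable(1)[OF r]])
      then have "(\<Sum>i<k. q i) \<le> (LINT v|\<mu>. 1 - exp (- coord_sum v))"
        by (rule incseq_le[rotated]) (auto intro!: incseq_SucI q0)
      then show ?thesis using t by (simp add: mult_left_mono flip: sum_distrib_left)
    qed
    finally show "(\<Sum>i<k. 1 - (LINT u|\<rho> i. exp (- coord_sum u))) \<le> t * (LINT v|\<mu>. 1 - exp (- coord_sum v))" .
  qed
  define S where "S k \<omega> = (\<Sum>i<k. \<omega> i)" for k and \<omega> :: "nat \<Rightarrow> real ^ 'n"
  \<comment> \<open>Where the series diverges, which is a null set, \<open>lim\<close> is an
    unspecified value.\<close>
  define X where "X \<omega> = lim (\<lambda>k. S k \<omega>) + t *\<^sub>R c1" for \<omega>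
  have S_meas [measurable]: "S k \<in> borel_measurable ?\<Omega>" for k
    unfolding S_def[abs_def] by measurable
  have X_meas [measurable]: "X \<in> borel_measurable ?\<Omega>"
    unfolding X_def[abs_def] by measurable
  have S_lim: "AE \<omega> in ?\<Omega>. (\<lambda>k. S k \<omega>) \<longlonglongrightarrow> lim (\<lambda>k. S k \<omega>)"
    using AE_sum by eventually_elim (simp add: S_def summable_iff_convergent convergent_LIMSEQ_iff)
  have S_orth: "AE \<omega> in ?\<Omega>. \<forall>k. S k \<omega> \<in> nonneg_orthant"
    using AE_orth by eventually_elim (auto simp: S_def nonneg_orthant_def sum_nonneg)
  have X_orth: "AE \<omega> in ?\<Omega>. X \<omega> \<in> nonneg_orthant"
    using S_lim S_orth
  proof eventually_elim
    case (elim \<omega>)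
    have "lim (\<lambda>k. S k \<omega>) \<in> nonneg_orthant"
      by (rule closed_sequentially[OF closed_nonneg_orthant _ elim(1)]) (use elim(2) in blast)
    moreover have "t *\<^sub>R c1 \<in> nonneg_orthant"
      using r t by (simp add: representation_def nonneg_orthant_def)
    ultimately show ?case unfolding X_def by (rule nonneg_orthant_add)
  qed
  have "(LINT u|distr ?\<Omega> borel X. exp (cdot z u)) =
      exp (of_real t * (cdot z c1 + (LINT v|\<mu>. exp (cdot z v) - 1)))" if z: "z \<in> left_half" for z
  proof -
    have "(\<lambda>k. LINT \<omega>|?\<Omega>. exp (cdot z (S k \<omega>))) \<longlonglongrightarrow> (LINT \<omega>|?\<Omega>. exp (cdot z (lim (\<lambda>k. S k \<omega>))))"
    proof (rule integral_dominated_convergence[where w="\<lambda>_. 1"])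
      show "AE \<omega> in ?\<Omega>. (\<lambda>k. exp (cdot z (S k \<omega>))) \<longlonglongrightarrow> exp (cdot z (lim (\<lambda>k. S k \<omega>)))"
        using S_lim by eventually_elim
          (intro tendsto_exp continuous_on_tendsto_compose[OF continuous_on_cdot[of UNIV]], auto)
      show "AE \<omega> in ?\<Omega>. norm (exp (cdot z (S k \<omega>))) \<le> 1" for k
        using S_orth by eventually_elim (intro norm_exp_cdot_le z, blast)
    qed auto
    moreover have "(LINT \<omega>|?\<Omega>. exp (cdot z (S k \<omega>)))
        = exp (of_real t * (\<Sum>i<k. LINT v|\<mu>. indicator (annulus i) v *\<^sub>R (exp (cdot z v) - 1)))" for k
    proof -
      have "(LINT \<omega>|?\<Omega>. exp (cdot z (S k \<omega>))) = (LINT \<omega>|?\<Omega>. (\<Prod>i<k. exp (cdot z (\<omega> i))))"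
        by (simp add: S_def cdot_sum exp_sum)
      also have "\<dots> = (\<Prod>i<k. LINT u|\<rho> i. exp (cdot z u))"
        by (intro PiM_nat_integral_prod \<rho> orthant_measure.integral_orthant(2)[OF \<rho>(2) orthant_bcont_exp_cdot[OF z]])
          measurable
      also have "\<dots> = exp (of_real t * (\<Sum>i<k. LINT v|\<mu>. indicator (annulus i) v *\<^sub>R (exp (cdot z v) - 1)))"
        by (simp add: \<rho>(3)[OF z] sum_distrib_left exp_sum)
      finally show ?thesis .
    qed
    moreover have "(\<lambda>k. exp (of_real t * (\<Sum>i<k. LINT v|\<mu>. indicator (annulus i) v *\<^sub>R (exp (cdot z v) - 1))))
        \<longlonglongrightarrow> exp (of_real t * (LINT v|\<mu>. exp (cdot z v) - 1))"
      by (intro tendsto_intros integral_annuli_tendsto[OF r representation_integrable(2)[OF r z]])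
    ultimately have "(LINT \<omega>|?\<Omega>. exp (cdot z (lim (\<lambda>k. S k \<omega>)))) = exp (of_real t * (LINT v|\<mu>. exp (cdot z v) - 1))"
      by (simp add: LIMSEQ_unique)
    then have "(LINT \<omega>|?\<Omega>. exp (cdot z (X \<omega>))) = exp (of_real t * (cdot z c1 + (LINT v|\<mu>. exp (cdot z v) - 1)))"
      by (simp add: X_def cdot_add cdot_scaleR exp_add distrib_left)
    then show ?thesis by (subst integral_distr) auto
  qed
  then show ?thesis
    using orthant_measure_distr[OF \<rho>.P.prob_space_axioms X_meas X_orth] by blast
qed

section \<open>The laws \<open>nu\<close> and the extension of \<open>\<psi>\<close>\<close>

definition cvec :: "real ^ 'n::finite \<Rightarrow> complex ^ 'n" where
  "cvec s = (\<chi> j. of_real (s $ j))"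

lemma cdot_cvec: "cdot (cvec s) v = of_real (s \<bullet> v)"
  by (simp add: cdot_def cvec_def inner_vec_def)

lemma cdot_imag_vec: "cdot (imag_vec y) v = \<i> * of_real (y \<bullet> v)"
  by (simp add: cdot_def imag_vec_def inner_vec_def sum_distrib_left mult_ac)

lemma cvec_left_half: "s \<in> neg_orthant \<Longrightarrow> cvec s \<in> left_half"
  by (simp add: cvec_def left_half_def neg_orthant_def less_imp_le)

lemma imag_vec_left_half: "imag_vec y \<in> left_half"
  by (simp add: imag_vec_def left_half_def)

text \<open>Makes limits at 0 within the orthant unique, which determines the constant term of a
  representation.\<close>

lemma at_0_within_neg_orthant: "at 0 within (neg_orthant :: (real ^ 'n::finite) set) \<noteq> bot"
proof -
  have "(0 :: real ^ 'n) islimpt neg_orthant"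
    unfolding islimpt_sequential
  proof (intro exI[of _ "\<lambda>k. (- (1 / real (Suc k))) *\<^sub>R 1"] conjI allI)
    show "(- (1 / real (Suc k))) *\<^sub>R 1 \<in> (neg_orthant :: (real ^ 'n) set) - {0}" for k
      by (auto simp: neg_orthant_def vec_eq_iff)
    have "(\<lambda>k. 1 / real (Suc k)) \<longlonglongrightarrow> 0"
      using LIMSEQ_inverse_real_of_nat by (simp add: inverse_eq_divide)
    then have "(\<lambda>k. (- (1 / real (Suc k))) *\<^sub>R (1 :: real ^ 'n)) \<longlonglongrightarrow> (- 0) *\<^sub>R 1"
      by (intro tendsto_intros)
    then show "(\<lambda>k. (- (1 / real (Suc k))) *\<^sub>R (1 :: real ^ 'n)) \<longlonglongrightarrow> 0" by simp
  qed
  then show ?thesis by (simp add: trivial_limit_within)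
qed

text \<open>The choice operator may return any valid triple. Uniqueness of limits forces its
  constant term to be 0; the linear term is carried along as the drift that
  \<open>subordinator_exists\<close> admits.\<close>

lemma extension_representation:
  assumes "\<psi> \<in> T0_class"
  obtains c1 \<mu> where "representation \<psi> 0 c1 \<mu>"
    "\<And>z. extension \<psi> z = cdot z c1 + (LINT v|\<mu>. exp (cdot z v) - 1)"
proof -
  obtain \<mu>0 where r0: "representation \<psi> 0 0 \<mu>0" using assms by (auto simp: T0_class_def)
  define tr where "tr = (SOME (c0, c1, \<mu>). representation \<psi> c0 c1 \<mu>)"
  obtain c0 c1 \<mu> where tr: "tr = (c0, c1, \<mu>)" by (cases tr) auto
  have "case tr of (c0, c1, \<mu>) \<Rightarrow> representation \<psi> c0 c1 \<mu>"
    unfolding tr_def by (rule someI[of _ "(0, 0, \<mu>0)"]) (simp add: r0)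
  then have r: "representation \<psi> c0 c1 \<mu>" by (simp add: tr)
  have "c0 = 0"
    using r r0 tendsto_unique[OF at_0_within_neg_orthant] unfolding representation_def by blast
  show thesis
  proof (rule that)
    show "representation \<psi> 0 c1 \<mu>" using r by (simp add: \<open>c0 = 0\<close>)
    show "extension \<psi> z = cdot z c1 + (LINT v|\<mu>. exp (cdot z v) - 1)" for z
      by (simp add: extension_def tr_def[symmetric] tr \<open>c0 = 0\<close>)
  qed
qed

lemma extension_cvec:
  assumes "\<psi> \<in> T0_class" and s: "s \<in> neg_orthant"
  shows "extension \<psi> (cvec s) = of_real (\<psi> s)"
proof -
  obtain c1 \<mu> where r: "representation \<psi> 0 c1 \<mu>"
    and e: "\<And>z. extension \<psi> z = cdot z c1 + (LINT v|\<mu>. exp (cdot z v) - 1)"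
    using extension_representation[OF assms(1)] by blast
  have "(LINT v|\<mu>. exp (cdot (cvec s) v) - 1) = (LINT v|\<mu>. complex_of_real (exp (s \<bullet> v) - 1))"
    by (simp add: cdot_cvec exp_of_real)
  also have "\<dots> = of_real (LINT v|\<mu>. exp (s \<bullet> v) - 1)"
    by (rule integral_complex_of_real)
  finally show ?thesis
    using r s by (simp add: e cdot_cvec representation_def inner_commute)
qed

lemma orthant_integral_exp_char_cong:
  assumes M: "orthant_measure M"
  shows "orthant_integral M (exp_char m) = (LINT u|M. exp ((- nat_vec m) \<bullet> u))"
proof -
  have "exp_char m u = exp ((- nat_vec m) \<bullet> u)" for u
    by (simp add: exp_char_def inner_vec_def sum_negf)
  moreover have "exp_char m \<in> borel_measurable borel"
    unfolding exp_char_def[abs_def] by (intro borel_measurable_continuous_onI continuous_intros)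
  ultimately show ?thesis
    using orthant_measure.integral_orthant(1)[OF M orthant_bcont_exp_char, of m] by simp
qed

text \<open>The constructed subordinator meets the defining description, and a second candidate has
  the same Laplace transform at the points \<open>- nat_vec m\<close>. The transform on the closed
  half space comes with the construction, without analytic continuation.\<close>

theorem nu_properties:
  assumes \<psi>: "\<psi> \<in> T0_class" and t: "0 \<le> t"
  shows prob_space_nu: "prob_space (nu \<psi> t)"
    and orthant_measure_nu: "orthant_measure (nu \<psi> t)"
    and integral_exp_nu: "z \<in> left_half \<Longrightarrow> (LINT u|nu \<psi> t. exp (cdot z u)) = exp (of_real t * extension \<psi> z)"
    and laplace_nu: "s \<in> neg_orthant \<Longrightarrow> (LINT u|nu \<psi> t. exp (s \<bullet> u)) = exp (t * \<psi> s)"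
proof -
  obtain c1 \<mu> where r: "representation \<psi> 0 c1 \<mu>"
    and e: "\<And>z. extension \<psi> z = cdot z c1 + (LINT v|\<mu>. exp (cdot z v) - 1)"
    using extension_representation[OF \<psi>] by blast
  obtain \<rho> where \<rho>: "prob_space \<rho>" "orthant_measure \<rho>"
    "\<And>z. z \<in> left_half \<Longrightarrow> (LINT u|\<rho>. exp (cdot z u)) = exp (of_real t * extension \<psi> z)"
    using subordinator_exists[OF r t] unfolding e by blast
  have lap: "(LINT u|\<rho>. exp (s \<bullet> u)) = exp (t * \<psi> s)" if s: "s \<in> neg_orthant" for s
  proof -
    have "complex_of_real (LINT u|\<rho>. exp (s \<bullet> u)) = (LINT u|\<rho>. exp (cdot (cvec s) u))"
      by (simp add: cdot_cvec exp_of_real)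
    also have "\<dots> = of_real (exp (t * \<psi> s))"
      using \<rho>(3)[OF cvec_left_half[OF s]] by (simp add: extension_cvec[OF \<psi> s] flip: exp_of_real)
    finally show ?thesis by (rule of_real_eq_iff[THEN iffD1])
  qed
  have "nu \<psi> t = \<rho>"
    unfolding nu_def
  proof (rule the_equality)
    show "prob_space \<rho> \<and> sets \<rho> = sets borel \<and> (AE u in \<rho>. u \<in> nonneg_orthant) \<and>
        (\<forall>z\<in>neg_orthant. (LINT u|\<rho>. exp (z \<bullet> u)) = exp (t * \<psi> z))"
      using \<rho> lap by (simp add: orthant_measure.sets_eq orthant_measure.AE_orthant)
    fix \<nu> assume \<nu>: "prob_space \<nu> \<and> sets \<nu> = sets borel \<and> (AE u in \<nu>. u \<in> nonneg_orthant) \<and>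
        (\<forall>z\<in>neg_orthant. (LINT u|\<nu>. exp (z \<bullet> u)) = exp (t * \<psi> z))"
    then have o: "orthant_measure \<nu>"
      by (simp add: orthant_measure_def orthant_measure_axioms_def prob_space_def)
    show "\<nu> = \<rho>"
    proof (rule orthant_measure_eqI[OF o \<rho>(2)])
      fix m :: "'a \<Rightarrow> nat" assume "\<And>j. 1 \<le> m j"
      then have "- nat_vec m \<in> neg_orthant"
        by (simp add: neg_orthant_def Suc_le_eq)
      then show "orthant_integral \<nu> (exp_char m) = orthant_integral \<rho> (exp_char m)"
        unfolding orthant_integral_exp_char_cong[OF o] orthant_integral_exp_char_cong[OF \<rho>(2)]
        using \<nu> lap by metis
    qed
  qed
  then show "prob_space (nu \<psi> t)" "orthant_measure (nu \<psi> t)"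
    "z \<in> left_half \<Longrightarrow> (LINT u|nu \<psi> t. exp (cdot z u)) = exp (of_real t * extension \<psi> z)"
    "s \<in> neg_orthant \<Longrightarrow> (LINT u|nu \<psi> t. exp (s \<bullet> u)) = exp (t * \<psi> s)"
    using \<rho> lap by auto
qed

text \<open>\<open>exp (extension \<psi> z)\<close> is the transform of the probability measure
  \<open>nu \<psi> 1\<close>, so its modulus is at most 1.\<close>

lemma Re_extension_le:
  assumes \<psi>: "\<psi> \<in> T0_class" and z: "z \<in> left_half"
  shows "Re (extension \<psi> z) \<le> 0"
proof -
  interpret prob_space "nu \<psi> 1" by (rule prob_space_nu[OF \<psi>]) simp
  interpret o: orthant_measure "nu \<psi> 1" by (rule orthant_measure_nu[OF \<psi>]) simp
  have "norm (LINT u|nu \<psi> 1. exp (cdot z u)) \<le> (LINT u|nu \<psi> 1. norm (exp (cdot z u)))"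
    by (rule integral_norm_bound)
  also have "\<dots> \<le> (LINT u|nu \<psi> 1. 1)"
  proof (rule integral_mono_AE)
    show "integrable (nu \<psi> 1) (\<lambda>u. norm (exp (cdot z u)))"
      by (intro integrable_norm o.integral_orthant(2) orthant_bcont_exp_cdot z) measurable
    show "AE u in nu \<psi> 1. norm (exp (cdot z u)) \<le> 1"
      using o.AE_orthant by eventually_elim (rule norm_exp_cdot_le[OF z])
  qed simp
  also have "\<dots> = 1" using prob_space by simp
  finally have "norm (exp (of_real 1 * extension \<psi> z)) \<le> 1"
    by (simp only: integral_exp_nu[OF \<psi> zero_le_one z])
  then show ?thesis by simp
qed

section \<open>Gaussian test functions\<close>

lemma real_polynomial_function_directional_derivative:
  fixes P :: "real ^ 'n::finite \<Rightarrow> real"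
  assumes "real_polynomial_function P"
  shows "\<exists>Q. real_polynomial_function Q \<and>
    (\<forall>x. ((\<lambda>h. P (x + h *\<^sub>R e)) has_real_derivative Q x) (at 0))"
  using assms
proof induction
  case (linear f)
  have "((\<lambda>h. f (x + h *\<^sub>R e)) has_real_derivative f e) (at 0)" for x
  proof -
    have "(\<lambda>h. f (x + h *\<^sub>R e)) = (\<lambda>h. f x + h * f e)"
      using linear by (simp add: fun_eq_iff linear_add linear_cmul bounded_linear.linear)
    then show ?thesis by (auto intro!: derivative_eq_intros)
  qed
  then show ?case by (intro exI[of _ "\<lambda>x. f e"]) auto
next
  case (const c)
  then show ?case by (intro exI[of _ "\<lambda>x. 0"]) auto
next
  case (add f g)
  then obtain F G where "real_polynomial_function F" "real_polynomial_function G"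
    "\<And>x. ((\<lambda>h. f (x + h *\<^sub>R e)) has_real_derivative F x) (at 0)"
    "\<And>x. ((\<lambda>h. g (x + h *\<^sub>R e)) has_real_derivative G x) (at 0)" by blast
  then show ?case
    by (intro exI[of _ "\<lambda>x. F x + G x"]) (auto intro!: derivative_intros)
next
  case (mult f g)
  then obtain F G where FG: "real_polynomial_function F" "real_polynomial_function G"
    "\<And>x. ((\<lambda>h. f (x + h *\<^sub>R e)) has_real_derivative F x) (at 0)"
    "\<And>x. ((\<lambda>h. g (x + h *\<^sub>R e)) has_real_derivative G x) (at 0)" by blast
  have "((\<lambda>h. f (x + h *\<^sub>R e) * g (x + h *\<^sub>R e)) has_real_derivative F x * g x + f x * G x) (at 0)" for x
    using DERIV_mult[OF FG(3)[of x] FG(4)[of x]] by (simp add: add.commute mult.commute)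
  with FG mult.hyps show ?case
    by (intro exI[of _ "\<lambda>x. F x * g x + f x * G x"]) auto
qed

lemma real_polynomial_function_growth:
  fixes P :: "'a::real_normed_vector \<Rightarrow> real"
  assumes "real_polynomial_function P"
  shows "\<exists>C d. 0 \<le> C \<and> (\<forall>x. \<bar>P x\<bar> \<le> C * (1 + norm x) ^ d)"
  using assms
proof induction
  case (linear f)
  then obtain K where K: "0 < K" "\<And>x. norm (f x) \<le> norm x * K" using bounded_linear.pos_bounded by blast
  have "\<bar>f x\<bar> \<le> K * (1 + norm x) ^ 1" for x
    using K(2)[of x] K(1) by (simp add: algebra_simps)
  with K(1) show ?case by (intro exI[of _ K] exI[of _ 1]) auto
next
  case (const c)
  then show ?case by (intro exI[of _ "\<bar>c\<bar>"] exI[of _ 0]) auto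
next
  case (add f g)
  then obtain C d C' d' where C: "0 \<le> C" "\<And>x. \<bar>f x\<bar> \<le> C * (1 + norm x) ^ d"
    and C': "0 \<le> C'" "\<And>x. \<bar>g x\<bar> \<le> C' * (1 + norm x) ^ d'" by blast
  have "\<bar>f x + g x\<bar> \<le> (C + C') * (1 + norm x) ^ (max d d')" for x
  proof -
    have "C * (1 + norm x) ^ d \<le> C * (1 + norm x) ^ max d d'"
      "C' * (1 + norm x) ^ d' \<le> C' * (1 + norm x) ^ max d d'"
      using C(1) C'(1) by (auto intro!: mult_left_mono power_increasing)
    with C(2)[of x] C'(2)[of x] show ?thesis by (simp add: distrib_right)
  qed
  with C(1) C'(1) show ?case by (intro exI[of _ "C + C'"] exI[of _ "max d d'"]) auto
next
  case (mult f g)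
  then obtain C d C' d' where C: "0 \<le> C" "\<And>x. \<bar>f x\<bar> \<le> C * (1 + norm x) ^ d"
    and C': "0 \<le> C'" "\<And>x. \<bar>g x\<bar> \<le> C' * (1 + norm x) ^ d'" by blast
  have "\<bar>f x * g x\<bar> \<le> (C * C') * (1 + norm x) ^ (d + d')" for x
    using mult_mono[OF C(2)[of x] C'(2)[of x]] C(1) by (simp add: abs_mult power_add mult_ac)
  with C(1) C'(1) show ?case by (intro exI[of _ "C * C'"] exI[of _ "d + d'"]) auto
qed

lemma power_le_fact_exp: "0 \<le> x \<Longrightarrow> x ^ n \<le> fact n * exp x" for x :: real
proof -
  assume x: "0 \<le> x"
  have s: "(\<lambda>n. x ^ n /\<^sub>R fact n) sums exp x" by (rule exp_converges)
  have "(\<Sum>k\<in>{n}. x ^ k /\<^sub>R fact k) \<le> (\<Sum>k. x ^ k /\<^sub>R fact k)"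
    using x by (intro sum_le_suminf sums_summable[OF s]) auto
  then show ?thesis using sums_unique[OF s] by (simp add: field_simps)
qed

lemma bounded_power_mult_gauss:
  fixes s :: "real ^ 'n::finite"
  assumes s: "\<And>j. 0 < s $ j"
  shows "\<exists>B. \<forall>x. (1 + norm x) ^ m * gauss s x \<le> B"
proof -
  \<comment> \<open>Half the smallest coefficient, so that the exponent of \<open>gauss s\<close> is
    at most \<open>- c * (norm x)\<^sup>2\<close>.\<close>
  define c where "c = (MIN j. s $ j) / 2"
  have c: "c > 0" using s by (simp add: c_def)
  have cs: "c * 2 \<le> s $ j" for j by (simp add: c_def)
  \<comment> \<open>The constant \<open>3 * c\<close> comes from
    \<open>(norm x)\<^sup>2 \<ge> 2 * (1 + norm x) - 3\<close>; the linear exponent that remains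
    beats the power through a single term of the exponential series.\<close>
  have "(1 + norm x) ^ m * gauss s x \<le> (fact m * exp (3 * c)) / (2 * c) ^ m" for x
  proof -
    have "(\<Sum>j\<in>UNIV. c * (x $ j)\<^sup>2) \<le> (\<Sum>j\<in>UNIV. s $ j * (x $ j)\<^sup>2 / 2)"
    proof (intro sum_mono)
      fix j show "c * (x $ j)\<^sup>2 \<le> s $ j * (x $ j)\<^sup>2 / 2"
        using mult_right_mono[OF cs[of j], of "(x $ j)\<^sup>2"] by simp
    qed
    moreover have "(norm x)\<^sup>2 = (\<Sum>j\<in>UNIV. (x $ j)\<^sup>2)"
      by (simp add: norm_vec_def L2_set_def sum_nonneg)
    ultimately have "c * (norm x)\<^sup>2 \<le> (\<Sum>j\<in>UNIV. s $ j * (x $ j)\<^sup>2 / 2)"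
      by (simp add: sum_distrib_left)
    moreover have "c * (2 * norm x) \<le> c * ((norm x)\<^sup>2 + 1)"
      using c sum_power2_ge_zero[of "norm x - 1" 0] by (intro mult_left_mono) (auto simp: power2_eq_square algebra_simps)
    ultimately have "gauss s x \<le> exp (3 * c - 2 * c * (1 + norm x))"
      using c unfolding gauss_def by (simp add: algebra_simps)
    then have g: "gauss s x \<le> exp (3 * c) / exp (2 * c * (1 + norm x))" by (simp add: exp_diff)
    have p: "(2 * c * (1 + norm x)) ^ m \<le> fact m * exp (2 * c * (1 + norm x))"
      using c by (intro power_le_fact_exp) simp
    have "(2 * c) ^ m * ((1 + norm x) ^ m * gauss s x) = (2 * c * (1 + norm x)) ^ m * gauss s x"
      by (simp only: power_mult_distrib mult_ac)
    also have "\<dots> \<le> (fact m * exp (2 * c * (1 + norm x))) * (exp (3 * c) / exp (2 * c * (1 + norm x)))"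
      using c by (intro mult_mono p g) (auto simp: gauss_def)
    also have "\<dots> = fact m * exp (3 * c)" by simp
    finally show ?thesis using c by (simp add: field_simps)
  qed
  then show ?thesis by blast
qed

lemma gauss_directional_derivative:
  "((\<lambda>h. gauss s (x + h *\<^sub>R axis j 1)) has_real_derivative (- (s $ j * x $ j)) * gauss s x) (at 0)"
proof -
  have D: "((\<lambda>h. \<Sum>i\<in>UNIV. s $ i * ((x + h *\<^sub>R axis j 1) $ i)\<^sup>2 / 2) has_real_derivative
      (\<Sum>i\<in>UNIV. s $ i * x $ i * axis j 1 $ i)) (at 0)"
    by (auto intro!: derivative_eq_intros sum.cong)
  have "(\<Sum>i\<in>UNIV. s $ i * x $ i * axis j 1 $ i) = s $ j * x $ j"
    by (simp add: axis_def if_distrib cong: if_cong)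
  then show ?thesis
    using DERIV_fun_exp[OF DERIV_minus[OF D]] by (simp add: gauss_def mult.commute)
qed

text \<open>Polynomial multiples of a fixed Gaussian are closed under partial derivatives. By
  induction all derivatives of the Gaussian have this form, and polynomial growth then gives the
  Schwartz bounds.\<close>

lemma real_polynomial_mult_gauss_derivative:
  fixes s :: "real ^ 'n::finite"
  assumes P: "real_polynomial_function P"
  shows "\<exists>Q. real_polynomial_function Q \<and>
    (\<forall>x. ((\<lambda>h. complex_of_real (P (x + h *\<^sub>R axis j 1) * gauss s (x + h *\<^sub>R axis j 1)))
      has_vector_derivative of_real (Q x * gauss s x)) (at 0))"
proof -
  obtain P' where P': "real_polynomial_function P'"
    "\<And>x. ((\<lambda>h. P (x + h *\<^sub>R axis j 1)) has_real_derivative P' x) (at 0)"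
    using real_polynomial_function_directional_derivative[OF P] by blast
  define Q where "Q x = P' x + P x * ((- (s $ j)) * x $ j)" for x
  have "real_polynomial_function Q"
    unfolding Q_def
    by (intro P'(1) P real_polynomial_function.intros(3,4,2,1) bounded_linear_vec_nth)
  moreover have "((\<lambda>h. complex_of_real (P (x + h *\<^sub>R axis j 1) * gauss s (x + h *\<^sub>R axis j 1)))
      has_vector_derivative of_real (Q x * gauss s x)) (at 0)" for x
  proof -
    have "((\<lambda>h. P (x + h *\<^sub>R axis j 1) * gauss s (x + h *\<^sub>R axis j 1)) has_real_derivative Q x * gauss s x) (at 0)"
      using DERIV_mult[OF P'(2)[of x] gauss_directional_derivative[of s x j]]
      by (simp add: Q_def algebra_simps)
    then show ?thesis
      by (intro has_vector_derivative_of_real) (simp add: has_real_derivative_iff_has_vector_derivative)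
  qed
  ultimately show ?thesis by blast
qed

lemma partial_derivs_gauss:
  fixes s :: "real ^ 'n::finite"
  shows "\<exists>P. real_polynomial_function P \<and>
    partial_derivs js (\<lambda>u. complex_of_real (gauss s u)) = (\<lambda>x. of_real (P x * gauss s x))"
proof (induction js)
  case Nil
  then show ?case by (intro exI[of _ "\<lambda>_. 1"]) auto
next
  case (Cons j js)
  then obtain P where P: "real_polynomial_function P"
    "partial_derivs js (\<lambda>u. complex_of_real (gauss s u)) = (\<lambda>x. of_real (P x * gauss s x))" by blast
  obtain Q where Q: "real_polynomial_function Q"
    "\<And>x. ((\<lambda>h. complex_of_real (P (x + h *\<^sub>R axis j 1) * gauss s (x + h *\<^sub>R axis j 1)))
      has_vector_derivative of_real (Q x * gauss s x)) (at 0)"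
    using real_polynomial_mult_gauss_derivative[OF P(1), where j=j and s=s] by blast
  have "partial_derivs (j # js) (\<lambda>u. complex_of_real (gauss s u)) = (\<lambda>x. of_real (Q x * gauss s x))"
    unfolding partial_derivs.simps P(2) partial_deriv_def
    using vector_derivative_at[OF Q(2)] by (simp add: fun_eq_iff)
  with Q(1) show ?case by blast
qed

lemma continuous_on_gauss: "continuous_on S (gauss s)"
  unfolding gauss_def[abs_def] by (intro continuous_intros) auto

lemma borel_measurable_gauss [measurable]: "gauss s \<in> borel_measurable borel"
  by (intro borel_measurable_continuous_onI continuous_on_gauss)

lemma gauss_schwartz:
  fixes s :: "real ^ 'n::finite"
  assumes s: "\<And>j. 0 < s $ j"
  shows "(\<lambda>u. complex_of_real (gauss s u)) \<in> schwartz"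
  unfolding schwartz_def smooth_on_def
proof (intro CollectI conjI allI ballI)
  fix js
  obtain P where P: "real_polynomial_function P"
    and d: "partial_derivs js (\<lambda>u. complex_of_real (gauss s u)) = (\<lambda>x. of_real (P x * gauss s x))"
    using partial_derivs_gauss by blast
  have "continuous_on UNIV P"
    using continuous_real_polymonial_function[OF P] by (simp add: continuous_at_imp_continuous_on)
  then show "continuous_on UNIV (partial_derivs js (\<lambda>u. complex_of_real (gauss s u)))"
    unfolding d by (intro continuous_intros continuous_on_gauss)
  show "(\<lambda>h. partial_derivs js (\<lambda>u. complex_of_real (gauss s u)) (x + h *\<^sub>R axis j 1)) differentiable at 0" for j x
    unfolding d using real_polynomial_mult_gauss_derivative[OF P, where j=j and s=s]
    by (blast intro: differentiableI_vector)
  fix k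
  obtain C m where C: "0 \<le> C" "\<And>x. \<bar>P x\<bar> \<le> C * (1 + norm x) ^ m"
    using real_polynomial_function_growth[OF P] by blast
  obtain B where B: "\<And>x :: real ^ 'n. (1 + norm x) ^ (k + m) * gauss s x \<le> B"
    using bounded_power_mult_gauss[OF s] by blast
  show "bounded (range (\<lambda>x. norm x ^ k *\<^sub>R partial_derivs js (\<lambda>u. complex_of_real (gauss s u)) x))"
    unfolding bounded_iff
  proof (intro exI[of _ "C * B"] ballI, clarsimp simp: d norm_mult simp del: of_real_mult)
    fix x :: "real ^ 'n"
    have "norm x ^ k * \<bar>P x * gauss s x\<bar> \<le> (1 + norm x) ^ k * (C * (1 + norm x) ^ m * gauss s x)"
      using C by (intro mult_mono power_mono) (auto simp: abs_mult gauss_def intro!: mult_right_mono)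
    also have "\<dots> = C * ((1 + norm x) ^ (k + m) * gauss s x)" by (simp add: power_add mult_ac)
    also have "\<dots> \<le> C * B" using C(1) B by (intro mult_left_mono)
    finally show "norm x ^ k * \<bar>P x * gauss s x\<bar> \<le> C * B" .
  qed
qed

section \<open>Fourier transforms of Gaussians\<close>

lemma gauss_fourier_real:
  fixes \<sigma> \<omega> :: real
  assumes \<sigma>: "0 < \<sigma>"
  shows "integrable lborel (\<lambda>x. complex_of_real (exp (- (\<sigma> * x\<^sup>2 / 2))) * cis (\<omega> * x))"
    and "(LINT x|lborel. complex_of_real (exp (- (\<sigma> * x\<^sup>2 / 2))) * cis (\<omega> * x))
      = of_real (sqrt (2 * pi / \<sigma>) * exp (- (\<omega>\<^sup>2 / (2 * \<sigma>))))"
proof -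
  let ?g = "\<lambda>x. complex_of_real (exp (- (\<sigma> * x\<^sup>2 / 2))) * cis (\<omega> * x)"
  \<comment> \<open>The standard deviation; rescaling by it reduces the integral to the
    characteristic function of the standard normal law.\<close>
  define c where "c = 1 / sqrt \<sigma>"
  have c: "c > 0" using \<sigma> by (simp add: c_def)
  have c2: "\<sigma> * c\<^sup>2 = 1" using \<sigma> by (simp add: c_def power_divide)
  interpret prob_space std_normal_distribution
    by (rule prob_space_normal_density) simp
  have g: "?g (0 + c * x) = of_real (sqrt (2 * pi)) * (std_normal_density x *\<^sub>R iexp ((\<omega> * c) * x))" for x
  proof -
    have "\<sigma> * (c * x)\<^sup>2 = x\<^sup>2" using c2 by (simp add: power_mult_distrib mult.assoc[symmetric])
    then show ?thesis
      by (simp add: std_normal_density_def scaleR_conv_of_real cis_conv_exp mult_ac)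
  qed
  have "integrable std_normal_distribution (\<lambda>x. iexp ((\<omega> * c) * x))"
    by (rule integrable_const_bound[where B=1]) auto
  then have int: "integrable lborel (\<lambda>x. std_normal_density x *\<^sub>R iexp ((\<omega> * c) * x))"
    by (subst (asm) integrable_density) auto
  then have "integrable lborel (\<lambda>x. ?g (0 + c * x))"
    unfolding g by (rule integrable_mult_right)
  then show "integrable lborel ?g"
    using c by (subst (asm) lborel_integrable_real_affine_iff) auto
  have "(LINT x|lborel. ?g x) = \<bar>c\<bar> *\<^sub>R (LINT x|lborel. ?g (0 + c * x))"
    using c by (intro lborel_integral_real_affine) simp
  also have "\<dots> = of_real (c * sqrt (2 * pi)) * (LINT x|lborel. std_normal_density x *\<^sub>R iexp ((\<omega> * c) * x))"
    unfolding g using c by (simp add: scaleR_conv_of_real)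
  also have "(LINT x|lborel. std_normal_density x *\<^sub>R iexp ((\<omega> * c) * x)) = char std_normal_distribution (\<omega> * c)"
    unfolding char_def by (subst integral_density) auto
  also have "char std_normal_distribution (\<omega> * c) = of_real (exp (- (\<omega>\<^sup>2 / (2 * \<sigma>))))"
    using \<sigma> by (simp add: char_std_normal_distribution c_def power_divide power_mult_distrib)
  also have "c * sqrt (2 * pi) = sqrt (2 * pi / \<sigma>)"
    by (simp add: c_def real_sqrt_divide)
  finally show "(LINT x|lborel. ?g x) = of_real (sqrt (2 * pi / \<sigma>) * exp (- (\<omega>\<^sup>2 / (2 * \<sigma>))))"
    by simp
qed

text \<open>Lebesgue measure is the image of a product measure indexed by \<open>Basis\<close>; the
  bijection \<open>e\<close> from coordinates to basis vectors translates the product over one into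
  a product over the other.\<close>

lemma lborel_vec_integral_prod:
  fixes h :: "'n::finite \<Rightarrow> real \<Rightarrow> complex"
  assumes h: "\<And>j. integrable lborel (h j)"
  shows "integrable lborel (\<lambda>x::real^'n. \<Prod>j\<in>UNIV. h j (x $ j))"
    and "(LINT x|lborel. (\<Prod>j\<in>UNIV. h j ((x::real^'n) $ j))) = (\<Prod>j\<in>UNIV. LINT y|lborel. h j y)"
proof -
  interpret product_sigma_finite "\<lambda>b :: real ^ 'n. lborel :: real measure"
    by (simp add: product_sigma_finite_def sigma_finite_lborel)
  define e :: "'n \<Rightarrow> real ^ 'n" where "e j = axis j 1" for j
  have inj: "inj e" by (auto simp: inj_def e_def axis_eq_axis)
  have B: "(Basis :: (real ^ 'n) set) = range e" by (auto simp: Basis_vec_def e_def)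
  define k where "k b = h (inv e b)" for b
  have ke: "k (e j) = h j" for j using inj by (simp add: k_def)
  have [measurable]: "h j \<in> borel_measurable borel" for j
    using borel_measurable_integrable[OF h[of j]] by simp
  have ej: "e i $ j = (if i = j then 1 else 0)" for i j by (simp add: e_def axis_def)
  have comp: "(\<Sum>b\<in>Basis. f b *\<^sub>R b) $ j = f (e j)" for f :: "real ^ 'n \<Rightarrow> real" and j
    unfolding B by (subst sum.reindex[OF inj]) (simp add: ej if_distrib cong: if_cong)
  have pr: "(\<Prod>j\<in>UNIV. h j ((\<Sum>b\<in>Basis. f b *\<^sub>R b) $ j)) = (\<Prod>b\<in>Basis. k b (f b))" for f :: "real ^ 'n \<Rightarrow> real"
    unfolding comp unfolding B by (subst prod.reindex[OF inj]) (simp add: ke)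
  have kint: "integrable lborel (k b)" for b using h by (simp add: k_def)
  have meas: "(\<lambda>x::real^'n. \<Prod>j\<in>UNIV. h j (x $ j)) \<in> borel_measurable borel"
    by measurable
  have T: "(\<lambda>f. \<Sum>b\<in>Basis. f b *\<^sub>R b) \<in> (\<Pi>\<^sub>M b\<in>(Basis :: (real ^ 'n) set). lborel) \<rightarrow>\<^sub>M borel"
    by measurable
  show "integrable lborel (\<lambda>x::real^'n. \<Prod>j\<in>UNIV. h j (x $ j))"
    by (subst lborel_eq, subst integrable_distr_eq[OF T meas], unfold pr)
      (rule product_integrable_prod[OF finite_Basis kint])
  have "(LINT x|lborel. (\<Prod>j\<in>UNIV. h j ((x::real^'n) $ j))) = (\<Prod>b\<in>Basis. LINT y|lborel. k b y)"
    by (subst lborel_eq, subst integral_distr[OF T meas], unfold pr)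
      (rule product_integral_prod[OF finite_Basis kint])
  also have "\<dots> = (\<Prod>j\<in>UNIV. LINT y|lborel. h j y)"
    unfolding B by (subst prod.reindex[OF inj]) (simp add: ke)
  finally show "(LINT x|lborel. (\<Prod>j\<in>UNIV. h j ((x::real^'n) $ j))) = (\<Prod>j\<in>UNIV. LINT y|lborel. h j y)" .
qed

text \<open>The Lebesgue integral of \<open>gauss s\<close> when all coefficients are
  positive.\<close>

definition gauss_mass :: "real ^ 'n::finite \<Rightarrow> real" where
  "gauss_mass s = (\<Prod>j\<in>UNIV. sqrt (2 * pi / s $ j))"

definition inv_vec :: "real ^ 'n::finite \<Rightarrow> real ^ 'n" where
  "inv_vec s = (\<chi> j. 1 / s $ j)"

lemma cis_sum: "cis (\<Sum>j\<in>A. f j) = (\<Prod>j\<in>A. cis (f j))"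
  by (induction A rule: infinite_finite_induct) (auto simp: cis_mult[symmetric])

lemma gauss_fourier:
  fixes s :: "real ^ 'n::finite"
  assumes s: "\<And>j. 0 < s $ j"
  shows "integrable lborel (\<lambda>u. complex_of_real (gauss s u) * cis (y \<bullet> u))"
    and "(LINT u|lborel. complex_of_real (gauss s u) * cis (y \<bullet> u)) = of_real (gauss_mass s * gauss (inv_vec s) y)"
proof -
  let ?h = "\<lambda>j x. complex_of_real (exp (- (s $ j * x\<^sup>2 / 2))) * cis (y $ j * x)"
  have eq: "complex_of_real (gauss s u) * cis (y \<bullet> u) = (\<Prod>j\<in>UNIV. ?h j (u $ j))" for u
    by (simp add: gauss_def exp_sum sum_negf[symmetric] inner_vec_def cis_sum prod.distrib)
  show "integrable lborel (\<lambda>u. complex_of_real (gauss s u) * cis (y \<bullet> u))"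
    unfolding eq by (intro lborel_vec_integral_prod(1) gauss_fourier_real(1) s)
  have "(LINT u|lborel. complex_of_real (gauss s u) * cis (y \<bullet> u)) = (\<Prod>j\<in>UNIV. LINT x|lborel. ?h j x)"
    unfolding eq by (intro lborel_vec_integral_prod(2) gauss_fourier_real(1) s)
  also have "\<dots> = (\<Prod>j\<in>UNIV. of_real (sqrt (2 * pi / s $ j) * exp (- ((y $ j)\<^sup>2 / (2 * s $ j)))))"
    by (intro prod.cong refl gauss_fourier_real(2) s)
  also have "\<dots> = of_real (gauss_mass s * gauss (inv_vec s) y)"
    by (simp add: gauss_mass_def gauss_def inv_vec_def exp_sum prod.distrib sum_negf[symmetric] mult.commute)
  finally show "(LINT u|lborel. complex_of_real (gauss s u) * cis (y \<bullet> u)) = of_real (gauss_mass s * gauss (inv_vec s) y)" .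
qed

lemma fourier_gauss:
  fixes s :: "real ^ 'n::finite"
  assumes s: "\<And>j. 0 < s $ j"
  shows "fourier (\<lambda>u. complex_of_real (gauss s u)) y
    = of_real ((2 * pi) powr (- real CARD('n) / 2) * gauss_mass s * gauss (inv_vec s) y)"
proof -
  have "(LINT u|lborel. complex_of_real (gauss s u) * cis (- (y \<bullet> u)))
      = (LINT u|lborel. complex_of_real (gauss s u) * cis ((- y) \<bullet> u))" by simp
  also have "\<dots> = of_real (gauss_mass s * gauss (inv_vec s) y)"
    unfolding gauss_fourier(2)[OF s] by (simp add: gauss_def)
  finally show ?thesis
    unfolding fourier_def by (simp add: scaleR_conv_of_real mult.assoc)
qed

lemma gauss_mass_pos: "(\<And>j. 0 < s $ j) \<Longrightarrow> 0 < gauss_mass s"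
  by (simp add: gauss_mass_def prod_pos)

lemma inv_vec_pos: "(\<And>j. 0 < s $ j) \<Longrightarrow> 0 < inv_vec s $ j"
  by (simp add: inv_vec_def)

lemma inv_vec_inv_vec [simp]: "inv_vec (inv_vec s) = s"
  by (simp add: inv_vec_def vec_eq_iff)

lemma gauss_mass_inv_vec:
  fixes s :: "real ^ 'n::finite"
  assumes s: "\<And>j. 0 < s $ j"
  shows "gauss_mass s * gauss_mass (inv_vec s) = (2 * pi) ^ CARD('n)"
proof -
  have "sqrt (2 * pi / s $ j) * sqrt (2 * pi / inv_vec s $ j) = 2 * pi" for j
  proof -
    have "2 * pi / s $ j * (2 * pi / inv_vec s $ j) = (2 * pi)\<^sup>2"
      using s[of j] by (simp add: inv_vec_def power2_eq_square)
    then show ?thesis by (simp only: real_sqrt_mult[symmetric] real_sqrt_abs) simp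
  qed
  then show ?thesis by (simp add: gauss_mass_def prod.distrib[symmetric])
qed

lemma integrable_of_real_gauss:
  fixes s :: "real ^ 'n::finite"
  assumes s: "\<And>j. 0 < s $ j"
  shows "integrable lborel (\<lambda>u. complex_of_real (gauss s u))"
  using gauss_fourier(1)[OF s, of 0] by simp

section \<open>Parseval formulas against Gaussians\<close>

lemma exp_imag_vec: "exp (cdot (imag_vec y) u) = cis (y \<bullet> u)"
  by (simp add: cdot_imag_vec cis_conv_exp)

text \<open>The function is the characteristic function of \<open>nu \<psi> t\<close>, so its
  measurability is that of an integral depending on a parameter.\<close>

lemma borel_measurable_exp_extension:
  assumes \<psi>: "\<psi> \<in> T0_class" and t: "0 \<le> t"
  shows "(\<lambda>y. exp (of_real t * extension \<psi> (imag_vec y))) \<in> borel_measurable borel"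
proof -
  interpret o: orthant_measure "nu \<psi> t" by (rule orthant_measure_nu[OF \<psi> t])
  have "(\<lambda>y. LINT u|nu \<psi> t. cis (y \<bullet> u)) \<in> borel_measurable borel"
  proof (rule o.borel_measurable_lebesgue_integral)
    have "(\<lambda>x. cis (fst x \<bullet> snd x)) \<in> borel_measurable (borel \<Otimes>\<^sub>M borel :: ((real ^ 'a) \<times> (real ^ 'a)) measure)"
      unfolding borel_prod by (intro borel_measurable_continuous_onI continuous_intros)
    then show "(\<lambda>(y, u). cis (y \<bullet> u)) \<in> borel_measurable (borel \<Otimes>\<^sub>M nu \<psi> t)"
      by (simp add: case_prod_beta' measurable_cong_sets[OF sets_pair_measure_cong[OF refl o.sets_eq] refl])
  qed
  then show ?thesis
    using integral_exp_nu[OF \<psi> t imag_vec_left_half] by (simp add: exp_imag_vec)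
qed

text \<open>Fubini for \<open>gauss (inv_vec s) y * cis (y \<bullet> u)\<close>: integrating first
  in \<open>y\<close> gives a multiple of \<open>gauss s u\<close>, integrating first in
  \<open>u\<close> gives the characteristic function.\<close>

lemma integral_gauss_nu:
  fixes \<psi> :: "real ^ 'n::finite \<Rightarrow> real"
  assumes \<psi>: "\<psi> \<in> T0_class" and t: "0 \<le> t" and s: "\<And>j. 0 < s $ j"
  shows "complex_of_real (LINT u|nu \<psi> t. gauss s u) =
    (LINT y|lborel. complex_of_real (gauss (inv_vec s) y) * exp (of_real t * extension \<psi> (imag_vec y)))
      / of_real (gauss_mass (inv_vec s))"
proof -
  interpret o: orthant_measure "nu \<psi> t" by (rule orthant_measure_nu[OF \<psi> t])
  interpret l: sigma_finite_measure "lborel :: (real ^ 'n) measure" by (rule sigma_finite_lborel)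
  interpret P: pair_sigma_finite "lborel :: (real ^ 'n) measure" "nu \<psi> t"
    by unfold_locales
  let ?g = "\<lambda>y. complex_of_real (gauss (inv_vec s) y)"
  have iv: "\<And>j. 0 < inv_vec s $ j" by (rule inv_vec_pos[OF s])
  have meas: "(\<lambda>x. ?g (fst x) * cis (fst x \<bullet> snd x)) \<in> borel_measurable (lborel \<Otimes>\<^sub>M nu \<psi> t)"
  proof -
    have "(\<lambda>x. ?g (fst x) * cis (fst x \<bullet> snd x)) \<in> borel_measurable (borel \<Otimes>\<^sub>M borel :: ((real ^ 'n) \<times> (real ^ 'n)) measure)"
      unfolding borel_prod gauss_def by (intro borel_measurable_continuous_onI continuous_intros) auto
    then show ?thesis
      by (simp add: measurable_cong_sets[OF sets_pair_measure_cong[OF sets_lborel o.sets_eq] refl])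
  qed
  have int: "integrable (lborel \<Otimes>\<^sub>M nu \<psi> t) (\<lambda>(y, u). ?g y * cis (y \<bullet> u))"
  proof (rule P.Fubini_integrable)
    show "(\<lambda>(y, u). ?g y * cis (y \<bullet> u)) \<in> borel_measurable (lborel \<Otimes>\<^sub>M nu \<psi> t)"
      using meas by (simp add: case_prod_beta')
    have "(LINT u|nu \<psi> t. norm (?g y * cis (y \<bullet> u))) = norm (?g y)" for y
      using prob_space.prob_space[OF prob_space_nu[OF \<psi> t]] by (simp add: norm_mult)
    then show "integrable lborel (\<lambda>y. LINT u|nu \<psi> t. norm (case (y, u) of (y, u) \<Rightarrow> ?g y * cis (y \<bullet> u)))"
      using integrable_norm[OF integrable_of_real_gauss[OF iv]] by simp
    have "integrable (nu \<psi> t) (\<lambda>u. ?g y * cis (y \<bullet> u))" for y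
    proof (intro integrable_mult_right)
      have "(\<lambda>u. cis (y \<bullet> u)) \<in> borel_measurable borel"
        by (intro borel_measurable_continuous_onI continuous_intros)
      then show "integrable (nu \<psi> t) (\<lambda>u. cis (y \<bullet> u))"
        by (intro o.integrable_const_bound[where B=1]) (auto simp: measurable_cong_sets[OF o.sets_eq refl])
    qed
    then show "AE y in lborel. integrable (nu \<psi> t) (\<lambda>u. case (y, u) of (y, u) \<Rightarrow> ?g y * cis (y \<bullet> u))"
      by simp
  qed
  have "(LINT y|lborel. ?g y * exp (of_real t * extension \<psi> (imag_vec y)))
      = (LINT y|lborel. LINT u|nu \<psi> t. ?g y * cis (y \<bullet> u))"
    using integral_exp_nu[OF \<psi> t imag_vec_left_half] by (simp add: exp_imag_vec)
  also have "\<dots> = (LINT u|nu \<psi> t. LINT y|lborel. ?g y * cis (y \<bullet> u))"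
    by (rule P.Fubini_integral[OF int, symmetric])
  also have "\<dots> = (LINT u|nu \<psi> t. complex_of_real (gauss_mass (inv_vec s) * gauss s u))"
  proof (intro Bochner_Integration.integral_cong refl)
    fix u
    show "(LINT y|lborel. ?g y * cis (y \<bullet> u)) = complex_of_real (gauss_mass (inv_vec s) * gauss s u)"
      using gauss_fourier(2)[OF iv, of u] by (simp add: inner_commute)
  qed
  also have "\<dots> = of_real (gauss_mass (inv_vec s)) * of_real (LINT u|nu \<psi> t. gauss s u)"
    by simp
  finally show ?thesis using gauss_mass_pos[OF iv] by simp
qed

text \<open>The factor accounts for the symmetric normalisation of the Fourier transform. The real
  part is taken because integrals of real functions against \<open>nu\<close> are real, and so are
  their derivatives.\<close>

definition density_fn :: "(real ^ 'n::finite \<Rightarrow> complex) \<Rightarrow> real ^ 'n \<Rightarrow> real" where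
  "density_fn p u = (2 * pi) powr (- real CARD('n) / 2) * Re (p u)"

text \<open>The distributional identity tested at a Gaussian. The two normalising factors and
  \<open>gauss_mass s\<close> combine to \<open>1 / gauss_mass (inv_vec s)\<close>, the constant
  that occurs in \<open>integral_gauss_nu\<close>.\<close>

lemma integral_gauss_density:
  fixes F p :: "real ^ 'n::finite \<Rightarrow> complex"
  assumes ft: "has_fourier_transform F p" and p: "integrable lborel p" and s: "\<And>j. 0 < s $ j"
  shows "(LINT u|lborel. gauss s u * density_fn p u)
    = Re ((LINT y|lborel. F y * of_real (gauss (inv_vec s) y)) / of_real (gauss_mass (inv_vec s)))"
proof -
  let ?c = "(2 * pi) powr (- real CARD('n) / 2)"
  have iv: "\<And>j. 0 < inv_vec s $ j" by (rule inv_vec_pos[OF s])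
  have S: "(\<lambda>u. complex_of_real (gauss s u)) \<in> schwartz" by (rule gauss_schwartz[OF s])
  have int: "integrable lborel (\<lambda>u. p u * complex_of_real (gauss s u))"
    using ft S by (simp add: has_fourier_transform_def)
  have "(LINT u|lborel. gauss s u * density_fn p u) = ?c * (LINT u|lborel. Re (p u * complex_of_real (gauss s u)))"
    unfolding density_fn_def by (subst integral_mult_right_zero[symmetric]) (simp add: mult_ac)
  also have "\<dots> = ?c * Re (LINT u|lborel. p u * complex_of_real (gauss s u))"
    by (simp only: integral_Re[OF int])
  also have "(LINT u|lborel. p u * complex_of_real (gauss s u))
      = (LINT y|lborel. F y * fourier (\<lambda>u. complex_of_real (gauss s u)) y)"
    using ft S by (simp add: has_fourier_transform_def)
  also have "\<dots> = of_real (?c * gauss_mass s) * (LINT y|lborel. F y * of_real (gauss (inv_vec s) y))"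
    unfolding fourier_gauss[OF s] by (subst integral_mult_right_zero[symmetric]) (simp add: mult_ac)
  finally have "(LINT u|lborel. gauss s u * density_fn p u)
      = (?c * ?c * gauss_mass s) * Re (LINT y|lborel. F y * of_real (gauss (inv_vec s) y))"
    by (simp add: mult_ac)
  moreover have "?c * ?c * gauss_mass s = 1 / gauss_mass (inv_vec s)"
  proof -
    have "?c * ?c = (2 * pi) powr (- real CARD('n))" by (simp add: powr_add[symmetric])
    also have "\<dots> = 1 / (2 * pi) ^ CARD('n)" by (simp add: powr_minus powr_realpow divide_inverse)
    also have "\<dots> = 1 / (gauss_mass s * gauss_mass (inv_vec s))"
      by (simp only: gauss_mass_inv_vec[OF s])
    finally have cc: "?c * ?c = 1 / (gauss_mass s * gauss_mass (inv_vec s))" .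
    show ?thesis unfolding cc using gauss_mass_pos[OF s] by simp
  qed
  ultimately show ?thesis by (simp add: Re_divide_of_real)
qed

text \<open>For \<open>Re w \<le> 0\<close> moduli decrease in time. Hence the function at half
  time, which becomes \<open>F_fun \<psi> (t / 2)\<close>, dominates all difference quotients near
  \<open>t\<close>.\<close>

lemma norm_exp_difference_le:
  fixes w :: complex
  assumes w: "Re w \<le> 0" and s: "t / 2 \<le> s" and t: "t / 2 \<le> t'"
  shows "norm (exp (of_real s * w) - exp (of_real t' * w)) \<le> \<bar>s - t'\<bar> * norm (exp (of_real (t / 2) * w) * w)"
proof -
  have main: "norm (exp (of_real b * w) - exp (of_real a * w)) \<le> (b - a) * norm (exp (of_real (t / 2) * w) * w)"
    if "a \<le> b" "t / 2 \<le> a" for a b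
  proof -
    have "exp (of_real b * w) - exp (of_real a * w) = exp (of_real a * w) * (exp (of_real (b - a) * w) - 1)"
      by (simp add: right_diff_distrib flip: exp_add) (simp add: algebra_simps)
    then have "norm (exp (of_real b * w) - exp (of_real a * w)) = exp (a * Re w) * norm (exp (of_real (b - a) * w) - 1)"
      by (simp add: norm_mult)
    also have "\<dots> \<le> exp (t / 2 * Re w) * ((b - a) * norm w)"
    proof (intro mult_mono)
      show "exp (a * Re w) \<le> exp (t / 2 * Re w)"
        unfolding exp_le_cancel_iff by (rule mult_right_mono_neg[OF that(2) w])
      have "norm (of_real (b - a) * w) = (b - a) * norm w"
        using that by (simp only: norm_mult norm_of_real)
      moreover have "Re (of_real (b - a) * w) \<le> 0"
        using that w by (simp add: mult_nonneg_nonpos)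
      ultimately show "norm (exp (of_real (b - a) * w) - 1) \<le> (b - a) * norm w"
        by (metis norm_exp_minus_1_le)
    qed auto
    finally show ?thesis by (simp add: norm_mult mult_ac)
  qed
  show ?thesis
  proof (cases "s \<le> t'")
    case True
    then show ?thesis using main[of s t'] s by (simp add: norm_minus_commute)
  next
    case False
    then show ?thesis using main[of t' s] t by simp
  qed
qed

text \<open>Differentiation under the integral over the imaginary axis, between the two Parseval
  formulas. The dominating function is \<open>F_fun \<psi> (t / 2)\<close> times a Gaussian,
  integrable because \<open>F_fun\<close> pairs with Schwartz functions.\<close>

theorem derivative_integral_gauss_nu:
  fixes \<psi> :: "real ^ 'n::finite \<Rightarrow> real" and p :: "real \<Rightarrow> real ^ 'n \<Rightarrow> complex"
  assumes \<psi>: "\<psi> \<in> T0_class"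
    and ft: "\<And>t. t > 0 \<Longrightarrow> has_fourier_transform (F_fun \<psi> t) (p t)"
    and p: "\<And>t. t > 0 \<Longrightarrow> integrable lborel (p t)"
    and s: "\<And>j. 0 < s $ j" and t: "0 < t"
  shows "((\<lambda>t. LINT u|nu \<psi> t. gauss s u) has_real_derivative
    (LINT u|lborel. gauss s u * density_fn (p t) u)) (at t)"
proof -
  let ?g = "\<lambda>y. complex_of_real (gauss (inv_vec s) y)"
  let ?w = "\<lambda>y. extension \<psi> (imag_vec y)"
  let ?K = "gauss_mass (inv_vec s)"
  have iv: "\<And>j. 0 < inv_vec s $ j" by (rule inv_vec_pos[OF s])
  have Rew: "Re (?w y) \<le> 0" for y by (rule Re_extension_le[OF \<psi> imag_vec_left_half])
  have intF: "integrable lborel (\<lambda>y. F_fun \<psi> r y * ?g y)" if "r > 0" for r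
    using ft[OF that] gauss_schwartz[OF iv] by (simp add: has_fourier_transform_def)
  define E where "E r = (LINT y|lborel. ?g y * exp (of_real r * ?w y))" for r
  have em: "(\<lambda>y. ?g y * exp (of_real r * ?w y)) \<in> borel_measurable lborel" if "0 \<le> r" for r
    using borel_measurable_exp_extension[OF \<psi> that] by simp
  have ei: "integrable lborel (\<lambda>y. ?g y * exp (of_real r * ?w y))" if "0 \<le> r" for r
  proof (rule Bochner_Integration.integrable_bound[OF integrable_of_real_gauss[OF iv] em[OF that]])
    show "AE y in lborel. norm (?g y * exp (of_real r * ?w y)) \<le> norm (?g y)"
      using Rew that by (auto simp: norm_mult mult_nonneg_nonpos intro!: mult_left_le)
  qed
  have "((\<lambda>h. (E (t + h) - E t) / of_real h) \<longlongrightarrow> (LINT y|lborel. F_fun \<psi> t y * ?g y)) (at 0)"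
    unfolding tendsto_at_iff_sequentially
  proof (intro allI impI)
    fix X :: "nat \<Rightarrow> real" assume X0: "\<forall>i. X i \<in> UNIV - {0}" and X: "X \<longlonglongrightarrow> 0"
    have "\<forall>\<^sub>F k in sequentially. \<bar>X k\<bar> < t / 2"
      using X t by (intro order_tendstoD(2)[of _ 0]) (auto intro: tendsto_rabs_zero)
    then obtain N where N: "\<And>k. k \<ge> N \<Longrightarrow> \<bar>X k\<bar> < t / 2" by (auto simp: eventually_sequentially)
    \<comment> \<open>Dropping finitely many terms keeps all times above \<open>t / 2\<close>, as
      the domination requires.\<close>
    define Y where "Y k = X (k + N)" for k
    have Y0: "Y k \<noteq> 0" and Yt: "\<bar>Y k\<bar> < t / 2" for k using X0 N[of "k + N"] by (auto simp: Y_def)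
    have Y: "Y \<longlonglongrightarrow> 0" unfolding Y_def using X by (rule LIMSEQ_ignore_initial_segment)
    let ?q = "\<lambda>k y. (?g y * exp (of_real (t + Y k) * ?w y) - ?g y * exp (of_real t * ?w y)) / of_real (Y k)"
    have nn: "0 \<le> t + Y k" for k using Yt[of k] t by (auto simp: abs_less_iff)
    have "(\<lambda>k. LINT y|lborel. ?q k y) \<longlonglongrightarrow> (LINT y|lborel. F_fun \<psi> t y * ?g y)"
    proof (rule integral_dominated_convergence[where w="\<lambda>y. norm (F_fun \<psi> (t / 2) y * ?g y)"])
      show "(\<lambda>y. F_fun \<psi> t y * ?g y) \<in> borel_measurable lborel"
        using intF[OF t] by (rule borel_measurable_integrable)
      show "?q k \<in> borel_measurable lborel" for k
        using em[OF nn[of k]] em[of t] t by simp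
      show "integrable lborel (\<lambda>y. norm (F_fun \<psi> (t / 2) y * ?g y))"
        using intF[of "t / 2"] t by simp
      show "AE y in lborel. (\<lambda>k. ?q k y) \<longlonglongrightarrow> F_fun \<psi> t y * ?g y"
      proof (intro AE_I2)
        fix y
        have "((\<lambda>r. exp (r * ?w y)) has_field_derivative ?w y * exp (of_real t * ?w y)) (at (of_real t))"
          by (auto intro!: derivative_eq_intros)
        then have "((\<lambda>h. (exp ((of_real t + h) * ?w y) - exp (of_real t * ?w y)) / h) \<longlongrightarrow> ?w y * exp (of_real t * ?w y)) (at 0)"
          by (simp add: DERIV_def)
        moreover have "filterlim (\<lambda>k. complex_of_real (Y k)) (at 0) sequentially"
          unfolding filterlim_at using Y0 tendsto_of_real[OF Y] by simp
        ultimately have "(\<lambda>k. (exp ((of_real t + of_real (Y k)) * ?w y) - exp (of_real t * ?w y)) / of_real (Y k))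
            \<longlonglongrightarrow> ?w y * exp (of_real t * ?w y)"
          by (rule filterlim_compose)
        then have "(\<lambda>k. ?g y * ((exp ((of_real t + of_real (Y k)) * ?w y) - exp (of_real t * ?w y)) / of_real (Y k)))
            \<longlonglongrightarrow> ?g y * (?w y * exp (of_real t * ?w y))"
          by (intro tendsto_mult tendsto_const)
        then show "(\<lambda>k. ?q k y) \<longlonglongrightarrow> F_fun \<psi> t y * ?g y"
          by (simp add: F_fun_def right_diff_distrib mult_ac)
      qed
      show "AE y in lborel. norm (?q k y) \<le> norm (F_fun \<psi> (t / 2) y * ?g y)" for k
      proof (intro AE_I2)
        fix y
        have "norm (exp (of_real (t + Y k) * ?w y) - exp (of_real t * ?w y)) \<le> \<bar>t + Y k - t\<bar> * norm (exp (of_real (t / 2) * ?w y) * ?w y)"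
          using Yt[of k] t by (intro norm_exp_difference_le Rew) auto
        then have "norm (?g y) * norm (exp (of_real (t + Y k) * ?w y) - exp (of_real t * ?w y))
            \<le> norm (?g y) * (\<bar>Y k\<bar> * norm (F_fun \<psi> (t / 2) y))"
          by (intro mult_left_mono) (auto simp: F_fun_def)
        moreover have "norm (?q k y) = norm (?g y) * norm (exp (of_real (t + Y k) * ?w y) - exp (of_real t * ?w y)) / \<bar>Y k\<bar>"
          by (simp only: right_diff_distrib[symmetric] norm_divide norm_mult norm_of_real)
        ultimately show "norm (?q k y) \<le> norm (F_fun \<psi> (t / 2) y * ?g y)"
          using Y0[of k] by (simp add: divide_le_eq norm_mult mult_ac)
      qed
    qed
    moreover have eq: "(LINT y|lborel. ?q k y) = (E (t + Y k) - E t) / of_real (Y k)" for k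
      unfolding E_def using ei[OF nn[of k]] ei[of t] t by simp
    ultimately have "(\<lambda>k. (E (t + Y k) - E t) / of_real (Y k)) \<longlonglongrightarrow> (LINT y|lborel. F_fun \<psi> t y * ?g y)"
      by (simp only: eq)
    then show "((\<lambda>h. (E (t + h) - E t) / of_real h) \<circ> X) \<longlonglongrightarrow> (LINT y|lborel. F_fun \<psi> t y * ?g y)"
      unfolding o_def Y_def by (rule LIMSEQ_offset)
  qed
  then have "((\<lambda>h. Re ((E (t + h) - E t) / of_real h / of_real ?K)) \<longlongrightarrow>
      Re ((LINT y|lborel. F_fun \<psi> t y * ?g y) / of_real ?K)) (at 0)"
    using gauss_mass_pos[OF iv] by (intro tendsto_intros) auto
  then have lim: "((\<lambda>h. Re ((E (t + h) - E t) / of_real h / of_real ?K)) \<longlongrightarrow> (LINT u|lborel. gauss s u * density_fn (p t) u)) (at 0)"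
    unfolding integral_gauss_density[OF ft[OF t] p[OF t] s] .
  have nuE: "(LINT u|nu \<psi> r. gauss s u) = Re (E r / of_real ?K)" if "0 \<le> r" for r
    unfolding E_def integral_gauss_nu[OF \<psi> that s, symmetric] by simp
  \<comment> \<open>\<open>nuE\<close> covers nonnegative times only, so the difference quotients
    are compared for small \<open>h\<close>.\<close>
  have "\<forall>\<^sub>F h in at 0. -t < h"
    using t by (intro order_tendstoD(1)[OF tendsto_ident_at]) simp
  then have "\<forall>\<^sub>F h in at 0. Re ((E (t + h) - E t) / of_real h / of_real ?K)
      = ((LINT u|nu \<psi> (t + h). gauss s u) - (LINT u|nu \<psi> t. gauss s u)) / h"
  proof eventually_elim
    case (elim h)
    then show ?case
      using t by (simp add: nuE Re_divide_of_real diff_divide_distrib mult.commute)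
  qed
  then show ?thesis
    unfolding DERIV_def using lim by (rule Lim_transform_eventually[rotated])
qed

section \<open>Differentiation of the subordinator\<close>

locale orthant_density =
  fixes q :: "real ^ 'n::finite \<Rightarrow> real"
  assumes integrable_q: "integrable lborel q"
    and AE_q: "AE u in lborel. u \<notin> nonneg_orthant \<longrightarrow> q u = 0"
begin

lemma q_meas [measurable]: "q \<in> borel_measurable borel"
  using borel_measurable_integrable[OF integrable_q] by simp

lemma orthant_measure_density:
  assumes f: "integrable lborel f" "\<And>u. 0 \<le> f u" "\<And>u. q u = 0 \<Longrightarrow> f u = 0"
  shows "orthant_measure (density lborel (\<lambda>u. ennreal (f u)))"
    and "measure (density lborel (\<lambda>u. ennreal (f u))) UNIV = (LINT u|lborel. f u)"
proof -
  have [measurable]: "f \<in> borel_measurable borel"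
    using borel_measurable_integrable[OF f(1)] by simp
  have e: "emeasure (density lborel (\<lambda>u. ennreal (f u))) UNIV = ennreal (LINT u|lborel. f u)"
    using nn_integral_eq_integral[OF f(1)] f(2) by (simp add: emeasure_density)
  then show "measure (density lborel (\<lambda>u. ennreal (f u))) UNIV = (LINT u|lborel. f u)"
    by (simp add: measure_def f(2))
  have "finite_measure (density lborel (\<lambda>u. ennreal (f u)))"
    by (rule finite_measureI) (simp add: e)
  moreover have "AE u in density lborel (\<lambda>u. ennreal (f u)). u \<in> nonneg_orthant"
  proof (subst AE_density)
    show "AE u in lborel. 0 < ennreal (f u) \<longrightarrow> u \<in> nonneg_orthant"
      using AE_q by eventually_elim (use f(3) in fastforce)
  qed simp
  ultimately show "orthant_measure (density lborel (\<lambda>u. ennreal (f u)))"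
    by (simp add: orthant_measure_def orthant_measure_axioms_def)
qed

definition pos_measure :: "(real ^ 'n) measure" where
  "pos_measure = density lborel (\<lambda>u. ennreal (max 0 (q u)))"

definition neg_measure :: "(real ^ 'n) measure" where
  "neg_measure = density lborel (\<lambda>u. ennreal (max 0 (- q u)))"

lemma integrable_parts:
  "integrable lborel (\<lambda>u. max 0 (q u))" "integrable lborel (\<lambda>u. max 0 (- q u))"
  using integrable_max[OF integrable_zero integrable_q]
    integrable_max[OF integrable_zero integrable_minus[OF integrable_q]] by simp_all

sublocale pos: orthant_measure pos_measure
  unfolding pos_measure_def by (rule orthant_measure_density[OF integrable_parts(1)]) auto

sublocale neg: orthant_measure neg_measure
  unfolding neg_measure_def by (rule orthant_measure_density[OF integrable_parts(2)]) auto

text \<open>The integral against the signed measure with density \<open>q\<close>, through its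
  Jordan decomposition, so that everything known for positive measures applies to both
  parts.\<close>

definition density_integral :: "(real ^ 'n \<Rightarrow> 'x::banach) \<Rightarrow> 'x" where
  "density_integral f = orthant_integral pos_measure f
     - orthant_integral neg_measure f"

definition mass :: real where
  "mass = (LINT u|lborel. \<bar>q u\<bar>)"

lemma mass_nonneg: "0 \<le> mass"
  by (simp add: mass_def)

lemma mass_eq:
  "mass = measure pos_measure UNIV
    + measure neg_measure UNIV"
proof -
  have "mass = (LINT u|lborel. max 0 (q u) + max 0 (- q u))"
    unfolding mass_def by (intro Bochner_Integration.integral_cong) auto
  also have "\<dots> = (LINT u|lborel. max 0 (q u)) + (LINT u|lborel. max 0 (- q u))"
    by (rule Bochner_Integration.integral_add[OF integrable_parts])
  finally show ?thesis
    unfolding pos_measure_def neg_measure_def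
    by (subst (1 2) orthant_measure_density(2)) (auto intro: integrable_parts simp del: ennreal_max_0 ennreal_max_0')
qed

lemma density_integral_diff:
  fixes f g :: "real ^ 'n \<Rightarrow> 'x::banach"
  assumes "orthant_bcont f" "orthant_bcont g"
  shows "density_integral (\<lambda>u. f u - g u) = density_integral f - density_integral g"
  unfolding density_integral_def
  by (simp add: pos.orthant_integral_diff neg.orthant_integral_diff assms)

lemma density_integral_bounded_linear:
  fixes f :: "real ^ 'n \<Rightarrow> 'x::banach" and L :: "'x \<Rightarrow> 'y::banach"
  assumes "bounded_linear L" "orthant_bcont f"
  shows "density_integral (\<lambda>u. L (f u)) = L (density_integral f)"
  unfolding density_integral_def
  by (simp add: pos.orthant_integral_bounded_linear[OF assms] neg.orthant_integral_bounded_linear[OF assms]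
    linear_diff[OF bounded_linear.linear[OF assms(1)]])

lemma density_integral_sum:
  fixes f :: "'i \<Rightarrow> real ^ 'n \<Rightarrow> 'x::banach"
  assumes "\<And>i. i \<in> I \<Longrightarrow> orthant_bcont (f i)"
  shows "density_integral (\<lambda>u. \<Sum>i\<in>I. f i u) = (\<Sum>i\<in>I. density_integral (f i))"
  unfolding density_integral_def
  by (simp add: pos.orthant_integral_sum neg.orthant_integral_sum assms sum_subtractf)

lemma norm_density_integral_le:
  fixes f :: "real ^ 'n \<Rightarrow> 'x::banach"
  assumes f: "orthant_bcont f" and B: "\<And>u. u \<in> nonneg_orthant \<Longrightarrow> norm (f u) \<le> B"
  shows "norm (density_integral f) \<le> mass * B"
  using pos.norm_orthant_integral_le_bound[OF f B] neg.norm_orthant_integral_le_bound[OF f B]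
    norm_triangle_ineq4[of "orthant_integral pos_measure f"
      "orthant_integral neg_measure f"]
  unfolding density_integral_def mass_eq distrib_right by linarith

lemma density_integral_tendsto:
  fixes f :: "real ^ 'n \<Rightarrow> 'x::banach" and F :: "nat \<Rightarrow> real ^ 'n \<Rightarrow> 'x"
  assumes "\<And>k. orthant_bcont (F k)" "orthant_bcont f"
    and "\<And>u. u \<in> nonneg_orthant \<Longrightarrow> (\<lambda>k. F k u) \<longlonglongrightarrow> f u"
    and "\<And>k u. u \<in> nonneg_orthant \<Longrightarrow> norm (F k u) \<le> B"
  shows "(\<lambda>k. density_integral (F k)) \<longlonglongrightarrow> density_integral f"
  unfolding density_integral_def
  by (intro tendsto_diff pos.orthant_integral_tendsto[OF assms] neg.orthant_integral_tendsto[OF assms])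

lemma density_integral_real:
  fixes \<phi> :: "real ^ 'n \<Rightarrow> real"
  assumes \<phi>: "orthant_bcont \<phi>" and [measurable]: "\<phi> \<in> borel_measurable borel"
    and B: "\<And>u. \<bar>\<phi> u\<bar> \<le> B"
  shows "density_integral \<phi> = (LINT u|lborel. \<phi> u * q u)"
proof -
  have B0: "0 \<le> B" using B[of 0] by linarith
  have i: "integrable lborel (\<lambda>u. max 0 (q u) * \<phi> u)" "integrable lborel (\<lambda>u. max 0 (- q u) * \<phi> u)"
    by (rule Bochner_Integration.integrable_bound[where f="\<lambda>u. B * q u"],
        auto intro!: integrable_q AE_I2 simp: abs_mult B0 mult_mono B mult.commute[of B])+
  have "density_integral \<phi> = (LINT u|lborel. max 0 (q u) * \<phi> u) - (LINT u|lborel. max 0 (- q u) * \<phi> u)"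
    unfolding density_integral_def pos.integral_orthant(1)[OF assms(1,2)] neg.integral_orthant(1)[OF assms(1,2)]
    unfolding pos_measure_def neg_measure_def by (subst (1 2) integral_density) auto
  also have "\<dots> = (LINT u|lborel. max 0 (q u) * \<phi> u - max 0 (- q u) * \<phi> u)"
    by (rule Bochner_Integration.integral_diff[OF i, symmetric])
  also have "\<dots> = (LINT u|lborel. \<phi> u * q u)"
    by (intro Bochner_Integration.integral_cong) (auto simp: max_def)
  finally show ?thesis .
qed

end

section \<open>The time derivative of the laws\<close>

lemma gauss_nonneg_le_1: "(\<And>j. 0 \<le> s $ j) \<Longrightarrow> 0 \<le> gauss s u \<and> gauss s u \<le> 1"
  by (simp add: gauss_def sum_nonneg)

abbreviation nu_integral :: "(real ^ 'n::finite \<Rightarrow> real) \<Rightarrow> real \<Rightarrow> (real ^ 'n \<Rightarrow> 'x::banach) \<Rightarrow> 'x" where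
  "nu_integral \<psi> t f \<equiv> orthant_integral (nu \<psi> t) f"

text \<open>What the later argument keeps of the Fourier hypothesis: derivatives against Gaussians
  and a bound on the mass of the densities. The limsup controls small times only, hence
  \<open>\<delta>\<close>.\<close>

locale nu_derivative =
  fixes \<psi> :: "real ^ 'n::finite \<Rightarrow> real" and q :: "real \<Rightarrow> real ^ 'n \<Rightarrow> real" and J :: "real \<Rightarrow> real" and \<delta> C :: real
  assumes \<psi>: "\<psi> \<in> T0_class"
    and density: "\<And>t. 0 < t \<Longrightarrow> orthant_density (q t)"
    and mass_le: "\<And>t. 0 < t \<Longrightarrow> orthant_density.mass (q t) \<le> J t"
    and \<delta>: "0 < \<delta>" and J_bound: "\<And>t. 0 < t \<Longrightarrow> t < \<delta> \<Longrightarrow> t * J t \<le> C"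
    and gauss_derivative: "\<And>s t. (\<And>j. 0 < s $ j) \<Longrightarrow> 0 < t \<Longrightarrow>
      ((\<lambda>t. LINT u|nu \<psi> t. gauss s u) has_real_derivative (LINT u|lborel. gauss s u * q t u)) (at t)"
begin

abbreviation q_integral :: "real \<Rightarrow> (real ^ 'n \<Rightarrow> 'x::banach) \<Rightarrow> 'x" where
  "q_integral t f \<equiv> orthant_density.density_integral (q t) f"

lemma J_nonneg: "0 < t \<Longrightarrow> 0 \<le> J t"
  using mass_le[of t] orthant_density.mass_nonneg[OF density, of t] by linarith

abbreviation gauss_sum :: "nat \<Rightarrow> (('n \<Rightarrow> nat) \<Rightarrow> 'x) \<Rightarrow> real ^ 'n \<Rightarrow> 'x::real_vector" where
  "gauss_sum N c u \<equiv> (\<Sum>m\<in>exponents N. gauss (nat_vec m) u *\<^sub>R c m)"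

lemma orthant_bcont_gauss_sum:
  fixes c :: "('n \<Rightarrow> nat) \<Rightarrow> 'x::real_normed_vector"
  shows "orthant_bcont (gauss_sum N c)"
  by (intro orthant_bcont_sum orthant_bcont_scaleR orthant_bcont_gauss orthant_bcont_const) simp

lemma nu_integral_gauss_sum_derivative:
  fixes c :: "('n \<Rightarrow> nat) \<Rightarrow> 'x::banach"
  assumes t: "0 < t"
  shows "((\<lambda>t. nu_integral \<psi> t (gauss_sum N c)) has_vector_derivative q_integral t (gauss_sum N c)) (at t)"
proof -
  interpret q: orthant_density "q t" by (rule density[OF t])
  have bc: "orthant_bcont (gauss (nat_vec m :: real ^ 'n))" for m
    by (rule orthant_bcont_gauss) simp
  have qm: "q_integral t (\<lambda>u. gauss (nat_vec m) u *\<^sub>R c m) = (LINT u|lborel. gauss (nat_vec m) u * q t u) *\<^sub>R c m" for m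
  proof -
    have "q_integral t (gauss (nat_vec m)) = (LINT u|lborel. gauss (nat_vec m) u * q t u)"
      using gauss_nonneg_le_1[of "nat_vec m :: real ^ 'n"] by (intro q.density_integral_real[where B=1] bc) auto
    then show ?thesis
      using q.density_integral_bounded_linear[OF bounded_linear_scaleR_left bc, of m "c m"] by simp
  qed
  have num: "nu_integral \<psi> r (gauss_sum N c) = (\<Sum>m\<in>exponents N. (LINT u|nu \<psi> r. gauss (nat_vec m) u) *\<^sub>R c m)"
    if "0 \<le> r" for r
  proof -
    interpret o: orthant_measure "nu \<psi> r" by (rule orthant_measure_nu[OF \<psi> that])
    show ?thesis
      by (subst o.orthant_integral_sum)
        (auto intro!: orthant_bcont_scaleR bc orthant_bcont_const simp: o.orthant_integral_scaleR[OF bc] o.integral_orthant(1)[OF bc])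
  qed
  have "((\<lambda>t. \<Sum>m\<in>exponents N. (LINT u|nu \<psi> t. gauss (nat_vec m) u) *\<^sub>R c m) has_vector_derivative
      (\<Sum>m\<in>exponents N. (LINT u|lborel. gauss (nat_vec m) u * q t u) *\<^sub>R c m)) (at t)"
  proof (rule has_vector_derivative_sum)
    fix m :: "'n \<Rightarrow> nat" assume "m \<in> exponents N"
    then have "\<And>j. 0 < (nat_vec m :: real ^ 'n) $ j" by (auto simp: PiE_iff Suc_le_eq)
    then have "((\<lambda>t. LINT u|nu \<psi> t. gauss (nat_vec m) u) has_real_derivative (LINT u|lborel. gauss (nat_vec m) u * q t u)) (at t)"
      by (rule gauss_derivative[OF _ t])
    from has_vector_derivative_scaleR[OF this has_vector_derivative_const[of "c m"]]
    show "((\<lambda>t. (LINT u|nu \<psi> t. gauss (nat_vec m) u) *\<^sub>R c m) has_vector_derivative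
        (LINT u|lborel. gauss (nat_vec m) u * q t u) *\<^sub>R c m) (at t)" by simp
  qed
  also have "(\<Sum>m\<in>exponents N. (LINT u|lborel. gauss (nat_vec m) u * q t u) *\<^sub>R c m) = q_integral t (gauss_sum N c)"
    by (subst q.density_integral_sum) (auto intro!: orthant_bcont_scaleR bc orthant_bcont_const simp: qm)
  finally show ?thesis
    by (rule has_vector_derivative_transform_within_open[where S="{0<..}"]) (use t num in auto)
qed

text \<open>Termwise differentiation of a sequence: uniform approximation of \<open>f\<close> by
  Gaussian sums makes the derivatives converge uniformly in time, because the masses of the
  densities have a common bound on \<open>S\<close>.\<close>

theorem nu_integral_C0_derivative:
  fixes f :: "real ^ 'n \<Rightarrow> 'x::banach"
  assumes f: "orthant_bcont f" and f0: "orthant_C0 f" and t: "0 < t" "t < \<delta>"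
  shows "((\<lambda>t. nu_integral \<psi> t f) has_vector_derivative q_integral t f) (at t)"
proof -
  \<comment> \<open>Staying above \<open>t / 2\<close> keeps the bound \<open>C / r\<close> on the
    masses below the constant \<open>D\<close>.\<close>
  define S where "S = {t / 2<..<\<delta>}"
  have tS: "t \<in> S" using t by (simp add: S_def)
  have S: "0 < r" "0 \<le> r" if "r \<in> S" for r using that t by (auto simp: S_def)
  have "\<exists>x. \<forall>u\<in>nonneg_orthant. norm (f u - gauss_sum (fst x) (snd x) u) \<le> 1 / real (Suc k)" for k
  proof -
    have k: "1 / real (Suc k) > 0" by simp
    obtain N c where "\<And>u. u \<in> nonneg_orthant \<Longrightarrow> norm (f u - gauss_sum N c u) \<le> 1 / real (Suc k)"
      using gauss_approximation[OF f0 k] by blast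
    then show ?thesis by (intro exI[of _ "(N, c)"]) auto
  qed
  then obtain x where x: "\<And>k. \<forall>u\<in>nonneg_orthant. norm (f u - gauss_sum (fst (x k)) (snd (x k)) u) \<le> 1 / real (Suc k)"
    using choice[of "\<lambda>k x. \<forall>u\<in>nonneg_orthant. norm (f u - gauss_sum (fst x) (snd x) u) \<le> 1 / real (Suc k)"] by blast
  define g where "g k = gauss_sum (fst (x k)) (snd (x k))" for k
  have gb: "orthant_bcont (g k)" for k unfolding g_def by (rule orthant_bcont_gauss_sum)
  have gf: "norm (g k u - f u) \<le> 1 / real (Suc k)" if "u \<in> nonneg_orthant" for k u
    using x that by (simp add: g_def norm_minus_commute)
  have lim0: "(\<lambda>k. 1 / real (Suc k)) \<longlonglongrightarrow> 0"
    using LIMSEQ_inverse_real_of_nat by (simp add: inverse_eq_divide)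
  have conv: "(\<lambda>k. nu_integral \<psi> r (g k)) \<longlonglongrightarrow> nu_integral \<psi> r f" if "r \<in> S" for r
  proof -
    interpret o: orthant_measure "nu \<psi> r" by (rule orthant_measure_nu[OF \<psi> S(2)[OF that]])
    have m1: "measure (nu \<psi> r) UNIV = 1"
      using prob_space.prob_space[OF prob_space_nu[OF \<psi> S(2)[OF that]]] by simp
    have "(\<lambda>k. nu_integral \<psi> r (g k) - nu_integral \<psi> r f) \<longlonglongrightarrow> 0"
    proof (rule Lim_null_comparison[OF _ lim0], intro always_eventually allI)
      fix k
      show "norm (nu_integral \<psi> r (g k) - nu_integral \<psi> r f) \<le> 1 / real (Suc k)"
        using o.norm_orthant_integral_le_bound[OF orthant_bcont_diff[OF gb f] gf]
        unfolding o.orthant_integral_diff[OF gb f] m1 by simp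
    qed
    then show ?thesis by (simp add: LIM_zero_iff)
  qed
  have der: "((\<lambda>t. nu_integral \<psi> t (g k)) has_derivative (\<lambda>h. h *\<^sub>R q_integral r (g k))) (at r within S)" if "r \<in> S" for r k
    using nu_integral_gauss_sum_derivative[OF S(1)[OF that], where N="fst (x k)" and c="snd (x k)"]
    unfolding g_def has_vector_derivative_def by (rule has_derivative_at_withinI)
  define D where "D = C / (t / 2)"
  have JD: "J r \<le> D" if "r \<in> S" for r
  proof -
    have r: "t / 2 < r" "r < \<delta>" using that by (auto simp: S_def)
    have "t / 2 * J r \<le> r * J r" using r J_nonneg[of r] t by (intro mult_right_mono) auto
    also have "\<dots> \<le> C" using r t by (intro J_bound) auto
    finally show ?thesis using t by (simp add: D_def field_simps)
  qed
  have unif: "\<forall>\<^sub>F k in sequentially. \<forall>r\<in>S. \<forall>h. norm (h *\<^sub>R q_integral r (g k) - h *\<^sub>R q_integral r f) \<le> e * norm h"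
    if e: "0 < e" for e
  proof -
    have "(\<lambda>k. D * (1 / real (Suc k))) \<longlonglongrightarrow> D * 0" by (intro tendsto_intros lim0)
    then have "\<forall>\<^sub>F k in sequentially. D * (1 / real (Suc k)) < e"
      using e by (intro order_tendstoD) auto
    then show ?thesis
    proof eventually_elim
      case (elim k)
      show ?case
      proof (intro ballI allI)
        fix r h assume r: "r \<in> S"
        interpret q: orthant_density "q r" by (rule density[OF S(1)[OF r]])
        have "norm (q_integral r (g k) - q_integral r f) \<le> q.mass * (1 / real (Suc k))"
          using q.norm_density_integral_le[OF orthant_bcont_diff[OF gb f] gf]
          unfolding q.density_integral_diff[OF gb f] .
        also have "\<dots> \<le> D * (1 / real (Suc k))"
          using mass_le[OF S(1)[OF r]] JD[OF r] by (intro mult_right_mono) auto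
        finally have "norm (q_integral r (g k) - q_integral r f) \<le> e" using elim by linarith
        then have "\<bar>h\<bar> * norm (q_integral r (g k) - q_integral r f) \<le> \<bar>h\<bar> * e"
          by (intro mult_left_mono) auto
        then show "norm (h *\<^sub>R q_integral r (g k) - h *\<^sub>R q_integral r f) \<le> e * norm h"
          by (simp add: scaleR_diff_right[symmetric] mult.commute)
      qed
    qed
  qed
  have cS: "convex S" and oS: "open S" by (simp_all add: S_def)
  obtain G where G: "\<And>r. r \<in> S \<Longrightarrow> (\<lambda>k. nu_integral \<psi> r (g k)) \<longlonglongrightarrow> G r"
    "\<And>r. r \<in> S \<Longrightarrow> (G has_derivative (\<lambda>h. h *\<^sub>R q_integral r f)) (at r within S)"
    using has_derivative_sequence[OF cS der unif tS conv[OF tS]] by blast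
  have eq: "G r = nu_integral \<psi> r f" if "r \<in> S" for r
    using LIMSEQ_unique[OF G(1)[OF that] conv[OF that]] .
  have "(G has_vector_derivative q_integral t f) (at t)"
    using G(2)[OF tS] unfolding has_vector_derivative_def at_within_open[OF tS oS] .
  then show ?thesis
    by (rule has_vector_derivative_transform_within_open[OF _ oS tS]) (rule eq)
qed

end

section \<open>The convolution law\<close>

lemma nu_integral_exp_char:
  fixes \<psi> :: "real ^ 'n::finite \<Rightarrow> real"
  assumes \<psi>: "\<psi> \<in> T0_class" and t: "0 \<le> t" and m: "\<And>j. 1 \<le> m j"
  shows "nu_integral \<psi> t (exp_char m) = exp (t * \<psi> (- nat_vec m))"
proof -
  have "- nat_vec m \<in> (neg_orthant :: (real ^ 'n) set)"
    using m by (simp add: neg_orthant_def Suc_le_eq)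
  then show ?thesis
    unfolding orthant_integral_exp_char_cong[OF orthant_measure_nu[OF \<psi> t]] by (rule laplace_nu[OF \<psi> t])
qed

lemma exp_char_add: "exp_char m (u + v) = exp_char m u * exp_char m v"
  by (simp add: exp_char_def distrib_left sum.distrib flip: exp_add)

lemma orthant_bcont_translate:
  fixes f :: "real ^ 'n::finite \<Rightarrow> 'x::real_normed_vector"
  assumes f: "orthant_bcont f" and u: "u \<in> nonneg_orthant"
  shows "orthant_bcont (\<lambda>v. f (u + v))"
proof -
  obtain B where B: "\<And>u. u \<in> nonneg_orthant \<Longrightarrow> norm (f u) \<le> B"
    using orthant_bcontE[OF f] by blast
  show ?thesis
  proof (rule orthant_bcontI)
    show "continuous_on nonneg_orthant (\<lambda>v. f (u + v))"
      using f u by (intro continuous_on_compose2[of nonneg_orthant f _ "\<lambda>v. u + v"] continuous_intros)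
        (auto simp: orthant_bcont_def nonneg_orthant_add)
    show "norm (f (u + v)) \<le> B" if "v \<in> nonneg_orthant" for v
      by (intro B nonneg_orthant_add u that)
  qed
qed

text \<open>Exponentials are multiplicative in \<open>u + v\<close>, so both sides agree on
  exponential sums; dominated convergence, in the inner and then in the outer integral, gives the
  rest. No Fubini theorem for Banach-space valued functions enters.\<close>

theorem nu_integral_convolution:
  fixes \<psi> :: "real ^ 'n::finite \<Rightarrow> real" and f :: "real ^ 'n \<Rightarrow> 'x::banach"
  assumes \<psi>: "\<psi> \<in> T0_class" and s: "0 \<le> s" and t: "0 \<le> t" and f: "orthant_bcont f"
  shows "nu_integral \<psi> s (\<lambda>u. nu_integral \<psi> t (\<lambda>v. f (u + v))) = nu_integral \<psi> (s + t) f"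
proof -
  interpret s: orthant_measure "nu \<psi> s" by (rule orthant_measure_nu[OF \<psi> s])
  interpret t: orthant_measure "nu \<psi> t" by (rule orthant_measure_nu[OF \<psi> t])
  interpret st: orthant_measure "nu \<psi> (s + t)" by (rule orthant_measure_nu[OF \<psi>]) (use s t in simp)
  have t1: "measure (nu \<psi> t) UNIV = 1"
    using prob_space.prob_space[OF prob_space_nu[OF \<psi> t]] by simp
  \<comment> \<open>The inner integral has to be bounded and continuous in \<open>u\<close> before
    the outer one can be taken; continuity is dominated convergence along sequences.\<close>
  have bc: "orthant_bcont (\<lambda>u. nu_integral \<psi> t (\<lambda>v. g (u + v)))" if g: "orthant_bcont g" for g :: "real ^ 'n \<Rightarrow> 'x"
  proof -
    obtain B where B: "\<And>u. u \<in> nonneg_orthant \<Longrightarrow> norm (g u) \<le> B"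
      using orthant_bcontE[OF g] by blast
    show ?thesis
    proof (rule orthant_bcontI)
      show "continuous_on nonneg_orthant (\<lambda>u. nu_integral \<psi> t (\<lambda>v. g (u + v)))"
        unfolding continuous_on_sequentially
      proof (intro allI ballI impI, elim conjE)
        fix X :: "nat \<Rightarrow> real ^ 'n" and u
        assume X: "\<forall>k. X k \<in> nonneg_orthant" and u: "u \<in> nonneg_orthant" and lim: "X \<longlonglongrightarrow> u"
        have "(\<lambda>k. nu_integral \<psi> t (\<lambda>v. g (X k + v))) \<longlonglongrightarrow> nu_integral \<psi> t (\<lambda>v. g (u + v))"
        proof (rule t.orthant_integral_tendsto[where B=B])
          show "(\<lambda>k. g (X k + v)) \<longlonglongrightarrow> g (u + v)" if "v \<in> nonneg_orthant" for v
            using g X u that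
            by (intro continuous_on_tendsto_compose[of nonneg_orthant g] tendsto_add tendsto_const lim)
              (auto simp: orthant_bcont_def nonneg_orthant_add)
        qed (use X u in \<open>auto intro: orthant_bcont_translate[OF g] B nonneg_orthant_add\<close>)
        then show "((\<lambda>u. nu_integral \<psi> t (\<lambda>v. g (u + v))) \<circ> X) \<longlonglongrightarrow> nu_integral \<psi> t (\<lambda>v. g (u + v))"
          by (simp add: o_def)
      qed
      show "norm (nu_integral \<psi> t (\<lambda>v. g (u + v))) \<le> B" if u: "u \<in> nonneg_orthant" for u
        using t.norm_orthant_integral_le_bound[OF orthant_bcont_translate[OF g u], of B] B t1 u
        by (simp add: nonneg_orthant_add)
    qed
  qed
  obtain K c B where "\<forall>u\<in>nonneg_orthant. (\<lambda>k. exp_sum (K k) (c k) u) \<longlonglongrightarrow> f u \<and>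
      (\<forall>k. norm (exp_sum (K k) (c k) u) \<le> B)"
    using exp_sum_pointwise_approximation[OF f] by (elim exE) (rule that)
  then have K: "\<And>u. u \<in> nonneg_orthant \<Longrightarrow> (\<lambda>k. exp_sum (K k) (c k) u) \<longlonglongrightarrow> f u"
    "\<And>k u. u \<in> nonneg_orthant \<Longrightarrow> norm (exp_sum (K k) (c k) u) \<le> B"
    by auto
  have inner: "nu_integral \<psi> t (\<lambda>v. exp_sum (K k) (c k) (u + v)) = exp_sum (K k) (\<lambda>m. exp (t * \<psi> (- nat_vec m)) *\<^sub>R c k m) u" for k u
  proof -
    have "nu_integral \<psi> t (\<lambda>v. exp_sum (K k) (c k) (u + v)) = nu_integral \<psi> t (exp_sum (K k) (\<lambda>m. exp_char m u *\<^sub>R c k m))"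
      by (simp add: exp_char_add mult.commute)
    also have "\<dots> = (\<Sum>m\<in>exponents (K k). exp (t * \<psi> (- nat_vec m)) *\<^sub>R exp_char m u *\<^sub>R c k m)"
      unfolding t.orthant_integral_exp_sum
      by (intro sum.cong refl arg_cong2[where f=scaleR] nu_integral_exp_char[OF \<psi> t]) (auto simp: PiE_iff)
    finally show ?thesis by (simp add: mult.commute)
  qed
  have "nu_integral \<psi> s (\<lambda>u. nu_integral \<psi> t (\<lambda>v. exp_sum (K k) (c k) (u + v))) = nu_integral \<psi> (s + t) (exp_sum (K k) (c k))" for k
  proof -
    have "nu_integral \<psi> s (\<lambda>u. nu_integral \<psi> t (\<lambda>v. exp_sum (K k) (c k) (u + v)))
        = (\<Sum>m\<in>exponents (K k). exp (s * \<psi> (- nat_vec m)) *\<^sub>R exp (t * \<psi> (- nat_vec m)) *\<^sub>R c k m)"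
      unfolding inner s.orthant_integral_exp_sum
      by (intro sum.cong refl arg_cong2[where f=scaleR] nu_integral_exp_char[OF \<psi> s]) (auto simp: PiE_iff)
    also have "\<dots> = (\<Sum>m\<in>exponents (K k). exp ((s + t) * \<psi> (- nat_vec m)) *\<^sub>R c k m)"
      by (simp add: distrib_right exp_add)
    also have "\<dots> = nu_integral \<psi> (s + t) (exp_sum (K k) (c k))"
      unfolding st.orthant_integral_exp_sum using s t
      by (intro sum.cong refl arg_cong2[where f=scaleR] nu_integral_exp_char[OF \<psi>, symmetric]) (auto simp: PiE_iff)
    finally show ?thesis .
  qed
  moreover have "(\<lambda>k. nu_integral \<psi> (s + t) (exp_sum (K k) (c k))) \<longlonglongrightarrow> nu_integral \<psi> (s + t) f"
    by (rule st.orthant_integral_tendsto[OF orthant_bcont_exp_sum f K])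
  moreover have "(\<lambda>k. nu_integral \<psi> s (\<lambda>u. nu_integral \<psi> t (\<lambda>v. exp_sum (K k) (c k) (u + v))))
      \<longlonglongrightarrow> nu_integral \<psi> s (\<lambda>u. nu_integral \<psi> t (\<lambda>v. f (u + v)))"
  proof (rule s.orthant_integral_tendsto[where B=B])
    show "orthant_bcont (\<lambda>u. nu_integral \<psi> t (\<lambda>v. exp_sum (K k) (c k) (u + v)))" for k
      by (rule bc[OF orthant_bcont_exp_sum])
    show "orthant_bcont (\<lambda>u. nu_integral \<psi> t (\<lambda>v. f (u + v)))" by (rule bc[OF f])
    fix u :: "real ^ 'n" assume u: "u \<in> nonneg_orthant"
    show "(\<lambda>k. nu_integral \<psi> t (\<lambda>v. exp_sum (K k) (c k) (u + v))) \<longlonglongrightarrow> nu_integral \<psi> t (\<lambda>v. f (u + v))"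
      by (rule t.orthant_integral_tendsto[OF orthant_bcont_translate[OF orthant_bcont_exp_sum u]
            orthant_bcont_translate[OF f u] K(1)[OF nonneg_orthant_add[OF u]] K(2)[OF nonneg_orthant_add[OF u]]])
    show "norm (nu_integral \<psi> t (\<lambda>v. exp_sum (K k) (c k) (u + v))) \<le> B" for k
      using t.norm_orthant_integral_le_bound[OF orthant_bcont_translate[OF orthant_bcont_exp_sum u]
          K(2)[OF nonneg_orthant_add[OF u]]]
      unfolding t1 mult_1 .
  qed
  ultimately show ?thesis by (simp add: LIMSEQ_unique)
qed

section \<open>Subordinate semigroups\<close>

lemma zero_in_nonneg_orthant [simp]: "0 \<in> nonneg_orthant"
  by (simp add: nonneg_orthant_def)

lemma minus_one_in_neg_orthant: "- 1 \<in> neg_orthant"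
  by (simp add: neg_orthant_def)

lemma T0_class_nonpos: "\<psi> \<in> T0_class \<Longrightarrow> s \<in> neg_orthant \<Longrightarrow> \<psi> s \<le> 0"
  by (simp add: T0_class_def T_class_def)

lemma nu_integral_one_minus_exp:
  fixes \<psi> :: "real ^ 'n::finite \<Rightarrow> real"
  assumes \<psi>: "\<psi> \<in> T0_class" and t: "0 \<le> t"
  shows "nu_integral \<psi> t (\<lambda>u. 1 - exp (- coord_sum u)) = 1 - exp (t * \<psi> (- 1))"
proof -
  interpret o: orthant_measure "nu \<psi> t" by (rule orthant_measure_nu[OF \<psi> t])
  have "nu_integral \<psi> t (\<lambda>u. exp (- coord_sum u)) = exp (t * \<psi> (- 1))"
    using laplace_nu[OF \<psi> t minus_one_in_neg_orthant] unfolding inner_minus_one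
    by (subst o.integral_orthant(1)[OF orthant_bcont_exp_coord_sum]) auto
  moreover have "nu_integral \<psi> t (\<lambda>u. 1 :: real) = 1"
    using prob_space.prob_space[OF prob_space_nu[OF \<psi> t]] by (simp add: o.orthant_integral_const)
  ultimately show ?thesis
    by (simp add: o.orthant_integral_diff orthant_bcont_const orthant_bcont_exp_coord_sum)
qed

text \<open>Quantitative weak continuity at time \<open>0\<close>: Markov's inequality with the test function
  \<open>1 - exp (- (u\<^sub>1 + \<dots> + u\<^sub>n))\<close>, whose \<open>nu \<psi> t\<close>-integral is explicit.\<close>

lemma nu_integral_deviation:
  fixes \<psi> :: "real ^ 'n::finite \<Rightarrow> real" and f :: "real ^ 'n \<Rightarrow> 'x::banach"
  assumes \<psi>: "\<psi> \<in> T0_class" and f: "orthant_bcont f" and e: "0 < e"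
  obtains B where "0 \<le> B"
    "\<And>t. 0 \<le> t \<Longrightarrow> nu_integral \<psi> t (\<lambda>u. norm (f u - f 0)) \<le> e + B * (1 - exp (t * \<psi> (- 1)))"
proof -
  obtain A where A: "A > 0" "\<And>u. u \<in> nonneg_orthant \<Longrightarrow> norm (f u) \<le> A"
    using orthant_bcontE[OF f] by blast
  obtain d where d: "d > 0" "\<And>u. u \<in> nonneg_orthant \<Longrightarrow> norm u < d \<Longrightarrow> norm (f u - f 0) < e"
    using f e unfolding orthant_bcont_def continuous_on_iff dist_norm
    by (metis diff_zero zero_in_nonneg_orthant)
  define B where "B = 2 * A / (1 - exp (- d))"
  have d1: "1 - exp (- d) > 0" using d by simp
  have B: "0 \<le> B" using A d1 by (simp add: B_def)
  show thesis
  proof (rule that[OF B])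
    fix t :: real assume t: "0 \<le> t"
    interpret o: orthant_measure "nu \<psi> t" by (rule orthant_measure_nu[OF \<psi> t])
    have t1: "measure (nu \<psi> t) UNIV = 1"
      using prob_space.prob_space[OF prob_space_nu[OF \<psi> t]] by simp
    have bc: "orthant_bcont (\<lambda>u. 1 - exp (- coord_sum u))"
      by (intro orthant_bcont_diff orthant_bcont_const orthant_bcont_exp_coord_sum)
    have bc': "orthant_bcont (\<lambda>u. B * (1 - exp (- coord_sum u)))"
      by (rule orthant_bcont_bounded_linear[OF bounded_linear_mult_right bc])
    have "nu_integral \<psi> t (\<lambda>u. norm (f u - f 0)) \<le> nu_integral \<psi> t (\<lambda>u. e + B * (1 - exp (- coord_sum u)))"
    proof (rule o.orthant_integral_mono)
      fix u :: "real ^ 'n" assume u: "u \<in> nonneg_orthant"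
      have pos: "0 \<le> B * (1 - exp (- coord_sum u))" using B coord_sum_nonneg[OF u] by simp
      show "norm (f u - f 0) \<le> e + B * (1 - exp (- coord_sum u))"
      proof (cases "norm u < d")
        case True
        then show ?thesis using d(2)[OF u] pos by fastforce
      next
        case False
        then have "d \<le> coord_sum u" using norm_le_coord_sum[OF u] by linarith
        then have "B * (1 - exp (- d)) \<le> B * (1 - exp (- coord_sum u))"
          using B by (intro mult_left_mono) auto
        moreover have "B * (1 - exp (- d)) = 2 * A" using d1 by (simp add: B_def)
        moreover have "norm (f u - f 0) \<le> A + A"
          using norm_triangle_ineq4[of "f u" "f 0"] A(2)[OF u] A(2)[OF zero_in_nonneg_orthant] by linarith
        ultimately show ?thesis using e by linarith
      qed
    qed (intro orthant_bcont_norm orthant_bcont_diff orthant_bcont_add orthant_bcont_const f bc')+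
    also have "\<dots> = e + B * (1 - exp (t * \<psi> (- 1)))"
      unfolding o.orthant_integral_add[OF orthant_bcont_const bc'] o.orthant_integral_const t1
        o.orthant_integral_bounded_linear[OF bounded_linear_mult_right bc] nu_integral_one_minus_exp[OF \<psi> t]
      by simp
    finally show "nu_integral \<psi> t (\<lambda>u. norm (f u - f 0)) \<le> e + B * (1 - exp (t * \<psi> (- 1)))" .
  qed
qed

section \<open>Subordination of an n-parameter semigroup\<close>

locale orthant_semigroup =
  fixes T :: "real ^ 'n::finite \<Rightarrow> 'x::banach \<Rightarrow> 'x" and K :: real
  assumes T_linear: "\<And>u. u \<in> nonneg_orthant \<Longrightarrow> bounded_linear (T u)"
    and T_zero: "\<And>x. T 0 x = x"
    and T_add: "\<And>u v x. u \<in> nonneg_orthant \<Longrightarrow> v \<in> nonneg_orthant \<Longrightarrow> T (u + v) x = T u (T v x)"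
    and T_bound: "\<And>u x. u \<in> nonneg_orthant \<Longrightarrow> norm (T u x) \<le> K * norm x"
    and T_cont: "\<And>x. continuous_on nonneg_orthant (\<lambda>u. T u x)"
    and K_nonneg: "0 \<le> K"
begin

lemma T_bcont: "orthant_bcont (\<lambda>u. T u x)"
  by (rule orthant_bcontI[OF T_cont T_bound])

end

locale subordinate_semigroup = orthant_semigroup T K
  for T :: "real ^ 'n::finite \<Rightarrow> 'x::banach \<Rightarrow> 'x" and K +
  fixes \<psi> :: "real ^ 'n \<Rightarrow> real"
  assumes \<psi>: "\<psi> \<in> T0_class"
begin

definition U :: "real \<Rightarrow> 'x \<Rightarrow> 'x" where
  "U t x = nu_integral \<psi> t (\<lambda>u. T u x)"

lemma measure_nu_UNIV: "0 \<le> t \<Longrightarrow> measure (nu \<psi> t) UNIV = 1"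
  using prob_space.prob_space[OF prob_space_nu[OF \<psi>]]
    orthant_measure.space_eq[OF orthant_measure_nu[OF \<psi>]] by metis

lemma U_bound: "0 \<le> t \<Longrightarrow> norm (U t x) \<le> K * norm x"
  unfolding U_def
  using orthant_measure.norm_orthant_integral_le_bound[OF orthant_measure_nu[OF \<psi>] T_bcont T_bound, of t x]
  by (simp add: measure_nu_UNIV)

lemma U_linear: "bounded_linear (U t)" if t: "0 \<le> t"
proof -
  interpret o: orthant_measure "nu \<psi> t" by (rule orthant_measure_nu[OF \<psi> t])
  show ?thesis
  proof (rule bounded_linear_intro[where K=K])
    fix x y r
    have "U t (x + y) = nu_integral \<psi> t (\<lambda>u. T u x + T u y)"
      unfolding U_def using T_linear by (intro orthant_integral_cong) (simp add: linear_add bounded_linear.linear)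
    then show "U t (x + y) = U t x + U t y"
      unfolding U_def by (simp add: o.orthant_integral_add T_bcont)
    have "U t (r *\<^sub>R x) = nu_integral \<psi> t (\<lambda>u. r *\<^sub>R T u x)"
      unfolding U_def using T_linear by (intro orthant_integral_cong) (simp add: linear_cmul bounded_linear.linear)
    then show "U t (r *\<^sub>R x) = r *\<^sub>R U t x"
      unfolding U_def by (simp add: o.orthant_integral_bounded_linear[OF bounded_linear_scaleR_right] T_bcont)
    show "norm (U t x) \<le> norm x * K" using U_bound[OF t] by (simp add: mult.commute)
  qed
qed

lemma U_diff: "0 \<le> t \<Longrightarrow> U t (x - y) = U t x - U t y"
  by (rule linear_diff[OF bounded_linear.linear[OF U_linear]])

lemma T_U: "u \<in> nonneg_orthant \<Longrightarrow> 0 \<le> t \<Longrightarrow> T u (U t x) = nu_integral \<psi> t (\<lambda>v. T (u + v) x)"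
  unfolding U_def
    orthant_measure.orthant_integral_bounded_linear[OF orthant_measure_nu[OF \<psi>] T_linear T_bcont, symmetric]
  by (intro orthant_integral_cong) (simp add: T_add)

lemma U_add: "U s (U t x) = U (s + t) x" if "0 \<le> s" "0 \<le> t"
proof -
  have "U s (U t x) = nu_integral \<psi> s (\<lambda>u. nu_integral \<psi> t (\<lambda>v. T (u + v) x))"
    unfolding U_def[of s] by (intro orthant_integral_cong T_U that)
  also have "\<dots> = U (s + t) x"
    unfolding U_def by (rule nu_integral_convolution[OF \<psi> that T_bcont])
  finally show ?thesis .
qed

lemma norm_U_diff_le: "norm (U t x - x) \<le> nu_integral \<psi> t (\<lambda>u. norm (T u x - x))" if t: "0 \<le> t"
proof -
  interpret o: orthant_measure "nu \<psi> t" by (rule orthant_measure_nu[OF \<psi> t])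
  have "U t x - x = nu_integral \<psi> t (\<lambda>u. T u x - x)"
    unfolding U_def by (simp add: o.orthant_integral_diff T_bcont orthant_bcont_const o.orthant_integral_const measure_nu_UNIV t)
  then show ?thesis
    using o.norm_orthant_integral_le[OF orthant_bcont_diff[OF T_bcont orthant_bcont_const], of x x] by simp
qed

lemma deviation:
  assumes "0 < e"
  obtains B where "0 \<le> B"
    "\<And>t. 0 \<le> t \<Longrightarrow> nu_integral \<psi> t (\<lambda>u. norm (T u x - x)) \<le> e + B * (1 - exp (t * \<psi> (- 1)))"
  using nu_integral_deviation[OF \<psi> T_bcont[of x] assms] unfolding T_zero by blast

text \<open>There is no need to identify \<open>nu \<psi> 0\<close>: at time 0 the second term of
  the deviation bound vanishes and the first is arbitrarily small.\<close>

lemma U_zero: "U 0 x = x"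
proof -
  have "norm (U 0 x - x) \<le> e" if e: "0 < e" for e
  proof -
    obtain B where "\<And>t. 0 \<le> t \<Longrightarrow> nu_integral \<psi> t (\<lambda>u. norm (T u x - x)) \<le> e + B * (1 - exp (t * \<psi> (- 1)))"
      using deviation[OF e] by blast
    from this[of 0] norm_U_diff_le[of 0 x] show ?thesis by simp
  qed
  then have "norm (U 0 x - x) \<le> 0" by (rule field_le_epsilon[where y=0, simplified])
  then show ?thesis by simp
qed

text \<open>The semigroup law and the uniform bound reduce everything to time 0, with a radius
  \<open>b\<close> that does not depend on the base point. Taking the smaller of two times as base
  point gives continuity from both sides.\<close>

lemma U_continuous: "continuous_on {0..} (\<lambda>t. U t x)"
  unfolding continuous_on_iff
proof (intro ballI allI impI)
  fix t e :: real assume t: "t \<in> {0..}" and e: "0 < e"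
  \<comment> \<open>\<open>K + 1\<close> keeps the denominator positive when
    \<open>K = 0\<close>.\<close>
  define e' where "e' = e / (2 * (K + 1))"
  have e': "0 < e'" and Ke: "K * e' \<le> e / 2"
    using e K_nonneg by (auto simp: e'_def field_simps)
  obtain B where B: "0 \<le> B" "\<And>t. 0 \<le> t \<Longrightarrow> nu_integral \<psi> t (\<lambda>u. norm (T u x - x)) \<le> e' + B * (1 - exp (t * \<psi> (- 1)))"
    using deviation[OF e'] by blast
  have "((\<lambda>r. K * (e' + B * (1 - exp (r * \<psi> (- 1))))) \<longlongrightarrow> K * (e' + B * (1 - exp (0 * \<psi> (- 1))))) (at_right 0)"
    by (intro tendsto_intros)
  then have "\<forall>\<^sub>F r in at_right 0. K * (e' + B * (1 - exp (r * \<psi> (- 1)))) < e"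
    by (rule order_tendstoD(2)) (use Ke e in auto)
  then obtain b where b: "b > 0" "\<And>r. 0 < r \<Longrightarrow> r < b \<Longrightarrow> K * (e' + B * (1 - exp (r * \<psi> (- 1)))) < e"
    unfolding eventually_at_right_field by blast
  have step: "norm (U (s + r) x - U s x) < e" if "0 \<le> s" "0 < r" "r < b" for s r
  proof -
    have "U (s + r) x - U s x = U s (U r x - x)"
      using that by (simp add: U_add[symmetric] U_diff)
    then have "norm (U (s + r) x - U s x) \<le> K * norm (U r x - x)"
      using U_bound[OF that(1)] by simp
    also have "\<dots> \<le> K * (e' + B * (1 - exp (r * \<psi> (- 1))))"
      using norm_U_diff_le[of r x] B(2)[of r] that K_nonneg by (intro mult_left_mono) auto
    also have "\<dots> < e" by (rule b) (use that in auto)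
    finally show ?thesis .
  qed
  show "\<exists>d>0. \<forall>t'\<in>{0..}. dist t' t < d \<longrightarrow> dist (U t' x) (U t x) < e"
  proof (intro exI[of _ b] conjI ballI impI b)
    fix t' :: real assume t': "t' \<in> {0..}" and "dist t' t < b"
    then show "dist (U t' x) (U t x) < e"
      using step[of t "t' - t"] step[of t' "t - t'"] t e
      by (cases t t' rule: linorder_cases) (auto simp: dist_norm norm_minus_commute)
  qed
qed

end

section \<open>The derivative of the subordinate semigroup\<close>

locale subordinate_derivative = subordinate_semigroup T K \<psi> + nu_derivative \<psi> q J \<delta> C
  for T :: "real ^ 'n::finite \<Rightarrow> 'x::banach \<Rightarrow> 'x" and K \<psi> q J \<delta> C
begin

definition V :: "real \<Rightarrow> 'x \<Rightarrow> 'x" where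
  "V t x = q_integral t (\<lambda>u. T u x)"

lemma V_bound: "norm (V t x) \<le> K * J t * norm x" if t: "0 < t"
proof -
  interpret q: orthant_density "q t" by (rule density[OF t])
  have "norm (V t x) \<le> q.mass * (K * norm x)"
    unfolding V_def by (rule q.norm_density_integral_le[OF T_bcont T_bound])
  also have "\<dots> \<le> J t * (K * norm x)"
    using mass_le[OF t] K_nonneg by (intro mult_right_mono) auto
  finally show ?thesis by (simp add: mult_ac)
qed

lemma V_diff: "V t (x - y) = V t x - V t y" if t: "0 < t"
proof -
  interpret q: orthant_density "q t" by (rule density[OF t])
  have "V t (x - y) = q_integral t (\<lambda>u. T u x - T u y)"
    unfolding V_def q.density_integral_def using T_linear
    by (intro arg_cong2[where f="(-)"] orthant_integral_cong) (simp_all add: linear_diff bounded_linear.linear)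
  then show ?thesis
    unfolding V_def by (simp add: q.density_integral_diff T_bcont)
qed

text \<open>After subtraction of the tangent, the derivative at \<open>s\<close> is
  \<open>V (t + s) x - V t x = V t (U s x - x)\<close>. It involves the bound at the fixed time
  \<open>t\<close> and a quantity that is small with \<open>s\<close>, so the mean value inequality
  needs no continuity of \<open>V\<close> in time.\<close>

lemma U_estimate_C0:
  assumes C0: "\<And>x. orthant_C0 (\<lambda>u. T u x)"
    and t: "0 < t" and h: "0 \<le> h" and th: "t + h < \<delta>"
    and w: "\<And>s. 0 \<le> s \<Longrightarrow> s \<le> h \<Longrightarrow> norm (U s x - x) \<le> w"
  shows "norm (U (t + h) x - U t x - h *\<^sub>R V t x) \<le> h * (K * J t * w)"
proof -
  have der: "((\<lambda>s. U s y) has_vector_derivative V r y) (at r)" if "0 < r" "r < \<delta>" for r y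
    unfolding U_def V_def by (rule nu_integral_C0_derivative[OF T_bcont C0 that])
  have shift: "((\<lambda>s. U (s + r) x) has_vector_derivative V (t + r) x) (at t)" if "0 \<le> r" "t + r < \<delta>" for r
  proof -
    have "((\<lambda>s. s + r) has_vector_derivative 1) (at t)"
      by (auto intro!: derivative_eq_intros)
    from vector_diff_chain_at[OF this] der[of "t + r" x] that t show ?thesis
      by (simp add: o_def)
  qed
  \<comment> \<open>Both sides are the derivative at \<open>t\<close> of the same shifted orbit,
    computed once by the chain rule and once after the semigroup law.\<close>
  have VU: "V (t + r) x = V t (U r x)" if r: "0 \<le> r" "t + r < \<delta>" for r
  proof -
    have "((\<lambda>s. U s (U r x)) has_vector_derivative V t (U r x)) (at t)"
      using r t by (intro der) auto
    then have "((\<lambda>s. U (s + r) x) has_vector_derivative V t (U r x)) (at t)"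
      by (rule has_vector_derivative_transform_within_open[where S="{0<..}"]) (use t r in \<open>auto simp: U_add\<close>)
    then show ?thesis
      using shift[OF r] by (rule vector_derivative_unique_at[symmetric])
  qed
  define \<phi> where "\<phi> s = U (t + s) x - s *\<^sub>R V t x" for s
  have d\<phi>: "(\<phi> has_derivative (\<lambda>y. y *\<^sub>R V t (U s x - x))) (at s within {0..h})" if s: "s \<in> {0..h}" for s
  proof -
    have "((\<lambda>s. t + s) has_vector_derivative 1) (at s)"
      by (auto intro!: derivative_eq_intros)
    from vector_diff_chain_at[OF this] der[of "t + s" x] s t th
    have "((\<lambda>s. U (t + s) x) has_vector_derivative V (t + s) x) (at s)"
      by (simp add: o_def)
    then have "(\<phi> has_vector_derivative V (t + s) x - V t x) (at s)"
      unfolding \<phi>_def by (auto intro!: derivative_eq_intros)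
    moreover have "V (t + s) x - V t x = V t (U s x - x)"
      using VU[of s] s th by (simp add: V_diff[OF t])
    ultimately show ?thesis
      unfolding has_vector_derivative_def by (auto intro: has_derivative_at_withinI)
  qed
  have "norm (\<phi> h - \<phi> 0) \<le> (K * J t * w) * norm (h - 0)"
  proof (rule differentiable_bound[OF _ d\<phi>])
    fix s assume s: "s \<in> {0..h}"
    have "norm (V t (U s x - x)) \<le> K * J t * norm (U s x - x)" by (rule V_bound[OF t])
    also have "\<dots> \<le> K * J t * w"
      using s w[of s] K_nonneg J_nonneg[OF t] by (intro mult_left_mono) auto
    finally have le: "norm (V t (U s x - x)) \<le> K * J t * w" .
    show "onorm (\<lambda>y. y *\<^sub>R V t (U s x - x)) \<le> K * J t * w"
      using le order_trans[OF norm_ge_zero le]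
      by (intro onorm_bound) (auto simp: mult.commute[of "K * J t * w"] intro!: mult_left_mono)
  qed (use h in auto)
  then show ?thesis
    using h by (simp add: \<phi>_def mult.commute algebra_simps)
qed

text \<open>The damping factor is multiplicative and at most 1, so the semigroup laws and the
  constant \<open>K\<close> survive; the data of \<open>nu_derivative\<close> concern
  \<open>\<psi>\<close> only.\<close>

lemma damped: "subordinate_derivative (\<lambda>u x. damp \<epsilon> u *\<^sub>R T u x) K \<psi> q J \<delta> C" if "0 \<le> \<epsilon>"
proof (intro subordinate_derivative.intro subordinate_semigroup.intro subordinate_semigroup_axioms.intro
    orthant_semigroup.intro \<psi> nu_derivative_axioms)
  fix u :: "real ^ 'n" assume u: "u \<in> nonneg_orthant"
  show "bounded_linear (\<lambda>x. damp \<epsilon> u *\<^sub>R T u x)"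
    by (rule bounded_linear_compose[OF bounded_linear_scaleR_right T_linear[OF u], unfolded o_def])
next
  fix u :: "real ^ 'n" and x assume u: "u \<in> nonneg_orthant"
  have "norm (damp \<epsilon> u *\<^sub>R T u x) \<le> 1 * norm (T u x)"
    unfolding norm_scaleR using damp_bounds[OF that u] by (intro mult_right_mono) auto
  then show "norm (damp \<epsilon> u *\<^sub>R T u x) \<le> K * norm x" using T_bound[OF u, of x] by linarith
next
  fix u v :: "real ^ 'n" and x assume u: "u \<in> nonneg_orthant" and v: "v \<in> nonneg_orthant"
  have "damp \<epsilon> (u + v) = damp \<epsilon> u * damp \<epsilon> v"
    by (simp add: damp_def distrib_left sum.distrib flip: exp_add)
  then show "damp \<epsilon> (u + v) *\<^sub>R T (u + v) x = damp \<epsilon> u *\<^sub>R T u (damp \<epsilon> v *\<^sub>R T v x)"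
    by (simp add: T_add[OF u v] linear_cmul[OF bounded_linear.linear[OF T_linear[OF u]]])
next
  show "continuous_on nonneg_orthant (\<lambda>u. damp \<epsilon> u *\<^sub>R T u x)" for x
    unfolding damp_def by (intro continuous_intros T_cont)
qed (simp_all add: damp_def T_zero K_nonneg)

text \<open>The damped semigroups \<open>exp (- \<epsilon> (u\<^sub>1 + \<dots> + u\<^sub>n)) T u\<close> vanish at infinity, and their estimates
  are uniform in \<open>\<epsilon>\<close>.\<close>

theorem U_estimate:
  assumes t: "0 < t" and h: "0 \<le> h" and th: "t + h < \<delta>"
    and w: "\<And>s. 0 \<le> s \<Longrightarrow> s \<le> h \<Longrightarrow>
      nu_integral \<psi> s (\<lambda>u. norm (T u x - x)) + norm x * (1 - exp (s * \<psi> (- 1))) \<le> w"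
  shows "norm (U (t + h) x - U t x - h *\<^sub>R V t x) \<le> h * (K * J t * w)"
proof -
  interpret q: orthant_density "q t" by (rule density[OF t])
  define \<epsilon> where "\<epsilon> k = 1 / real (Suc k)" for k
  have \<epsilon>: "0 < \<epsilon> k" "\<epsilon> k \<le> 1" for k by (auto simp: \<epsilon>_def)
  have \<epsilon>_lim: "\<epsilon> \<longlonglongrightarrow> 0"
    using LIMSEQ_inverse_real_of_nat unfolding \<epsilon>_def by (simp add: inverse_eq_divide)
  define D where "D k u = damp (\<epsilon> k) u *\<^sub>R T u x" for k u
  interpret d: subordinate_derivative "\<lambda>u x. damp (\<epsilon> k) u *\<^sub>R T u x" K \<psi> q J \<delta> C for k
    by (rule damped) (use \<epsilon> in \<open>simp add: less_imp_le\<close>)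
  have Db: "orthant_bcont (D k)" for k unfolding D_def by (rule d.T_bcont)
  have DB: "norm (D k u) \<le> K * norm x" if "u \<in> nonneg_orthant" for k u
    unfolding D_def by (rule d.T_bound[OF that])
  have D_lim: "(\<lambda>k. D k u) \<longlonglongrightarrow> T u x" for u
  proof -
    have "(\<lambda>k. D k u) \<longlonglongrightarrow> exp (- (0 * (\<Sum>j\<in>UNIV. u $ j))) *\<^sub>R T u x"
      unfolding D_def damp_def by (intro tendsto_intros \<epsilon>_lim)
    then show ?thesis by simp
  qed
  have U_lim: "(\<lambda>k. nu_integral \<psi> s (D k)) \<longlonglongrightarrow> U s x" if "0 \<le> s" for s
    unfolding U_def
    by (rule orthant_measure.orthant_integral_tendsto[OF orthant_measure_nu[OF \<psi> that] Db T_bcont D_lim DB])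
  have V_lim: "(\<lambda>k. q_integral t (D k)) \<longlonglongrightarrow> V t x"
    unfolding V_def by (rule q.density_integral_tendsto[OF Db T_bcont D_lim DB])
  have est: "norm (nu_integral \<psi> (t + h) (D k) - nu_integral \<psi> t (D k) - h *\<^sub>R q_integral t (D k)) \<le> h * (K * J t * w)" for k
  proof -
    have "norm (d.U k s x - x) \<le> w" if s: "0 \<le> s" "s \<le> h" for s
    proof -
      interpret o: orthant_measure "nu \<psi> s" by (rule orthant_measure_nu[OF \<psi> s(1)])
      have bc1: "orthant_bcont (\<lambda>u. norm (T u x - x))"
        by (intro orthant_bcont_norm orthant_bcont_diff T_bcont orthant_bcont_const)
      have bc2: "orthant_bcont (\<lambda>u. 1 - exp (- coord_sum u))"
        by (intro orthant_bcont_diff orthant_bcont_const orthant_bcont_exp_coord_sum)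
      have bc3: "orthant_bcont (\<lambda>u. norm x * (1 - exp (- coord_sum u)))"
        by (rule orthant_bcont_bounded_linear[OF bounded_linear_mult_right bc2])
      have "norm (d.U k s x - x) \<le> nu_integral \<psi> s (\<lambda>u. norm (damp (\<epsilon> k) u *\<^sub>R T u x - x))"
        by (rule d.norm_U_diff_le[OF s(1)])
      also have "\<dots> \<le> nu_integral \<psi> s (\<lambda>u. norm (T u x - x) + norm x * (1 - exp (- coord_sum u)))"
      proof (rule o.orthant_integral_mono)
        fix u :: "real ^ 'n" assume u: "u \<in> nonneg_orthant"
        let ?d = "damp (\<epsilon> k) u"
        have d: "0 \<le> ?d" "?d \<le> 1" using damp_bounds[OF _ u, of "\<epsilon> k"] \<epsilon>(1)[of k] by auto
        have "\<epsilon> k * coord_sum u \<le> 1 * coord_sum u"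
          using \<epsilon>(2) coord_sum_nonneg[OF u] by (intro mult_right_mono)
        then have e: "exp (- coord_sum u) \<le> ?d"
          by (simp add: damp_def coord_sum_def)
        \<comment> \<open>The loss through damping is \<open>1 - ?d\<close>, at most
          \<open>1 - exp (- coord_sum u)\<close> since \<open>\<epsilon> k \<le> 1\<close>; the
          integral of this majorant is explicit and free of \<open>k\<close>.\<close>
        have "?d *\<^sub>R T u x - x = ?d *\<^sub>R (T u x - x) - (1 - ?d) *\<^sub>R x"
          by (simp add: algebra_simps)
        then have "norm (?d *\<^sub>R T u x - x) \<le> ?d * norm (T u x - x) + (1 - ?d) * norm x"
          using norm_triangle_ineq4[of "?d *\<^sub>R (T u x - x)" "(1 - ?d) *\<^sub>R x"] d by simp
        also have "\<dots> \<le> 1 * norm (T u x - x) + (1 - exp (- coord_sum u)) * norm x"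
          using d e by (intro add_mono mult_right_mono) auto
        finally show "norm (?d *\<^sub>R T u x - x) \<le> norm (T u x - x) + norm x * (1 - exp (- coord_sum u))"
          by (simp add: mult.commute)
      qed (intro orthant_bcont_norm orthant_bcont_diff d.T_bcont orthant_bcont_const orthant_bcont_add bc1 bc3)+
      also have "\<dots> = nu_integral \<psi> s (\<lambda>u. norm (T u x - x)) + norm x * (1 - exp (s * \<psi> (- 1)))"
        unfolding o.orthant_integral_add[OF bc1 bc3]
          o.orthant_integral_bounded_linear[OF bounded_linear_mult_right bc2] nu_integral_one_minus_exp[OF \<psi> s(1)] ..
      also have "\<dots> \<le> w" by (rule w[OF s])
      finally show ?thesis .
    qed
    from d.U_estimate_C0[OF orthant_C0_damp[OF T_bcont \<epsilon>(1)] t h th this]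
    show ?thesis unfolding d.U_def d.V_def D_def .
  qed
  have "(\<lambda>k. norm (nu_integral \<psi> (t + h) (D k) - nu_integral \<psi> t (D k) - h *\<^sub>R q_integral t (D k)))
      \<longlonglongrightarrow> norm (U (t + h) x - U t x - h *\<^sub>R V t x)"
    using t h by (intro tendsto_intros U_lim V_lim) auto
  then show ?thesis by (rule LIMSEQ_le_const2) (use est in blast)
qed

text \<open>The majorant \<open>w h\<close> tends to \<open>e'\<close> and not to 0, but
  \<open>e'\<close> is at our disposal and is chosen against the fixed constant
  \<open>K * J t\<close>.\<close>

theorem U_right_derivative:
  assumes t: "0 < t" "t < \<delta>"
  shows "((\<lambda>h. (U h (U t x) - U t x) /\<^sub>R h) \<longlongrightarrow> V t x) (at_right 0)"
proof (rule tendstoI)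
  fix e :: real assume e: "0 < e"
  define A where "A = K * J t"
  have A: "0 \<le> A" using K_nonneg J_nonneg[OF t(1)] by (simp add: A_def)
  define e' where "e' = e / (2 * (A + 1))"
  have e': "0 < e'" and Ae: "A * e' \<le> e / 2"
    using e A by (auto simp: e'_def field_simps)
  obtain B where B: "0 \<le> B" "\<And>s. 0 \<le> s \<Longrightarrow> nu_integral \<psi> s (\<lambda>u. norm (T u x - x)) \<le> e' + B * (1 - exp (s * \<psi> (- 1)))"
    using deviation[OF e'] by blast
  have np: "\<psi> (- 1) \<le> 0" by (rule T0_class_nonpos[OF \<psi> minus_one_in_neg_orthant])
  \<comment> \<open>This dominates the deviation at every time up to \<open>h\<close>, because
    \<open>\<psi> (- 1) \<le> 0\<close> makes the right side monotone.\<close>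
  define w where "w h = e' + (B + norm x) * (1 - exp (h * \<psi> (- 1)))" for h
  have "((\<lambda>h. A * w h) \<longlongrightarrow> A * (e' + (B + norm x) * (1 - exp (0 * \<psi> (- 1))))) (at_right 0)"
    unfolding w_def by (intro tendsto_intros)
  then have "\<forall>\<^sub>F h in at_right 0. A * w h < e"
    by (rule order_tendstoD(2)) (use Ae e in auto)
  moreover have "\<forall>\<^sub>F h in at_right 0. h < \<delta> - t"
    using t by (intro order_tendstoD(2)[OF tendsto_ident_at]) simp
  moreover have "\<forall>\<^sub>F h::real in at_right 0. 0 < h" by (rule eventually_at_right_less)
  ultimately show "\<forall>\<^sub>F h in at_right 0. dist ((U h (U t x) - U t x) /\<^sub>R h) (V t x) < e"
  proof eventually_elim
    case (elim h)
    have est: "norm (U (t + h) x - U t x - h *\<^sub>R V t x) \<le> h * (K * J t * w h)"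
    proof (rule U_estimate)
      fix s assume s: "0 \<le> s" "s \<le> h"
      have "1 - exp (s * \<psi> (- 1)) \<le> 1 - exp (h * \<psi> (- 1))"
        using mult_right_mono_neg[OF s(2) np] by simp
      then have "(B + norm x) * (1 - exp (s * \<psi> (- 1))) \<le> (B + norm x) * (1 - exp (h * \<psi> (- 1)))"
        using B(1) by (intro mult_left_mono) auto
      then show "nu_integral \<psi> s (\<lambda>u. norm (T u x - x)) + norm x * (1 - exp (s * \<psi> (- 1))) \<le> w h"
        using B(2)[OF s(1)] by (simp add: w_def distrib_right)
    qed (use t elim in auto)
    have eq: "(U h (U t x) - U t x) /\<^sub>R h - V t x = (U (t + h) x - U t x - h *\<^sub>R V t x) /\<^sub>R h"
      using elim t by (simp add: U_add add.commute scaleR_diff_right)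
    have "norm ((U h (U t x) - U t x) /\<^sub>R h - V t x) = norm (U (t + h) x - U t x - h *\<^sub>R V t x) / h"
      unfolding eq norm_scaleR using elim by (simp add: divide_inverse mult.commute)
    also have "\<dots> \<le> (h * (K * J t * w h)) / h"
      using est elim by (intro divide_right_mono) auto
    also have "\<dots> = A * w h" using elim by (simp add: A_def)
    finally have "norm ((U h (U t x) - U t x) /\<^sub>R h - V t x) \<le> A * w h" .
    with elim show ?case by (simp add: dist_norm)
  qed
qed

end

section \<open>Products of commuting semigroups\<close>

lemma bounded_C0_semigroupE:
  assumes "bounded_C0_semigroup S"
  obtains M where "1 \<le> M" "\<And>t x. 0 \<le> t \<Longrightarrow> norm (S t x) \<le> M * norm x"
proof -
  obtain M where M: "\<And>t. 0 \<le> t \<Longrightarrow> onorm (S t) \<le> M" and bl: "\<And>t. 0 \<le> t \<Longrightarrow> bounded_linear (S t)"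
    using assms unfolding bounded_C0_semigroup_def bounded_clinear_def by blast
  show thesis
  proof (rule that[of "max 1 M"])
    fix t :: real and x assume t: "0 \<le> t"
    have "norm (S t x) \<le> onorm (S t) * norm x" by (rule onorm[OF bl[OF t]])
    also have "\<dots> \<le> max 1 M * norm x" using M[OF t] by (intro mult_right_mono) auto
    finally show "norm (S t x) \<le> max 1 M * norm x" .
  qed simp
qed

lemma bounded_linear_scaleC: "bounded_linear (scaleC c :: 'x::complex_banach \<Rightarrow> 'x)"
proof (rule bounded_linear_intro[where K="cmod c"])
  fix x :: 'x and r
  have "scaleC c (scaleC (complex_of_real r) x) = scaleC (complex_of_real r) (scaleC c x)"
    by (simp add: scaleC_scaleC mult.commute)
  then show "scaleC c (r *\<^sub>R x) = r *\<^sub>R scaleC c x" by (simp add: scaleC_of_real)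
qed (simp_all add: scaleC_add_right norm_scaleC mult.commute)

locale commuting_semigroups =
  fixes S :: "'n::finite \<Rightarrow> real \<Rightarrow> 'x::complex_banach \<Rightarrow> 'x"
  assumes S: "\<And>j. bounded_C0_semigroup (S j)"
    and comm: "\<And>j k s t. 0 \<le> s \<Longrightarrow> 0 \<le> t \<Longrightarrow> S j s \<circ> S k t = S k t \<circ> S j s"
begin

text \<open>Partial products, so that the properties of the full product follow by induction on the
  set of factors.\<close>

definition prod_on :: "'n set \<Rightarrow> real ^ 'n \<Rightarrow> 'x \<Rightarrow> 'x" where
  "prod_on F u x = Finite_Set.fold (\<lambda>j y. S j (u $ j) y) x F"

lemma prod_on_empty: "prod_on {} u x = x"
  by (simp add: prod_on_def)

lemma prod_on_insert:
  assumes u: "u \<in> nonneg_orthant" and "j \<notin> F"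
  shows "prod_on (insert j F) u x = S j (u $ j) (prod_on F u x)"
proof -
  interpret comp_fun_commute "\<lambda>j y. S j (u $ j) y"
    by unfold_locales (use u comm in \<open>simp add: nonneg_orthant_def\<close>)
  show ?thesis unfolding prod_on_def using assms(2) by (simp add: fold_insert)
qed

lemma S_clinear: "0 \<le> t \<Longrightarrow> bounded_clinear (S j t)"
  using S by (simp add: bounded_C0_semigroup_def)

text \<open>Serves to interleave the factors of two products in \<open>prod_on_add\<close>.\<close>

lemma S_prod_on:
  assumes u: "u \<in> nonneg_orthant" and r: "0 \<le> r"
  shows "S j r (prod_on F u x) = prod_on F u (S j r x)"
proof -
  have "finite F" by simp
  then show ?thesis
  proof (induction F rule: finite_induct)
    case (insert k F)
    have "0 \<le> u $ k" using u by (simp add: nonneg_orthant_def)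
    from fun_cong[OF comm[OF r this, of j k]] insert show ?case
      by (simp add: prod_on_insert[OF u])
  qed (simp add: prod_on_empty)
qed

lemma prod_on_clinear:
  assumes u: "u \<in> nonneg_orthant"
  shows "bounded_clinear (prod_on F u)"
proof -
  have "finite F" by simp
  then show ?thesis
  proof (induction F rule: finite_induct)
    case empty
    have "prod_on {} u = (\<lambda>x. x)" by (simp add: fun_eq_iff prod_on_empty)
    then show ?case by (simp add: bounded_clinear_def bounded_linear_ident)
  next
    case (insert k F)
    have "bounded_clinear (S k (u $ k))" using u by (intro S_clinear) (simp add: nonneg_orthant_def)
    moreover have "prod_on (insert k F) u = (\<lambda>x. S k (u $ k) (prod_on F u x))"
      using insert by (simp add: fun_eq_iff prod_on_insert[OF u])
    ultimately show ?case
      using insert.IH bounded_linear_compose by (auto simp: bounded_clinear_def)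
  qed
qed

lemma prod_on_zero: "prod_on F 0 x = x"
proof -
  have "finite F" by simp
  then show ?thesis
  proof (induction F rule: finite_induct)
    case (insert k F)
    then show ?case
      using S[of k] by (simp add: prod_on_insert[OF zero_in_nonneg_orthant] bounded_C0_semigroup_def)
  qed (simp add: prod_on_empty)
qed

lemma prod_on_add:
  assumes u: "u \<in> nonneg_orthant" and v: "v \<in> nonneg_orthant"
  shows "prod_on F (u + v) x = prod_on F u (prod_on F v x)"
proof -
  have "finite F" by simp
  then show ?thesis
  proof (induction F rule: finite_induct)
    case (insert k F)
    have uv: "0 \<le> u $ k" "0 \<le> v $ k" using u v by (auto simp: nonneg_orthant_def)
    then have "S k (u $ k + v $ k) = S k (u $ k) \<circ> S k (v $ k)"
      using S[of k] by (simp add: bounded_C0_semigroup_def)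
    then show ?case
      using insert
      by (simp add: prod_on_insert nonneg_orthant_add u v S_prod_on[OF u uv(2)])
  qed (simp add: prod_on_empty)
qed

lemma prod_on_bound: "\<exists>K\<ge>0. \<forall>u\<in>nonneg_orthant. \<forall>x. norm (prod_on F u x) \<le> K * norm x"
proof -
  have "finite F" by simp
  then show ?thesis
  proof (induction F rule: finite_induct)
    case empty
    show ?case by (intro exI[of _ 1]) (simp add: prod_on_empty)
  next
    case (insert k F)
    then obtain K where K: "0 \<le> K" "\<And>u x. u \<in> nonneg_orthant \<Longrightarrow> norm (prod_on F u x) \<le> K * norm x" by blast
    obtain M where M: "1 \<le> M" "\<And>t x. 0 \<le> t \<Longrightarrow> norm (S k t x) \<le> M * norm x"
      using bounded_C0_semigroupE[OF S] by blast
    have "norm (prod_on (insert k F) u x) \<le> (M * K) * norm x" if u: "u \<in> nonneg_orthant" for u x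
    proof -
      have "norm (prod_on (insert k F) u x) \<le> M * norm (prod_on F u x)"
        using insert.hyps u M(2) by (simp add: prod_on_insert nonneg_orthant_def)
      also have "\<dots> \<le> M * (K * norm x)" using M(1) K(2)[OF u] by (intro mult_left_mono) auto
      finally show ?thesis by (simp add: mult.assoc)
    qed
    then show ?case using M(1) K(1) by (intro exI[of _ "M * K"]) auto
  qed
qed

text \<open>Strong continuity passes to products through uniform boundedness: the change of the
  argument costs at most the factor \<open>M\<close>, and for a fixed argument the orbit of the new
  factor is continuous.\<close>

lemma prod_on_continuous: "continuous_on nonneg_orthant (\<lambda>u. prod_on F u x)"
proof -
  have "finite F" by simp
  then show ?thesis
  proof (induction F rule: finite_induct)
    case empty
    show ?case by (simp add: prod_on_empty)
  next
    case (insert k F)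
    obtain M where M: "1 \<le> M" "\<And>t x. 0 \<le> t \<Longrightarrow> norm (S k t x) \<le> M * norm x"
      using bounded_C0_semigroupE[OF S] by blast
    have "continuous_on nonneg_orthant (\<lambda>u. S k (u $ k) (prod_on F u x))"
      unfolding continuous_on_def
    proof
      fix u :: "real ^ 'n" assume u: "u \<in> nonneg_orthant"
      let ?F = "at u within nonneg_orthant"
      let ?y = "prod_on F u x"
      have in_O: "\<forall>\<^sub>F v in ?F. v \<in> nonneg_orthant" by (auto simp: eventually_at_filter)
      have "((\<lambda>v. prod_on F v x) \<longlongrightarrow> ?y) ?F"
        using insert.IH u by (simp add: continuous_on_def)
      then have "((\<lambda>v. M * norm (prod_on F v x - ?y)) \<longlongrightarrow> M * norm (?y - ?y)) ?F"
        by (intro tendsto_intros)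
      then have lim0: "((\<lambda>v. M * norm (prod_on F v x - ?y)) \<longlongrightarrow> 0) ?F" by simp
      have "((\<lambda>v. S k (v $ k) (prod_on F v x) - S k (v $ k) ?y) \<longlongrightarrow> 0) ?F"
      proof (rule Lim_null_comparison[OF _ lim0])
        show "\<forall>\<^sub>F v in ?F. norm (S k (v $ k) (prod_on F v x) - S k (v $ k) ?y) \<le> M * norm (prod_on F v x - ?y)"
          using in_O
        proof eventually_elim
          case (elim v)
          then have v: "0 \<le> v $ k" by (simp add: nonneg_orthant_def)
          have "S k (v $ k) (prod_on F v x) - S k (v $ k) ?y = S k (v $ k) (prod_on F v x - ?y)"
            using S_clinear[OF v, of k] by (simp add: bounded_clinear_def linear_diff bounded_linear.linear)
          then show ?case using M(2)[OF v] by simp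
        qed
      qed
      moreover have "((\<lambda>v. S k (v $ k) ?y) \<longlongrightarrow> S k (u $ k) ?y) ?F"
      proof (rule continuous_on_tendsto_compose[where f="\<lambda>t. S k t ?y" and s="{0..}"])
        show "continuous_on {0..} (\<lambda>t. S k t ?y)" using S[of k] by (simp add: bounded_C0_semigroup_def)
        show "((\<lambda>v. v $ k) \<longlongrightarrow> u $ k) ?F" by (intro tendsto_intros)
        show "u $ k \<in> {0..}" using u by (simp add: nonneg_orthant_def)
        show "\<forall>\<^sub>F v in ?F. v $ k \<in> {0..}" using in_O by eventually_elim (simp add: nonneg_orthant_def)
      qed
      ultimately have "((\<lambda>v. (S k (v $ k) (prod_on F v x) - S k (v $ k) ?y) + S k (v $ k) ?y) \<longlongrightarrow> 0 + S k (u $ k) ?y) ?F"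
        by (rule tendsto_add)
      then show "((\<lambda>v. S k (v $ k) (prod_on F v x)) \<longlongrightarrow> S k (u $ k) ?y) ?F" by simp
    qed
    then show ?case
      by (rule continuous_on_eq) (use insert.hyps in \<open>simp add: prod_on_insert\<close>)
  qed
qed

lemma orthant_semigroup_prod: "\<exists>K. orthant_semigroup (prod_on UNIV) K"
proof -
  obtain K where "0 \<le> K" "\<And>u x. u \<in> nonneg_orthant \<Longrightarrow> norm (prod_on UNIV u x) \<le> K * norm x"
    using prod_on_bound[of UNIV] by blast
  then have "orthant_semigroup (prod_on UNIV) K"
    using prod_on_clinear
    by (intro orthant_semigroup.intro) (auto simp: prod_on_zero prod_on_add prod_on_continuous bounded_clinear_def)
  then show ?thesis by blast
qed

end

section \<open>From the hypotheses to property (Y)\<close>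

lemma mass_density_fn_le:
  fixes p :: "real ^ 'n::finite \<Rightarrow> complex"
  assumes p: "integrable lborel p" and AE: "AE u in lborel. u \<notin> nonneg_orthant \<longrightarrow> p u = 0"
  shows "orthant_density (density_fn p)"
    and "orthant_density.mass (density_fn p) \<le> (LINT u:nonneg_orthant|lborel. cmod (p u))"
proof -
  let ?c = "(2 * pi) powr (- real CARD('n) / 2)"
  \<comment> \<open>The normalising factor is at most 1, so the mass is bounded by the integral of
    \<open>cmod (p u)\<close> itself.\<close>
  have c: "0 < ?c" "?c \<le> 1"
  proof -
    have "1 \<le> (2 * pi) powr (real CARD('n) / 2)"
      using pi_gt3 by (intro ge_one_powr_ge_zero) auto
    then show "?c \<le> 1" by (simp add: powr_minus inverse_le_1_iff)
  qed simp
  have i: "integrable lborel (density_fn p)"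
    unfolding density_fn_def using p by simp
  show od: "orthant_density (density_fn p)"
    by unfold_locales (use i AE in \<open>auto simp: density_fn_def elim!: eventually_mono\<close>)
  have "orthant_density.mass (density_fn p) = (LINT u|lborel. \<bar>density_fn p u\<bar>)"
    by (rule orthant_density.mass_def[OF od])
  also have "\<dots> \<le> (LINT u|lborel. indicator nonneg_orthant u *\<^sub>R cmod (p u))"
  proof (rule integral_mono_AE)
    show "integrable lborel (\<lambda>u. \<bar>density_fn p u\<bar>)" using i by simp
    show "integrable lborel (\<lambda>u. indicator nonneg_orthant u *\<^sub>R cmod (p u))"
      using p by (intro integrable_mult_indicator) auto
    show "AE u in lborel. \<bar>density_fn p u\<bar> \<le> indicator nonneg_orthant u *\<^sub>R cmod (p u)"
      using AE
    proof eventually_elim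
      case (elim u)
      have "\<bar>density_fn p u\<bar> = ?c * \<bar>Re (p u)\<bar>" using c by (simp add: density_fn_def abs_mult)
      also have "\<dots> \<le> 1 * cmod (p u)" using c abs_Re_le_cmod by (intro mult_mono) auto
      finally show ?case using elim by (auto simp: indicator_def)
    qed
  qed
  finally show "orthant_density.mass (density_fn p) \<le> (LINT u:nonneg_orthant|lborel. cmod (p u))"
    by (simp add: set_lebesgue_integral_def)
qed

lemma Limsup_at_right_finiteE:
  fixes f :: "real \<Rightarrow> real"
  assumes "Limsup (at_right 0) (\<lambda>t. ereal (f t)) < \<infinity>"
  obtains \<delta> C where "0 < \<delta>" "\<And>t. 0 < t \<Longrightarrow> t < \<delta> \<Longrightarrow> f t \<le> C"
proof -
  obtain n :: nat where "Limsup (at_right 0) (\<lambda>t. ereal (f t)) < ereal (real n)"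
    using less_PInf_Ex_of_nat assms by auto
  then have "\<forall>\<^sub>F t in at_right 0. ereal (f t) < ereal (real n)" by (rule Limsup_lessD)
  then obtain b where "b > 0" "\<And>t. 0 < t \<Longrightarrow> t < b \<Longrightarrow> f t < real n"
    unfolding eventually_at_right_field by auto
  then show thesis by (intro that[of b "real n"]) (auto intro: less_imp_le)
qed

lemma generator_apply: "(x, y) \<in> generator U \<Longrightarrow> op_apply (generator U) x = y"
  unfolding op_apply_def generator_def
  by (intro the_equality) (auto intro: tendsto_unique[OF trivial_limit_at_right_real])

theorem theorem5p2:
  fixes \<psi> :: "real ^ 'n::finite \<Rightarrow> real"
    and p :: "real \<Rightarrow> real ^ 'n \<Rightarrow> complex"
  assumes "\<psi> \<in> T0_class"
    and "\<And>t. t > 0 \<Longrightarrow> has_fourier_transform (F_fun \<psi> t) (p t)"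
    and "\<And>t. t > 0 \<Longrightarrow> integrable lborel (p t)"
    and "\<And>t. t > 0 \<Longrightarrow> AE u in lborel. u \<notin> nonneg_orthant \<longrightarrow> p t u = 0"
    and "Limsup (at_right 0) (\<lambda>t. ereal (t * (LINT u:nonneg_orthant|lborel. cmod (p t u)))) < \<infinity>"
  shows "\<psi> \<in> TY_class TYPE('x::complex_banach)"
  unfolding TY_class_def
proof (intro CollectI conjI allI impI)
  show "\<psi> \<in> T0_class" by fact
  define J where "J t = (LINT u:nonneg_orthant|lborel. cmod (p t u))" for t
  define q where "q t = density_fn (p t)" for t
  obtain \<delta> C where \<delta>: "0 < \<delta>" and C: "\<And>t. 0 < t \<Longrightarrow> t < \<delta> \<Longrightarrow> t * J t \<le> C"
    using Limsup_at_right_finiteE[OF assms(5)] unfolding J_def by blast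
  have nu: "nu_derivative \<psi> q J \<delta> C"
  proof (rule nu_derivative.intro)
    show "\<psi> \<in> T0_class" by fact
    show "orthant_density (q t)" "orthant_density.mass (q t) \<le> J t" if "0 < t" for t
      using mass_density_fn_le[OF assms(3)[OF that] assms(4)[OF that]] by (auto simp: q_def J_def)
    show "((\<lambda>t. LINT u|nu \<psi> t. gauss s u) has_real_derivative (LINT u|lborel. gauss s u * q t u)) (at t)"
      if "\<And>j. 0 < s $ j" "0 < t" for s t
      unfolding q_def by (rule derivative_integral_gauss_nu[OF assms(1-3) that])
  qed (fact \<delta> C)+
  fix A :: "'n \<Rightarrow> 'x unbounded_op" assume A: "commuting_generators A"
  define S where "S j = semigroup_of (A j)" for j
  have "\<exists>T. generates (A j) T" for j using A by (simp add: commuting_generators_def)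
  then have "generates (A j) (S j)" for j
    unfolding S_def semigroup_of_def by (rule someI_ex)
  then interpret S: commuting_semigroups S
    using A by unfold_locales (auto simp: generates_def commuting_generators_def S_def)
  obtain K where "orthant_semigroup (S.prod_on UNIV) K"
    using S.orthant_semigroup_prod by blast
  then interpret subordinate_derivative "S.prod_on UNIV" K \<psi> q J \<delta> C
    by (intro subordinate_derivative.intro subordinate_semigroup.intro subordinate_semigroup_axioms.intro assms(1) nu)
  have multi: "multi_semigroup A = S.prod_on UNIV"
    by (simp add: fun_eq_iff multi_semigroup_def S.prod_on_def S_def)
  have g: "g_semigroup \<psi> A = U"
    by (simp add: fun_eq_iff g_semigroup_def U_def orthant_integral_def multi)
  \<comment> \<open>The locales treat real Banach spaces; homogeneity for complex scalars follows
    because \<open>scaleC c\<close> is a bounded real-linear map and passes through the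
    integral.\<close>
  have scaleC: "U t (scaleC c x) = scaleC c (U t x)" if t: "0 \<le> t" for t c x
  proof -
    have "U t (scaleC c x) = nu_integral \<psi> t (\<lambda>u. scaleC c (S.prod_on UNIV u x))"
      unfolding U_def using S.prod_on_clinear by (intro orthant_integral_cong) (auto simp: bounded_clinear_def)
    also have "\<dots> = scaleC c (U t x)"
      unfolding U_def
      by (rule orthant_measure.orthant_integral_bounded_linear[OF orthant_measure_nu[OF \<psi> t] bounded_linear_scaleC T_bcont])
    finally show ?thesis .
  qed
  have semi: "bounded_C0_semigroup U"
    unfolding bounded_C0_semigroup_def bounded_clinear_def
  proof (intro conjI allI impI)
    show "U 0 = id" by (simp add: fun_eq_iff U_zero)
    show "\<exists>M. \<forall>t\<ge>0. onorm (U t) \<le> M"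
      using U_bound K_nonneg by (intro exI[of _ K] allI impI onorm_bound) auto
  qed (auto simp: U_linear scaleC U_add U_continuous)
  have gen: "(U t x, V t x) \<in> generator U" if "0 < t" "t < \<delta>" for t x
    unfolding generator_def using U_right_derivative[OF that] by simp
  have "condition_Y (generator U) U"
    unfolding condition_Y_def
  proof (intro conjI allI impI)
    fix t :: real assume t: "0 < t"
    show "range (U t) \<subseteq> Domain (generator U)"
    proof clarify
      fix x
      \<comment> \<open>The derivative is known only below \<open>\<delta>\<close>. For larger times
        the semigroup law splits off a factor at the admissible time \<open>r\<close>, whose range
        lies in the domain of the generator.\<close>
      define r where "r = min t (\<delta> / 2)"
      have r: "0 < r" "r < \<delta>" "r \<le> t" using t \<delta> by (auto simp: r_def)
      have "U t x = U r (U (t - r) x)" using r by (simp add: U_add)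
      then show "U t x \<in> Domain (generator U)" using gen[OF r(1,2)] by auto
    qed
  next
    have "\<forall>\<^sub>F t in at_right 0. ereal (t * onorm (\<lambda>x. op_apply (generator U) (U t x))) \<le> ereal (K * C)"
      unfolding eventually_at_right_field
    proof (intro exI[of _ \<delta>] conjI allI impI \<delta>)
      fix t :: real assume t: "0 < t" "t < \<delta>"
      have "onorm (\<lambda>x. op_apply (generator U) (U t x)) = onorm (V t)"
        using generator_apply[OF gen[OF t]] by simp
      also have "\<dots> \<le> K * J t"
        using V_bound[OF t(1)] K_nonneg J_nonneg[OF t(1)] by (intro onorm_bound) auto
      finally have "t * onorm (\<lambda>x. op_apply (generator U) (U t x)) \<le> t * (K * J t)"
        using t by (intro mult_left_mono) auto
      also have "\<dots> = K * (t * J t)" by simp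
      also have "\<dots> \<le> K * C" using C[OF t] K_nonneg by (intro mult_left_mono)
      finally show "ereal (t * onorm (\<lambda>x. op_apply (generator U) (U t x))) \<le> ereal (K * C)" by simp
    qed
    then have "Limsup (at_right 0) (\<lambda>t. ereal (t * onorm (\<lambda>x. op_apply (generator U) (U t x)))) \<le> ereal (K * C)"
      by (rule Limsup_bounded)
    then show "Limsup (at_right 0) (\<lambda>t. ereal (t * onorm (\<lambda>x. op_apply (generator U) (U t x)))) < \<infinity>"
      using le_less_trans by fastforce
  qed
  with semi show "quasibounded_holomorphic (psi_op \<psi> A) (g_semigroup \<psi> A)"
    by (simp add: quasibounded_holomorphic_def generates_def psi_op_def g)
qed

end
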